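(* Let $n\ge 2$ and $1\le k\le n-1$ be integers, and let $g$ be a $U(n)$-invariant shrinking gradient Kähler-Ricci soliton on the compact complex manifold $M_k$ (the projective line bundle over $\mathbb{P}^{n-1}$ defined in the context). Then the Ricci curvature of $g$ is positive if and only if $k=1$.
   Context: A shrinking gradient Kähler-Ricci soliton on a compact complex manifold $M$ is a Kähler metric $g=(g_{i\bar j})$ for which there is a smooth real-valued function $f$ on $M$ with $R_{i\bar j}-g_{i\bar j}=f_{,i\bar j}$ and $f_{,ij}=0$, where $R_{i\bar j}=-\partial_i\partial_{\bar j}\log\det(g_{k\bar l})$ is the Ricci tensor and commas denote covariant derivatives with respect to $g$. The manifold $M_k$: let $z_1,\dots,z_n$ be homogeneous coordinates on $\mathbb{P}^{n-1}$ and $U_j=\{z_j\neq 0\}$. $M_k$ is the total space of the $\mathbb{P}^1$-bundle $\pi:M_k\to\mathbb{P}^{n-1}$ obtained by gluing the pieces $U_j\times\mathbb{P}^1$ with fibre coordinates $y_j\in\mathbb{P}^1=\mathbb{C}\cup\{\infty\}$ by $y_i=(z_i/z_j)^k y_j$ over $U_i\cap U_j$. Let $S_0=\{y_j=0\}$ and $S_\infty=\{y_j=\infty\}$. The complement $M_k\setminus(S_0\cup S_\infty)$ is parametrized by the $k$-to-one map $\mathbb{C}^n\setminus\{0\}\to M_k\setminus(S_0\cup S_\infty)$, $(z_1,\dots,z_n)\mapsto\big((z_i/z_j)_{i\ne j};\,y_j=z_j^k\big)$ (where $z_j\neq0$). The standard action of $U(n)$ on $\mathbb{C}^n\setminus\{0\}$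 induces an action of $U(n)$ on $M_k$ by automorphisms; $U(n)$-invariance of a metric refers to this action. Such a soliton exists on each $M_k$, $1\le k\le n-1$, and is unique up to pull-back by fibrewise dilations $y_j\mapsto\lambda y_j$, $\lambda>0$. *)

theory Defs
  imports "HOL-Analysis.Analysis"
begin

section \<open>Calculus on complex coordinate space\<close>

primrec cont_diff :: "nat \<Rightarrow> ('a::real_normed_vector \<Rightarrow> 'b::real_normed_vector) \<Rightarrow> bool" where
  "cont_diff 0 F \<longleftrightarrow> continuous_on UNIV F"
| "cont_diff (Suc m) F \<longleftrightarrow>
     (\<forall>x. F differentiable (at x)) \<and> (\<forall>v. cont_diff m (\<lambda>x. frechet_derivative F (at x) v))"

definition smooth :: "('a::real_normed_vector \<Rightarrow> 'b::real_normed_vector) \<Rightarrow> bool" where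
  "smooth F \<longleftrightarrow> (\<forall>m. cont_diff m F)"

text \<open>The Wirtinger derivatives with respect to the \<open>a\<close>-th complex coordinate and its conjugate.\<close>

definition d_hol :: "'n \<Rightarrow> (complex ^ 'n::finite \<Rightarrow> complex) \<Rightarrow> complex ^ 'n \<Rightarrow> complex" where
  "d_hol a F u =
     (frechet_derivative F (at u) (axis a 1) - \<i> * frechet_derivative F (at u) (axis a \<i>)) / 2"

definition d_bar :: "'n \<Rightarrow> (complex ^ 'n::finite \<Rightarrow> complex) \<Rightarrow> complex ^ 'n \<Rightarrow> complex" where
  "d_bar a F u =
     (frechet_derivative F (at u) (axis a 1) + \<i> * frechet_derivative F (at u) (axis a \<i>)) / 2"

text \<open>The matrix \<open>G\<close> with entries \<open>G $ i $ j\<close> (the components of type \<open>i, j-bar\<close>)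
  encodes the sesquilinear form \<open>\<Sum>i j. G $ i $ j * v\<^sub>i * cnj v\<^sub>j\<close>.\<close>

definition positive_form :: "complex ^ 'n ^ 'n::finite \<Rightarrow> bool" where
  "positive_form G \<longleftrightarrow>
     (\<forall>v. v \<noteq> 0 \<longrightarrow> 0 < Re (\<Sum>i\<in>UNIV. \<Sum>j\<in>UNIV. G $ i $ j * v $ i * cnj (v $ j)))"

definition hermitian_matrix :: "complex ^ 'n ^ 'n::finite \<Rightarrow> bool" where
  "hermitian_matrix G \<longleftrightarrow> (\<forall>i j. G $ j $ i = cnj (G $ i $ j))"

definition unitary_matrix :: "complex ^ 'n ^ 'n::finite \<Rightarrow> bool" where
  "unitary_matrix A \<longleftrightarrow> (\<chi> i j. cnj (A $ j $ i)) ** A = mat 1"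

text \<open>Components of the pull-back of a form of type \<open>(1,1)\<close> under a holomorphic map \<open>\<phi>\<close>.\<close>

definition pullback_form ::
  "(complex ^ 'n \<Rightarrow> complex ^ 'n) \<Rightarrow> (complex ^ 'n \<Rightarrow> complex ^ 'n ^ 'n)
     \<Rightarrow> complex ^ 'n \<Rightarrow> complex ^ 'n ^ 'n::finite" where
  "pullback_form \<phi> G u =
     (\<chi> a b. \<Sum>p\<in>UNIV. \<Sum>q\<in>UNIV.
        d_hol a (\<lambda>v. \<phi> v $ p) u * G (\<phi> u) $ p $ q * cnj (d_hol b (\<lambda>v. \<phi> v $ q) u))"

section \<open>The manifold \<open>M\<^sub>k\<close>\<close>

text \<open>The index type \<open>'n\<close> labels the homogeneous coordinates, so \<open>n = CARD('n)\<close>.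
  Each piece \<open>U\<^sub>j \<times> P\<^sup>1\<close> is covered by two charts, both with range the whole of \<open>complex ^ 'n\<close>:
  in \<open>(j, False)\<close> a point \<open>u\<close> has \<open>u $ i = z\<^sub>i / z\<^sub>j\<close> for \<open>i \<noteq> j\<close> and \<open>u $ j = y\<^sub>j\<close>;
  in \<open>(j, True)\<close> the \<open>j\<close>-th entry is \<open>1 / y\<^sub>j\<close> instead.\<close>

type_synonym 'n chart = "'n \<times> bool"

text \<open>The representative of the base point normalised by \<open>z\<^sub>j = 1\<close>.\<close>

definition hom_coords :: "'n chart \<Rightarrow> complex ^ 'n \<Rightarrow> complex ^ 'n::finite" where
  "hom_coords c u = (\<chi> i. if i = fst c then 1 else u $ i)"

text \<open>For a nonzero vector \<open>z\<close> and \<open>t \<in> P\<^sup>1\<close>, consider the point over \<open>[z]\<close> with fibre coordinates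
  \<open>y\<^sub>i = z\<^sub>i\<^sup>k t\<close>; this is compatible with \<open>y\<^sub>i = (z\<^sub>i / z\<^sub>j)\<^sup>k y\<^sub>j\<close>.
  Here \<open>t\<close> is given by \<open>s\<close>, where \<open>t = s\<close> if \<open>b\<close> is false and \<open>t = 1 / s\<close> if \<open>b\<close> is true.
  The next two definitions say when the point lies in the chart \<open>d\<close>, and what its coordinates are.\<close>

definition in_chart :: "'n chart \<Rightarrow> complex ^ 'n::finite \<Rightarrow> bool \<Rightarrow> complex \<Rightarrow> bool" where
  "in_chart d z b s \<longleftrightarrow> z $ fst d \<noteq> 0 \<and> (b = snd d \<or> s \<noteq> 0)"

definition chart_coords ::
  "nat \<Rightarrow> 'n chart \<Rightarrow> complex ^ 'n \<Rightarrow> bool \<Rightarrow> complex \<Rightarrow> complex ^ 'n::finite" where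
  "chart_coords k d z b s =
     (let i = fst d; w = (if b then s / z $ i ^ k else z $ i ^ k * s)
      in \<chi> l. if l = i then (if b = snd d then w else inverse w) else z $ l / z $ i)"

definition overlap :: "'n chart \<Rightarrow> 'n chart \<Rightarrow> (complex ^ 'n::finite) set" where
  "overlap c d = {u. in_chart d (hom_coords c u) (snd c) (u $ fst c)}"

definition transition :: "nat \<Rightarrow> 'n chart \<Rightarrow> 'n chart \<Rightarrow> complex ^ 'n \<Rightarrow> complex ^ 'n::finite" where
  "transition k c d u = chart_coords k d (hom_coords c u) (snd c) (u $ fst c)"

type_synonym 'n chart_point = "'n chart \<times> (complex ^ 'n)"

definition glue :: "nat \<Rightarrow> (('n::finite) chart_point \<times> 'n chart_point) set" where
  "glue k = {((c, u), (d, v)). u \<in> overlap c d \<and> v = transition k c d u}"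

definition Mk :: "nat \<Rightarrow> ('n::finite) chart_point set set" where
  "Mk k = UNIV // glue k"

definition point :: "nat \<Rightarrow> 'n chart \<Rightarrow> complex ^ 'n \<Rightarrow> ('n::finite) chart_point set" where
  "point k c u = glue k `` {(c, u)}"

definition smooth_on_Mk :: "nat \<Rightarrow> (('n::finite) chart_point set \<Rightarrow> real) \<Rightarrow> bool" where
  "smooth_on_Mk k f \<longleftrightarrow> (\<forall>c. smooth (\<lambda>u. f (point k c u)))"

text \<open>The automorphism of \<open>M\<^sub>k\<close> induced by a linear map \<open>A\<close> sends the point given by \<open>z\<close> and \<open>t\<close>
  to the point given by \<open>A z\<close> and \<open>t\<close>. Its expression from the chart \<open>c\<close> to the chart \<open>d\<close>
  is defined on \<open>act_dom A c d\<close>.\<close>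

definition act_dom :: "complex ^ 'n ^ 'n \<Rightarrow> 'n chart \<Rightarrow> 'n chart \<Rightarrow> (complex ^ 'n::finite) set" where
  "act_dom A c d = {u. in_chart d (A *v hom_coords c u) (snd c) (u $ fst c)}"

definition act_map ::
  "nat \<Rightarrow> complex ^ 'n ^ 'n \<Rightarrow> 'n chart \<Rightarrow> 'n chart \<Rightarrow> complex ^ 'n \<Rightarrow> complex ^ 'n::finite" where
  "act_map k A c d u = chart_coords k d (A *v hom_coords c u) (snd c) (u $ fst c)"

section \<open>Metrics, curvature and solitons\<close>

text \<open>A tensor field of type \<open>i, j-bar\<close> on \<open>M\<^sub>k\<close> is given by its components in all charts, subject to
  the transformation law \<open>is_tensor\<close>.\<close>

type_synonym 'n form_field = "'n chart \<Rightarrow> complex ^ 'n \<Rightarrow> complex ^ 'n ^ 'n"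

definition is_tensor :: "nat \<Rightarrow> ('n::finite) form_field \<Rightarrow> bool" where
  "is_tensor k g \<longleftrightarrow>
     (\<forall>c d. \<forall>u\<in>overlap c d. g c u = pullback_form (transition k c d) (g d) u)"

text \<open>The last condition is that the fundamental form is closed.\<close>

definition kahler_metric :: "nat \<Rightarrow> ('n::finite) form_field \<Rightarrow> bool" where
  "kahler_metric k g \<longleftrightarrow>
     is_tensor k g \<and>
     (\<forall>c. smooth (g c)) \<and>
     (\<forall>c u. hermitian_matrix (g c u) \<and> positive_form (g c u)) \<and>
     (\<forall>c u i j l. d_hol l (\<lambda>v. g c v $ i $ j) u = d_hol i (\<lambda>v. g c v $ l $ j) u)"

definition U_invariant :: "nat \<Rightarrow> ('n::finite) form_field \<Rightarrow> bool" where
  "U_invariant k g \<longleftrightarrow>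
     (\<forall>A. unitary_matrix A \<longrightarrow>
        (\<forall>c d. \<forall>u\<in>act_dom A c d. g c u = pullback_form (act_map k A c d) (g d) u))"

text \<open>For a metric the determinant is a positive real number, so \<open>ln\<close> is the real logarithm here.\<close>

definition ricci :: "('n::finite) form_field \<Rightarrow> 'n form_field" where
  "ricci g c u =
     (\<chi> i j. - d_hol i (\<lambda>v. d_bar j (\<lambda>w. ln (det (g c w))) v) u)"

text \<open>With the inverse metric normalised by
  \<open>\<Sum>q. ginv p q * g l q = \<delta>\<^sub>p\<^sub>l\<close>, the only Christoffel symbols of a Kaehler metric,
  up to conjugation, are \<open>\<Gamma>\<^sup>p\<^sub>i\<^sub>j = \<Sum>q. ginv p q * \<partial>\<^sub>i g j q\<close>.\<close>

definition christoffel :: "('n::finite) form_field \<Rightarrow> 'n chart \<Rightarrow> complex ^ 'n \<Rightarrow> 'n \<Rightarrow> 'n \<Rightarrow> 'n \<Rightarrow> complex" where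
  "christoffel g c u p i j =
     (\<Sum>q\<in>UNIV. matrix_inv (transpose (g c u)) $ p $ q * d_hol i (\<lambda>v. g c v $ j $ q) u)"

text \<open>The second covariant derivatives of a function \<open>F\<close> expressed in the chart \<open>c\<close>. As the mixed
  Christoffel symbols of a Kaehler metric vanish, the one of type \<open>i, j-bar\<close> does not involve \<open>g\<close>.\<close>

definition hess_mixed :: "(complex ^ 'n::finite \<Rightarrow> complex) \<Rightarrow> complex ^ 'n \<Rightarrow> 'n \<Rightarrow> 'n \<Rightarrow> complex" where
  "hess_mixed F u i j = d_bar j (\<lambda>v. d_hol i F v) u"

definition hess_hol ::
  "('n::finite) form_field \<Rightarrow> 'n chart \<Rightarrow> (complex ^ 'n \<Rightarrow> complex) \<Rightarrow> complex ^ 'n \<Rightarrow> 'n \<Rightarrow> 'n \<Rightarrow> complex"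
  where
  "hess_hol g c F u i j =
     d_hol j (\<lambda>v. d_hol i F v) u - (\<Sum>p\<in>UNIV. christoffel g c u p i j * d_hol p F u)"

definition shrinking_gradient_KR_soliton :: "nat \<Rightarrow> ('n::finite) form_field \<Rightarrow> bool" where
  "shrinking_gradient_KR_soliton k g \<longleftrightarrow>
     kahler_metric k g \<and>
     (\<exists>f. smooth_on_Mk k f \<and>
        (\<forall>c u i j.
           ricci g c u $ i $ j - g c u $ i $ j =
             hess_mixed (\<lambda>v. complex_of_real (f (point k c v))) u i j \<and>
           hess_hol g c (\<lambda>v. complex_of_real (f (point k c v))) u i j = 0))"

definition positive_ricci :: "('n::finite) form_field \<Rightarrow> bool" where
  "positive_ricci g \<longleftrightarrow> (\<forall>c u. positive_form (ricci g c u))"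

section \<open>Consistency of the gluing and of the action\<close>

lemma in_chart_self: "in_chart c (hom_coords c u) (snd c) (u $ fst c)"
  by (simp add: in_chart_def hom_coords_def)

lemma chart_coords_self: "chart_coords k c (hom_coords c u) (snd c) (u $ fst c) = u"
  by (simp add: chart_coords_def hom_coords_def vec_eq_iff Let_def)

lemma hom_coords_chart_coords:
  assumes "z $ fst d \<noteq> 0"
  shows "hom_coords d (chart_coords k d z b s) = (\<chi> l. z $ l / z $ fst d)"
  using assms by (auto simp: chart_coords_def hom_coords_def vec_eq_iff Let_def)

lemma in_chart_chart_coords:
  assumes "in_chart d z b s" "in_chart e (A *v z) b s"
  shows "in_chart e (A *v hom_coords d (chart_coords k d z b s)) (snd d) (chart_coords k d z b s $ fst d)"
    and "chart_coords k e (A *v hom_coords d (chart_coords k d z b s)) (snd d)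
           (chart_coords k d z b s $ fst d) = chart_coords k e (A *v z) b s"
proof -
  have z: "z $ fst d \<noteq> 0" and az: "(A *v z) $ fst e \<noteq> 0"
    using assms by (auto simp: in_chart_def)
  have lin: "(A *v hom_coords d (chart_coords k d z b s)) $ l = (A *v z) $ l / z $ fst d" for l
    unfolding hom_coords_chart_coords[OF z]
    by (simp add: matrix_vector_mult_def sum_divide_distrib)
  show "in_chart e (A *v hom_coords d (chart_coords k d z b s)) (snd d) (chart_coords k d z b s $ fst d)"
    unfolding in_chart_def lin
    using assms z az by (auto simp: in_chart_def chart_coords_def Let_def)
  show "chart_coords k e (A *v hom_coords d (chart_coords k d z b s)) (snd d)
           (chart_coords k d z b s $ fst d) = chart_coords k e (A *v z) b s"
    unfolding chart_coords_def[of k e] lin Let_def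
    using assms z az
    by (auto simp: in_chart_def chart_coords_def Let_def vec_eq_iff power_divide field_simps)
qed

lemma equiv_glue: "equiv UNIV (glue k :: (('n::finite) chart_point \<times> 'n chart_point) set)"
proof (rule equivI)
  show "glue k \<subseteq> UNIV \<times> UNIV" by simp
  show "refl_on UNIV (glue k :: ('n chart_point \<times> 'n chart_point) set)"
    by (auto simp: refl_on_def glue_def overlap_def transition_def in_chart_self chart_coords_self)
  show "sym (glue k :: ('n chart_point \<times> 'n chart_point) set)"
  proof (rule symI)
    fix x y :: "'n chart_point" assume xy: "(x, y) \<in> glue k"
    obtain c u d v where [simp]: "x = (c, u)" "y = (d, v)"
      by (metis surj_pair)
    have yx: "in_chart d (hom_coords c u) (snd c) (u $ fst c)"
      and v: "v = chart_coords k d (hom_coords c u) (snd c) (u $ fst c)"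
      using xy by (auto simp: glue_def overlap_def transition_def)
    show "(y, x) \<in> glue k"
      using in_chart_chart_coords[where A = "mat 1", OF yx, of c k] in_chart_self[of c u]
      by (simp add: glue_def overlap_def transition_def v chart_coords_self)
  qed
  show "trans (glue k :: ('n chart_point \<times> 'n chart_point) set)"
  proof (rule transI)
    fix x y w :: "'n chart_point"
    assume xy: "(x, y) \<in> glue k" and yw: "(y, w) \<in> glue k"
    obtain c u d v e r where [simp]: "x = (c, u)" "y = (d, v)" "w = (e, r)"
      by (metis surj_pair)
    have yx: "in_chart d (hom_coords c u) (snd c) (u $ fst c)"
      and v: "v = chart_coords k d (hom_coords c u) (snd c) (u $ fst c)"
      using xy by (auto simp: glue_def overlap_def transition_def)
    have e: "in_chart e (hom_coords d v) (snd d) (v $ fst d)"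
      and r: "r = chart_coords k e (hom_coords d v) (snd d) (v $ fst d)"
      using yw by (auto simp: glue_def overlap_def transition_def)
    have z: "hom_coords c u $ fst d \<noteq> 0" using yx by (simp add: in_chart_def)
    have "in_chart e (hom_coords c u) (snd c) (u $ fst c)"
      using e yx z unfolding v hom_coords_chart_coords[OF z]
      by (auto simp: in_chart_def chart_coords_def Let_def split: if_splits)
    then show "(x, w) \<in> glue k"
      using in_chart_chart_coords(2)[where A = "mat 1", OF yx, of e k] r
      by (simp add: glue_def overlap_def transition_def v)
  qed
qed

text \<open>The parametrisation of the complement of \<open>S\<^sub>0\<close> and \<open>S\<^sub>\<infinity>\<close>: in every chart, the point
  \<open>((z\<^sub>i / z\<^sub>j)\<^sub>i; y\<^sub>j = z\<^sub>j\<^sup>k)\<close> is given by \<open>z\<close> and \<open>t = 1\<close>. It intertwines the linear action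
  with \<open>act_map\<close>.\<close>

lemma parametrisation_coords:
  "chart_coords k (j, False) z False 1 = (\<chi> i. if i = j then z $ j ^ k else z $ i / z $ j)"
  by (simp add: chart_coords_def vec_eq_iff Let_def)

lemma parametrisation_equivariant:
  assumes "z $ fst c \<noteq> 0" "(A *v z) $ fst d \<noteq> 0"
  shows "chart_coords k c z False 1 \<in> act_dom A c d"
    and "act_map k A c d (chart_coords k c z False 1) = chart_coords k d (A *v z) False 1"
  using in_chart_chart_coords[where A = A and d = c and e = d and z = z and b = False and s = 1 and k = k] assms
  by (auto simp: act_dom_def act_map_def in_chart_def)

end

theory Submission
  imports Defs "HOL-Complex_Analysis.Cauchy_Integral_Formula"
begin

text \<open>By invariance the metric is determined along the fibre \<open>w = 0\<close> by two radial functions,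
  \<open>alpha\<close> (horizontal) and \<open>beta\<close> (vertical), and \<open>det g\<close> is explicit in them, hence so is the Ricci form.
  The potential \<open>f\<close> need not be assumed invariant: \<open>f(\<theta>y) - f(y)\<close> is harmonic and bounded on the fibre, so
  Liouville's theorem makes \<open>f\<close> radial there, and \<open>f\<^sub>,\<^sub>i\<^sub>j = 0\<close> then makes its gradient a multiple of \<open>y \<partial>\<^sub>y\<close>.
  On the zero and infinity sections the equation has a bounded \<open>f\<close> with \<open>i \<partial>\<partial>-bar f\<close> a multiple of the
  Fubini-Study form; Liouville again forces that multiple to vanish, which fixes
  \<open>alpha = n - k\<close> on \<open>S\<^sub>0\<close> and \<open>alpha = n + k\<close> on \<open>S\<^sub>\<infinity>\<close>.

  Taking \<open>x = alpha\<close> as coordinate and \<open>P = d alpha / dt\<close>, \<open>t = ln |z|\<^sup>2\<close>, the soliton equation becomes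
  \<open>P' + ((n - 1) / x + c) P = n - x\<close> on \<open>[n - k, n + k]\<close> with \<open>P = 0\<close> at both ends, and the Ricci form is positive
  iff \<open>x + c P > 0\<close> and \<open>1 + c P' > 0\<close>. The end \<open>x = n - k\<close>, where \<open>P' = k\<close>, gives the condition \<open>1 + k c > 0\<close>, which
  conversely suffices by a first-touching argument. The boundary values say that
  \<open>(n - x) x\<^sup>n\<^sup>-\<^sup>1 e\<^sup>c\<^sup>x\<close> has integral \<open>0\<close>, which gives \<open>c > -1\<close> for \<open>k = 1\<close> and \<open>c \<le> -1 / k\<close> for \<open>k \<ge> 2\<close>.\<close>

subsection \<open>Wirtinger derivatives\<close>

text \<open>The Ricci form differentiates \<open>det g\<close> twice, also in horizontal directions,
  so the metric on the fibre \<open>w = 0\<close> alone is not enough: an explicit unitary matrix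
  carries each point to that fibre, and the Jacobian of this motion gives \<open>det g\<close> on
  the whole chart. On the fibre the gradient of \<open>f\<close> is a real multiple of
  \<open>y d/dy\<close>; the constant \<open>c\<close> of the overview is this multiple divided by
  \<open>k\<close>. It is known only through the integral condition, and the question is on which
  side of \<open>-1/k\<close> it lies. For \<open>k \<ge> 2\<close> and \<open>c > -1/k\<close> the
  weight is above its value at \<open>n\<close> to the right of \<open>n\<close> and below it to the
  left, which the integral condition forbids. No monotonicity of \<open>dP/dx\<close> is at hand, so
  the bound \<open>1 + c P' > 0\<close> cannot be read off at the ends; this is why it needs an
  argument at a first touching point.\<close>

text \<open>\<open>p\<close> and \<open>q\<close> are the derivatives with respect to the coordinates and to their conjugates.\<close>

definition wirtinger1 :: "(complex \<Rightarrow> complex) \<Rightarrow> complex \<Rightarrow> complex \<Rightarrow> complex \<Rightarrow> bool" where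
  "wirtinger1 G p q x \<longleftrightarrow> (G has_derivative (\<lambda>h. p * h + q * cnj h)) (at x)"

definition wirtinger ::
  "(complex ^ 'n::finite \<Rightarrow> complex) \<Rightarrow> ('n \<Rightarrow> complex) \<Rightarrow> ('n \<Rightarrow> complex) \<Rightarrow> complex ^ 'n \<Rightarrow> bool" where
  "wirtinger F p q u \<longleftrightarrow>
     (F has_derivative (\<lambda>h. \<Sum>i\<in>UNIV. p i * h $ i + q i * cnj (h $ i))) (at u)"

lemma sum_axis_complex:
  fixes p :: "'n::finite \<Rightarrow> complex"
  shows "(\<Sum>i\<in>UNIV. p i * axis a x $ i + q i * cnj (axis a x $ i)) = p a * x + q a * cnj x"
proof -
  have "(\<Sum>i\<in>UNIV. p i * axis a x $ i + q i * cnj (axis a x $ i)) =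
      (\<Sum>i\<in>UNIV. if i = a then p a * x + q a * cnj x else 0)"
    by (rule sum.cong) (auto simp: axis_def)
  then show ?thesis by simp
qed

lemma wirtinger_d_hol:
  assumes "wirtinger F p q u" shows "d_hol a F u = p a"
proof -
  have "frechet_derivative F (at u) = (\<lambda>h. \<Sum>i\<in>UNIV. p i * h $ i + q i * cnj (h $ i))"
    by (rule frechet_derivative_at[OF assms[unfolded wirtinger_def], symmetric])
  then show ?thesis unfolding d_hol_def by (simp only: sum_axis_complex) (simp add: complex_eq_iff)
qed

lemma wirtinger_d_bar:
  assumes "wirtinger F p q u" shows "d_bar a F u = q a"
proof -
  have "frechet_derivative F (at u) = (\<lambda>h. \<Sum>i\<in>UNIV. p i * h $ i + q i * cnj (h $ i))"
    by (rule frechet_derivative_at[OF assms[unfolded wirtinger_def], symmetric])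
  then show ?thesis unfolding d_bar_def by (simp only: sum_axis_complex) (simp add: complex_eq_iff)
qed

lemma vec_expand_complex:
  fixes h :: "complex ^ 'n::finite"
  shows "h = (\<Sum>i\<in>UNIV. Re (h $ i) *\<^sub>R axis i 1 + Im (h $ i) *\<^sub>R axis i \<i>)"
proof -
  have *: "(\<Sum>i\<in>UNIV. Re (h $ i) *\<^sub>R axis i 1 $ l + Im (h $ i) *\<^sub>R axis i \<i> $ l) =
     (\<Sum>i\<in>UNIV. if i = l then h $ l else (0::complex))" for l
    by (rule sum.cong) (auto simp: axis_def complex_eq_iff)
  show ?thesis unfolding vec_eq_iff
    by (simp add: sum_component *)
qed

lemma linear_wirtinger_form:
  fixes D :: "complex ^ 'n::finite \<Rightarrow> complex"
  assumes "linear D"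
  shows "D h = (\<Sum>i\<in>UNIV. (D (axis i 1) - \<i> * D (axis i \<i>)) / 2 * h $ i
                     + (D (axis i 1) + \<i> * D (axis i \<i>)) / 2 * cnj (h $ i))"
proof -
  interpret linear D by fact
  have "D h = (\<Sum>i\<in>UNIV. Re (h $ i) *\<^sub>R D (axis i 1) + Im (h $ i) *\<^sub>R D (axis i \<i>))"
    using arg_cong[OF vec_expand_complex[of h], of D] by (simp only: sum add scale)
  also have "\<dots> = (\<Sum>i\<in>UNIV. (D (axis i 1) - \<i> * D (axis i \<i>)) / 2 * h $ i
                     + (D (axis i 1) + \<i> * D (axis i \<i>)) / 2 * cnj (h $ i))"
  proof (rule sum.cong[OF refl])
    fix i
    have h: "h $ i = of_real (Re (h $ i)) + \<i> * of_real (Im (h $ i))"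
      by (simp add: complex_eq_iff)
    show "Re (h $ i) *\<^sub>R D (axis i 1) + Im (h $ i) *\<^sub>R D (axis i \<i>) =
      (D (axis i 1) - \<i> * D (axis i \<i>)) / 2 * h $ i + (D (axis i 1) + \<i> * D (axis i \<i>)) / 2 * cnj (h $ i)"
      by (simp add: complex_eq_iff field_simps)
  qed
  finally show ?thesis .
qed

lemma wirtingerI:
  assumes "F differentiable (at u)"
  shows "wirtinger F (\<lambda>a. d_hol a F u) (\<lambda>a. d_bar a F u) u"
proof -
  have D: "(F has_derivative frechet_derivative F (at u)) (at u)"
    using assms frechet_derivative_works by blast
  then have "linear (frechet_derivative F (at u))" by (rule has_derivative_linear)
  then have "frechet_derivative F (at u) =
      (\<lambda>h. \<Sum>i\<in>UNIV. d_hol i F u * h $ i + d_bar i F u * cnj (h $ i))"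
    unfolding d_hol_def d_bar_def by (intro ext linear_wirtinger_form)
  with D show ?thesis unfolding wirtinger_def by simp
qed

lemma wirtinger_unique:
  "wirtinger F p q u \<Longrightarrow> wirtinger F p' q' u \<Longrightarrow> p i = p' i \<and> q i = q' i"
  using wirtinger_d_hol[of F p q u i] wirtinger_d_hol[of F p' q' u i]
    wirtinger_d_bar[of F p q u i] wirtinger_d_bar[of F p' q' u i] by simp

lemma wirtinger_cong:
  "wirtinger F p q u \<Longrightarrow> (\<And>i. p i = p' i) \<Longrightarrow> (\<And>i. q i = q' i) \<Longrightarrow> wirtinger F p' q' u"
  unfolding wirtinger_def by simp

lemma wirtinger_const: "wirtinger (\<lambda>_. c) (\<lambda>_. 0) (\<lambda>_. 0) u"
  by (simp add: wirtinger_def)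

lemma wirtinger_coord:
  fixes u :: "complex ^ 'n::finite"
  shows "wirtinger (\<lambda>u. u $ l) (\<lambda>i. of_bool (i = l)) (\<lambda>_. 0) u"
proof -
  have "((\<lambda>u. u $ l) has_derivative (\<lambda>h. h $ l)) (at u)"
    using bounded_linear_imp_has_derivative[OF bounded_linear_vec_nth[of l]] by blast
  moreover have "(\<Sum>i\<in>UNIV. of_bool (i = l) * h $ i + 0 * cnj (h $ i)) = h $ l" for h :: "complex ^ 'n"
  proof -
    have "(\<Sum>i\<in>UNIV. of_bool (i = l) * h $ i + 0 * cnj (h $ i)) = (\<Sum>i\<in>UNIV. if i = l then h $ i else 0)"
      by (rule sum.cong) auto
    then show ?thesis by simp
  qed
  ultimately show ?thesis by (simp only: wirtinger_def)
qed

lemma wirtinger_add: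
  assumes "wirtinger F p q u" "wirtinger G p' q' u"
  shows "wirtinger (\<lambda>u. F u + G u) (\<lambda>i. p i + p' i) (\<lambda>i. q i + q' i) u"
  using has_derivative_add[OF assms[unfolded wirtinger_def]]
  unfolding wirtinger_def by (simp add: algebra_simps sum.distrib)

lemma wirtinger_mult:
  fixes F G :: "complex ^ 'n::finite \<Rightarrow> complex"
  assumes "wirtinger F p q u" "wirtinger G p' q' u"
  shows "wirtinger (\<lambda>u. F u * G u) (\<lambda>i. p i * G u + F u * p' i) (\<lambda>i. q i * G u + F u * q' i) u"
  unfolding wirtinger_def
proof (rule has_derivative_eq_rhs[OF has_derivative_mult[OF assms[unfolded wirtinger_def]]], rule ext)
  fix h :: "complex ^ 'n"
  show "F u * (\<Sum>i\<in>UNIV. p' i * h $ i + q' i * cnj (h $ i)) + (\<Sum>i\<in>UNIV. p i * h $ i + q i * cnj (h $ i)) * G u =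
    (\<Sum>i\<in>UNIV. (p i * G u + F u * p' i) * h $ i + (q i * G u + F u * q' i) * cnj (h $ i))"
    unfolding sum_distrib_left sum_distrib_right sum.distrib[symmetric]
    by (rule sum.cong) (simp_all add: algebra_simps)
qed

lemma wirtinger_sum:
  assumes "\<And>l. l \<in> I \<Longrightarrow> wirtinger (F l) (p l) (q l) u"
  shows "wirtinger (\<lambda>u. \<Sum>l\<in>I. F l u) (\<lambda>i. \<Sum>l\<in>I. p l i) (\<lambda>i. \<Sum>l\<in>I. q l i) u"
  using assms
proof (induction I rule: infinite_finite_induct)
  case (insert x I)
  then show ?case using wirtinger_add[of "F x"] by simp
qed (auto simp: wirtinger_const)

lemma wirtinger_cnj:
  assumes "wirtinger F p q u"
  shows "wirtinger (\<lambda>u. cnj (F u)) (\<lambda>i. cnj (q i)) (\<lambda>i. cnj (p i)) u"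
  using has_derivative_cnj[OF assms[unfolded wirtinger_def]]
  unfolding wirtinger_def by (simp add: algebra_simps sum.distrib)

lemma wirtinger_compose:
  fixes F :: "complex ^ 'n::finite \<Rightarrow> complex"
  assumes "wirtinger1 G P Q (F u)" "wirtinger F p q u"
  shows "wirtinger (\<lambda>u. G (F u)) (\<lambda>i. P * p i + Q * cnj (q i)) (\<lambda>i. P * q i + Q * cnj (p i)) u"
  unfolding wirtinger_def
proof (rule has_derivative_eq_rhs[OF has_derivative_compose[OF assms(2)[unfolded wirtinger_def]
      assms(1)[unfolded wirtinger1_def]]], rule ext)
  fix h :: "complex ^ 'n"
  show "P * (\<Sum>i\<in>UNIV. p i * h $ i + q i * cnj (h $ i)) + Q * cnj (\<Sum>i\<in>UNIV. p i * h $ i + q i * cnj (h $ i)) =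
    (\<Sum>i\<in>UNIV. (P * p i + Q * cnj (q i)) * h $ i + (P * q i + Q * cnj (p i)) * cnj (h $ i))"
    unfolding sum_distrib_left cnj_sum sum.distrib[symmetric]
    by (rule sum.cong) (simp_all add: algebra_simps)
qed

lemma wirtinger1_field:
  assumes "(G has_field_derivative P) (at x)" shows "wirtinger1 G P 0 x"
  using assms by (simp add: wirtinger1_def has_field_derivative_def)

lemma wirtinger1_unique:
  assumes "wirtinger1 G P Q x" "wirtinger1 G P' Q' x" shows "P = P'" "Q = Q'"
proof -
  have "(\<lambda>h. P * h + Q * cnj h) = (\<lambda>h. P' * h + Q' * cnj h)"
    using has_derivative_unique assms unfolding wirtinger1_def by blast
  then have 1: "P * h + Q * cnj h = P' * h + Q' * cnj h" for h by metis
  from 1[of 1] 1[of \<i>] show "P = P'" "Q = Q'" by (auto simp: complex_eq_iff)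
qed

lemma wirtinger1_const: "wirtinger1 (\<lambda>_. c) 0 0 x"
  by (simp add: wirtinger1_def)

lemma wirtinger1_id: "wirtinger1 (\<lambda>x. x) 1 0 x"
  by (simp add: wirtinger1_def)

lemma wirtinger1_cnj:
  "wirtinger1 F p q x \<Longrightarrow> wirtinger1 (\<lambda>x. cnj (F x)) (cnj q) (cnj p) x"
  unfolding wirtinger1_def by (drule has_derivative_cnj) (simp add: algebra_simps)

lemma wirtinger1_add:
  "wirtinger1 F p q x \<Longrightarrow> wirtinger1 G p' q' x \<Longrightarrow> wirtinger1 (\<lambda>x. F x + G x) (p + p') (q + q') x"
  unfolding wirtinger1_def by (drule (1) has_derivative_add) (simp add: algebra_simps)

lemma wirtinger1_mult:
  "wirtinger1 F p q x \<Longrightarrow> wirtinger1 G p' q' x \<Longrightarrow>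
     wirtinger1 (\<lambda>x. F x * G x) (p * G x + F x * p') (q * G x + F x * q') x"
  unfolding wirtinger1_def by (drule (1) has_derivative_mult) (simp add: algebra_simps)

lemma wirtinger1_compose:
  assumes "wirtinger1 G P Q (F x)" "wirtinger1 F p q x"
  shows "wirtinger1 (\<lambda>x. G (F x)) (P * p + Q * cnj q) (P * q + Q * cnj p) x"
  using has_derivative_compose[OF assms(2)[unfolded wirtinger1_def] assms(1)[unfolded wirtinger1_def]]
  unfolding wirtinger1_def by (simp add: algebra_simps)

lemma wirtinger1_cong:
  "wirtinger1 F p q x \<Longrightarrow> p = p' \<Longrightarrow> q = q' \<Longrightarrow> wirtinger1 F p' q' x"
  by simp

lemma wirtinger1_fibre:
  fixes F :: "complex ^ 'n::finite \<Rightarrow> complex"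
  assumes "wirtinger F p q (axis j x)"
  shows "wirtinger1 (\<lambda>x. F (axis j x)) (p j) (q j) x"
proof -
  have "bounded_linear (axis j :: complex \<Rightarrow> complex ^ 'n)"
    unfolding linear_conv_bounded_linear[symmetric]
    by (rule linearI) (simp_all add: axis_def vec_eq_iff)
  then have "(axis j has_derivative (axis j :: complex \<Rightarrow> complex ^ 'n)) (at x)"
    by (rule bounded_linear_imp_has_derivative)
  from has_derivative_compose[OF this assms[unfolded wirtinger_def]]
  show ?thesis unfolding wirtinger1_def by (simp add: sum_axis_complex)
qed

lemma wirtinger1_real:
  assumes "wirtinger1 F p q x" "\<And>x. F x \<in> \<real>" shows "q = cnj p"
proof -
  have "(\<lambda>x. cnj (F x)) = F" using assms(2) by (auto simp: Reals_cnj_iff)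
  with wirtinger1_cnj[OF assms(1)] have "wirtinger1 F (cnj q) (cnj p) x" by simp
  with assms(1) show ?thesis using wirtinger1_unique by blast
qed

text \<open>At most two derivatives of the metric and of the potential occur. Stated with
  \<open>d_hol\<close> and \<open>d_bar\<close>, this gives first derivatives as functions that can
  be differentiated again.\<close>

definition twice_differentiable :: "(complex ^ 'n::finite \<Rightarrow> complex) \<Rightarrow> bool" where
  "twice_differentiable F \<longleftrightarrow> (\<forall>u. F differentiable (at u)) \<and>
     (\<forall>a u. d_hol a F differentiable (at u) \<and> d_bar a F differentiable (at u))"

lemma smooth_twice_differentiable:
  fixes G :: "complex ^ 'n::finite \<Rightarrow> 'b::real_normed_vector"
  assumes "smooth G" "bounded_linear L"
  shows "twice_differentiable (\<lambda>u. L (G u))"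
proof -
  have "cont_diff (Suc (Suc 0)) G" using assms(1) unfolding smooth_def by blast
  then have G: "G differentiable (at u)"
    and G': "(\<lambda>u. frechet_derivative G (at u) v) differentiable (at u)" for u v
    by auto
  have DG: "(G has_derivative frechet_derivative G (at u)) (at u)" for u
    using G frechet_derivative_works by blast
  have DL: "((\<lambda>u. L (G u)) has_derivative (\<lambda>v. L (frechet_derivative G (at u) v))) (at u)" for u
    by (rule bounded_linear.has_derivative[OF assms(2) DG])
  have fd: "frechet_derivative (\<lambda>u. L (G u)) (at u) = (\<lambda>v. L (frechet_derivative G (at u) v))" for u
    by (rule frechet_derivative_at[OF DL, symmetric])
  have LG': "(\<lambda>u. L (frechet_derivative G (at u) v)) differentiable (at u)" for u v
    using bounded_linear.has_derivative[OF assms(2)] G'[of v u]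
    unfolding differentiable_def by blast
  have "d_hol a (\<lambda>u. L (G u)) differentiable (at u)" for a u
    unfolding d_hol_def[abs_def] fd
    by (intro differentiable_divide differentiable_diff differentiable_mult differentiable_const LG') auto
  moreover have "d_bar a (\<lambda>u. L (G u)) differentiable (at u)" for a u
    unfolding d_bar_def[abs_def] fd
    by (intro differentiable_divide differentiable_add differentiable_mult differentiable_const LG') auto
  ultimately show ?thesis
    unfolding twice_differentiable_def using DL differentiableI by blast
qed

lemma wirtinger1_axis:
  assumes "F differentiable (at (axis j x))"
  shows "wirtinger1 (\<lambda>x. F (axis j x)) (d_hol j F (axis j x)) (d_bar j F (axis j x)) x"
  by (rule wirtinger1_fibre[OF wirtingerI[OF assms]])

subsection \<open>Harmonic and rotationally symmetric functions of one variable\<close>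

text \<open>Holomorphy of \<open>p\<close> says that \<open>D\<close> is harmonic. A primitive
  \<open>G\<close> of \<open>p\<close> gives \<open>D = 2 Re G + const\<close>, so a bound from
  above alone makes the entire function \<open>exp (2 G)\<close> bounded.\<close>

lemma harmonic_Liouville:
  fixes D :: "complex \<Rightarrow> real"
  assumes D: "\<And>x. wirtinger1 (\<lambda>x. of_real (D x)) (p x) (cnj (p x)) x"
    and p: "p holomorphic_on UNIV" and bound: "\<And>x. D x \<le> C"
  shows "D x = D 0"
proof -
  obtain G where G: "\<And>x. x \<in> UNIV \<Longrightarrow> (G has_field_derivative p x) (at x)"
    using holomorphic_convex_primitive'[of UNIV p] p by auto
  have Gw: "wirtinger1 G (p x) 0 x" for x by (rule wirtinger1_field) (rule G, simp)
  have "wirtinger1 (\<lambda>x. of_real (D x) + (- 1) * (G x + cnj (G x))) 0 0 x" for x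
    by (rule wirtinger1_cong[OF wirtinger1_add[OF D[of x] wirtinger1_mult[OF wirtinger1_const
        wirtinger1_add[OF Gw[of x] wirtinger1_cnj[OF Gw[of x]]]]]]) auto
  then have "((\<lambda>x. of_real (D x) + (- 1) * (G x + cnj (G x))) has_derivative (\<lambda>h. 0)) (at x within UNIV)" for x
    by (simp add: wirtinger1_def)
  from has_derivative_zero_constant[OF convex_UNIV this]
  obtain c where "\<And>x. complex_of_real (D x) + (- 1) * (G x + cnj (G x)) = c" by blast
  then have "Re (complex_of_real (D x) + (- 1) * (G x + cnj (G x))) = Re c" for x by metis
  then have c: "D x = 2 * Re (G x) + Re c" for x by (simp add: algebra_simps)
  have hol: "(\<lambda>x. exp (2 * G x)) holomorphic_on UNIV"
    using G by (intro holomorphic_intros) (meson UNIV_I field_differentiable_def holomorphic_on_def field_differentiable_at_within)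
  have "norm (exp (2 * G x)) \<le> exp (C - Re c)" for x
    using bound[of x] c[of x] by simp
  then have "bounded (range (\<lambda>x. exp (2 * G x)))" unfolding bounded_iff by auto
  from Liouville_theorem[OF hol this] obtain K where "\<And>x. exp (2 * G x) = K"
    unfolding constant_on_def by auto
  then have "norm (exp (2 * G x)) = norm (exp (2 * G 0))" by metis
  then show ?thesis using c by simp
qed

lemma wirtinger1_rotate:
  assumes "wirtinger1 G p q (t * x)"
  shows "wirtinger1 (\<lambda>x. G (t * x)) (p * t) (q * cnj t) x"
  by (rule wirtinger1_cong[OF wirtinger1_compose[where F = "\<lambda>x. t * x", OF assms
     wirtinger1_mult[OF wirtinger1_const wirtinger1_id]]]) auto

definition radial :: "(complex \<Rightarrow> complex) \<Rightarrow> bool" where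
  "radial G \<longleftrightarrow> (\<forall>t x. norm t = 1 \<longrightarrow> G (t * x) = G x)"

lemma radialD: "radial G \<Longrightarrow> norm t = 1 \<Longrightarrow> G (t * x) = G x"
  by (simp add: radial_def)

text \<open>The derivative of \<open>G (cis t * x)\<close> at \<open>t = 0\<close>, that is the
  angular derivative of \<open>G\<close>, vanishes.\<close>

lemma radial_wirtinger1:
  assumes "radial G" "wirtinger1 G p q x"
  shows "x * p = cnj x * q"
proof -
  have "((\<lambda>t. cis t * x) has_derivative (\<lambda>s. s *\<^sub>R (\<i> * x))) (at 0)"
    unfolding cis_conv_exp has_vector_derivative_def[symmetric]
    by (rule has_vector_derivative_real_field[where f = "\<lambda>t. exp (\<i> * t) * x"])
      (auto intro!: derivative_eq_intros)
  moreover have "(G has_derivative (\<lambda>h. p * h + q * cnj h)) (at (cis 0 * x))"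
    using assms(2) by (simp add: wirtinger1_def)
  ultimately have "((\<lambda>t. G (cis t * x)) has_derivative (\<lambda>s. p * (s *\<^sub>R (\<i> * x)) + q * cnj (s *\<^sub>R (\<i> * x)))) (at 0)"
    by (rule has_derivative_compose)
  moreover have "(\<lambda>t. G (cis t * x)) = (\<lambda>t. G x)"
    using assms(1) by (auto simp: radial_def)
  ultimately have "((\<lambda>t. G x) has_derivative (\<lambda>s::real. p * (s *\<^sub>R (\<i> * x)) + q * cnj (s *\<^sub>R (\<i> * x)))) (at 0)"
    by simp
  then have "(\<lambda>s::real. p * (s *\<^sub>R (\<i> * x)) + q * cnj (s *\<^sub>R (\<i> * x))) = (\<lambda>s. 0)"
    using has_derivative_const has_derivative_unique by blast
  then have "p * (1 *\<^sub>R (\<i> * x)) + q * cnj (1 *\<^sub>R (\<i> * x)) = 0" by metis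
  then have "\<i> * (x * p - cnj x * q) = 0" by (simp add: algebra_simps)
  then show ?thesis by simp
qed

lemma radial_wirtinger1_equivariant:
  assumes "radial G" "\<And>x. wirtinger1 G (p x) (q x) x" "norm t = 1"
  shows "p (t * x) * t = p x" "q (t * x) = t * q x"
proof -
  have "(\<lambda>x. G (t * x)) = G" using assms(1,3) by (auto simp: radial_def)
  with wirtinger1_rotate[OF assms(2)[of "t * x"]]
  have w: "wirtinger1 G (p (t * x) * t) (q (t * x) * cnj t) x" by simp
  from wirtinger1_unique(1)[OF w assms(2)] show "p (t * x) * t = p x" .
  from wirtinger1_unique(2)[OF w assms(2)] have "q (t * x) * cnj t * t = q x * t" by simp
  moreover have "cnj t * t = 1"
    using assms(3) by (metis complex_norm_square mult.commute of_real_1 power_one)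
  ultimately show "q (t * x) = t * q x"
    by (metis mult.assoc mult.commute mult.left_neutral)
qed

text \<open>\<open>v x * cnj x\<close> is invariant under rotations, so its angular derivative gives
  Euler's equation \<open>x * v' x = v x\<close>. Hence \<open>v x / x\<close> is constant on the
  punctured plane, which is connected.\<close>

lemma holomorphic_equivariant_linear:
  fixes v v' :: "complex \<Rightarrow> complex"
  assumes v: "\<And>x. (v has_field_derivative v' x) (at x)"
    and eq: "\<And>t x. norm t = 1 \<Longrightarrow> v (t * x) = t * v x"
  obtains c where "\<And>x. v x = c * x"
proof -
  have "v (- 1 * 0) = - 1 * v 0" by (rule eq) simp
  then have v0: "v 0 = 0" by simp
  have rad: "radial (\<lambda>x. v x * cnj x)"
    unfolding radial_def
  proof (intro allI impI)
    fix t x :: complex assume t: "norm t = 1"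
    have "cnj t * t = 1" using t by (metis complex_norm_square mult.commute of_real_1 power_one)
    then have "cnj t * t * (v x * cnj x) = v x * cnj x" by simp
    then show "v (t * x) * cnj (t * x) = v x * cnj x"
      by (simp add: eq[OF t] ac_simps)
  qed
  have euler: "x * v' x = v x" if "x \<noteq> 0" for x
    using radial_wirtinger1[OF rad wirtinger1_mult[OF wirtinger1_field[OF v[of x]]
        wirtinger1_cnj[OF wirtinger1_id]]] that
    by simp
  have d: "((\<lambda>x. v x / x) has_field_derivative 0) (at x)" if "x \<noteq> 0" for x
    using that euler[OF that] by (auto intro!: derivative_eq_intros v simp: mult.commute)
  have "continuous_on (- {0}) (\<lambda>x. v x / x)"
    by (intro continuous_at_imp_continuous_on ballI DERIV_isCont[of _ 0]) (auto intro!: d)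
  moreover have "connected (- {0::complex})"
    by (rule connected_punctured_universe) simp
  ultimately obtain c where "\<And>x. x \<in> - {0} \<Longrightarrow> v x / x = c"
    using DERIV_zero_connected_constant[of "- {0::complex}" "{}" "\<lambda>x. v x / x"] d by auto
  then have "v x = c * x" for x using v0 by (cases "x = 0") (auto simp: field_simps)
  then show ?thesis by (rule that)
qed

subsection \<open>Linear algebra\<close>

text \<open>The negative of the reflection in the hyperplane orthogonal to \<open>v\<close>. With \<open>v = z + |z| e\<^sub>j\<close> it maps
  \<open>z\<close> to \<open>|z| e\<^sub>j\<close> if \<open>z\<^sub>j > 0\<close>; the opposite sign would degenerate at \<open>z = e\<^sub>j\<close>.\<close>

definition householder :: "complex ^ 'n \<Rightarrow> complex ^ 'n ^ 'n::finite" where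
  "householder v = (\<chi> p q. 2 * v $ p * cnj (v $ q) / (\<Sum>l\<in>UNIV. v $ l * cnj (v $ l)) - of_bool (p = q))"

lemma unitary_householder:
  fixes v :: "complex ^ 'n::finite"
  assumes "(\<Sum>l\<in>UNIV. v $ l * cnj (v $ l)) \<noteq> 0"
  shows "unitary_matrix (householder v)"
proof -
  define V where "V = (\<Sum>l\<in>UNIV. v $ l * cnj (v $ l))"
  have V: "V \<noteq> 0" using assms by (simp add: V_def)
  have Vc: "cnj V = V" by (simp add: V_def mult.commute)
  have "(\<Sum>p\<in>UNIV. cnj (householder v $ p $ i) * householder v $ p $ l) = of_bool (i = l)" for i l
  proof -
    have "(\<Sum>p\<in>UNIV. cnj (householder v $ p $ i) * householder v $ p $ l) =
      (\<Sum>p\<in>UNIV. 4 * v $ i * cnj (v $ l) / V^2 * (v $ p * cnj (v $ p))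
         - (if p = l then 2 * v $ i * cnj (v $ l) / V else 0) - (if p = i then 2 * v $ i * cnj (v $ l) / V else 0)
         + (if p = i then of_bool (i = l) else 0))"
      by (rule sum.cong)
        (auto simp: householder_def V_def[symmetric] Vc V field_simps power2_eq_square)
    also have "\<dots> = 4 * v $ i * cnj (v $ l) / V^2 * V - 4 * v $ i * cnj (v $ l) / V + of_bool (i = l)"
      unfolding sum.distrib sum_subtractf sum_distrib_left[symmetric] V_def[symmetric] by simp
    also have "\<dots> = of_bool (i = l)" using V by (simp add: power2_eq_square)
    finally show ?thesis .
  qed
  then show ?thesis
    unfolding unitary_matrix_def
    by (simp add: vec_eq_iff matrix_matrix_mult_def mat_def of_bool_def)
qed

text \<open>Sign changes, transpositions and phases of this shape preserve the fibre
  \<open>w = 0\<close> and suffice for the symmetries of the metric along it.\<close>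

definition monomial_matrix :: "('n \<Rightarrow> 'n) \<Rightarrow> ('n \<Rightarrow> complex) \<Rightarrow> complex ^ 'n ^ 'n::finite" where
  "monomial_matrix s c = (\<chi> p q. if p = s q then c q else 0)"

lemma unitary_monomial_matrix:
  fixes s :: "'n::finite \<Rightarrow> 'n"
  assumes "inj s" "\<And>q. c q * cnj (c q) = 1"
  shows "unitary_matrix (monomial_matrix s c)"
proof -
  have "(\<Sum>p\<in>UNIV. cnj (monomial_matrix s c $ p $ i) * monomial_matrix s c $ p $ l) = of_bool (i = l)" for i l
  proof -
    have "(\<Sum>p\<in>UNIV. cnj (monomial_matrix s c $ p $ i) * monomial_matrix s c $ p $ l) =
        (\<Sum>p\<in>UNIV. if p = s i then of_bool (i = l) else 0)"
      using assms(2)[of i] injD[OF assms(1), of i l]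
      by (intro sum.cong) (auto simp: monomial_matrix_def mult.commute)
    then show ?thesis by simp
  qed
  then show ?thesis
    unfolding unitary_matrix_def
    by (simp add: vec_eq_iff matrix_matrix_mult_def mat_def of_bool_def)
qed

lemma monomial_matrix_axis: "monomial_matrix s c *v axis j 1 = axis (s j) (c j)"
proof -
  have "(\<Sum>q\<in>UNIV. monomial_matrix s c $ p $ q * axis j 1 $ q) =
      (\<Sum>q\<in>UNIV. if q = j then axis (s j) (c j) $ p else 0)" for p
    by (rule sum.cong) (auto simp: monomial_matrix_def axis_def)
  then show ?thesis by (simp add: vec_eq_iff matrix_vector_mult_def)
qed

lemma unitary_matrix_sum:
  assumes "unitary_matrix A"
  shows "(\<Sum>p\<in>UNIV. A $ p $ i * cnj (A $ p $ l)) = of_bool (i = l)"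
proof -
  have "(\<Sum>p\<in>UNIV. cnj (A $ p $ l) * A $ p $ i) = of_bool (l = i)"
    using assms unfolding unitary_matrix_def vec_eq_iff
    by (simp add: matrix_matrix_mult_def mat_def of_bool_def)
  then show ?thesis by (simp add: mult.commute eq_commute)
qed

text \<open>\<open>z\<close> is the adjoint of \<open>A\<close> applied to \<open>n e_j\<close>. Row
  \<open>j\<close> is the only one needed explicitly of the matrix that moves a point to the
  fibre.\<close>

lemma unitary_matrix_row:
  assumes "unitary_matrix A" "A *v z = axis j n"
  shows "z $ l = n * cnj (A $ j $ l)"
proof -
  have "(\<chi> i j. cnj (A $ j $ i)) *v axis j n = z"
    using assms by (metis matrix_vector_mul_assoc matrix_vector_mul_lid unitary_matrix_def)
  then have "z $ l = (\<Sum>p\<in>UNIV. cnj (A $ p $ l) * axis j n $ p)"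
    by (auto simp: matrix_vector_mult_def)
  also have "\<dots> = (\<Sum>p\<in>UNIV. if p = j then n * cnj (A $ j $ l) else 0)"
    by (rule sum.cong) (auto simp: axis_def)
  finally show ?thesis by simp
qed

lemma det_cnj:
  fixes X :: "complex ^ 'n ^ 'n::finite"
  shows "det (\<chi> i l. cnj (X $ i $ l)) = cnj (det X)"
  by (simp add: det_def)

lemma det_unitary:
  assumes "unitary_matrix A" shows "det A * cnj (det A) = 1"
proof -
  have "(\<chi> i j. cnj (A $ j $ i)) = transpose (\<chi> i l. cnj (A $ i $ l))"
    by (simp add: transpose_def)
  then have "det (\<chi> i j. cnj (A $ j $ i)) = cnj (det A)"
    by (simp add: det_transpose det_cnj)
  then show ?thesis
    using assms unfolding unitary_matrix_def
    by (metis det_I det_mul mult.commute)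
qed

text \<open>Only permutations fixing \<open>j\<close> survive in the Leibniz formula. The cofactor
  stays a sum over permutations, since deleting an index would change the index type.\<close>

lemma det_expand_axis_row:
  fixes X :: "'a::comm_ring_1 ^ 'n ^ 'n::finite"
  assumes "\<And>p. p \<noteq> j \<Longrightarrow> X $ j $ p = 0"
  shows "det X = X $ j $ j *
    (\<Sum>p | p permutes UNIV \<and> p j = j. of_int (sign p) * (\<Prod>i\<in>- {j}. X $ i $ p i))"
proof -
  have split: "(\<Prod>i\<in>UNIV. X $ i $ p i) = X $ j $ p j * (\<Prod>i\<in>- {j}. X $ i $ p i)" for p
    by (subst prod.remove[of UNIV j]) (auto simp: Compl_eq_Diff_UNIV)
  have "det X = (\<Sum>p | p permutes UNIV. of_int (sign p) * (X $ j $ p j * (\<Prod>i\<in>- {j}. X $ i $ p i)))"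
    by (simp add: det_def split)
  also have "\<dots> = (\<Sum>p | p permutes UNIV \<and> p j = j. of_int (sign p) * (X $ j $ p j * (\<Prod>i\<in>- {j}. X $ i $ p i)))"
    by (rule sum.mono_neutral_right) (auto simp: assms)
  finally show ?thesis by (simp add: sum_distrib_left ac_simps)
qed

lemma det_scale_minor:
  fixes X Y :: "'a::comm_ring_1 ^ 'n ^ 'n::finite"
  assumes "\<And>p. p \<noteq> j \<Longrightarrow> X $ j $ p = 0" "\<And>p. p \<noteq> j \<Longrightarrow> Y $ j $ p = 0"
    and "\<And>i p. i \<noteq> j \<Longrightarrow> p \<noteq> j \<Longrightarrow> Y $ i $ p = s * X $ i $ p"
  shows "X $ j $ j * det Y = Y $ j $ j * s ^ (CARD('n) - 1) * det X"
proof -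
  have "(\<Prod>i\<in>- {j}. Y $ i $ p i) = s ^ (CARD('n) - 1) * (\<Prod>i\<in>- {j}. X $ i $ p i)"
    if "p permutes UNIV" "p j = j" for p
  proof -
    have "p i \<noteq> j" if "i \<noteq> j" for i
      using \<open>p permutes UNIV\<close> \<open>p j = j\<close> that by (metis permutes_def)
    then have "(\<Prod>i\<in>- {j}. Y $ i $ p i) = (\<Prod>i\<in>- {j}. s * X $ i $ p i)"
      by (intro prod.cong) (auto simp: assms(3))
    then show ?thesis by (simp add: prod.distrib card_Diff_singleton Compl_eq_Diff_UNIV)
  qed
  then have "(\<Sum>p | p permutes UNIV \<and> p j = j. of_int (sign p) * (\<Prod>i\<in>- {j}. Y $ i $ p i)) =
    (\<Sum>p | p permutes UNIV \<and> p j = j. s ^ (CARD('n) - 1) * (of_int (sign p) * (\<Prod>i\<in>- {j}. X $ i $ p i)))"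
    by (intro sum.cong) (auto simp: ac_simps)
  also have "\<dots> = s ^ (CARD('n) - 1) *
      (\<Sum>p | p permutes UNIV \<and> p j = j. of_int (sign p) * (\<Prod>i\<in>- {j}. X $ i $ p i))"
    by (simp only: sum_distrib_left)
  finally show ?thesis
    by (simp add: det_expand_axis_row[of j X, OF assms(1)] det_expand_axis_row[of j Y, OF assms(2)] ac_simps)
qed

subsection \<open>The action of the unitary group in a chart\<close>

text \<open>The factor by which the fibre coordinate changes, and its exponent: the two types of charts differ
  only in the sign of \<open>k\<close>, so that both ends of the fibre are treated at once.\<close>

definition twist :: "nat \<Rightarrow> bool \<Rightarrow> complex \<Rightarrow> complex" where
  "twist k b x = (if b then inverse (x ^ k) else x ^ k)"

definition weight :: "nat \<Rightarrow> bool \<Rightarrow> real" where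
  "weight k b = (if b then - real k else real k)"

lemma twist_one [simp]: "twist k b 1 = 1"
  by (simp add: twist_def)

lemma twist_derivative:
  assumes "x \<noteq> 0"
  shows "(twist k b has_field_derivative weight k b * twist k b x / x) (at x)"
proof -
  have pw: "((\<lambda>x. x ^ k) has_field_derivative of_nat k * x ^ k / x) (at x)"
    using DERIV_power[OF DERIV_ident, of k x UNIV] assms
    by (cases k) (simp_all add: DERIV_power_Suc)
  show ?thesis
  proof (cases b)
    case True
    then have "twist k b = (\<lambda>x. inverse (x ^ k))" by (simp add: twist_def fun_eq_iff)
    moreover have "((\<lambda>x. inverse (x ^ k)) has_field_derivative
        - (inverse (x ^ k) * (of_nat k * x ^ k / x) * inverse (x ^ k))) (at x)"
      by (rule DERIV_inverse'[OF pw]) (use assms in simp)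
    ultimately show ?thesis using True assms
      by (simp add: weight_def divide_simps mult.commute split: if_splits)
  next
    case False
    then have "twist k b = (\<lambda>x. x ^ k)" by (simp add: twist_def fun_eq_iff)
    with pw False show ?thesis by (simp add: weight_def)
  qed
qed

text \<open>Every phase has a \<open>k\<close>-th root of modulus one, so all rotations of the fibre
  come from the unitary group.\<close>

lemma twist_surj_circle:
  assumes "k \<ge> 1" "norm t = 1"
  obtains x where "norm x = 1" "twist k b x = t"
proof -
  obtain s where s: "norm s = 1" "s = (if b then inverse t else t)"
    using assms(2) by (auto simp: norm_inverse)
  obtain \<theta> where "s = cis \<theta>" using s(1) by (metis cis_Arg sgn_eq scaleR_one div_by_1 of_real_1 norm_zero zero_neq_one)
  moreover have "real k * (\<theta> / real k) = \<theta>" using assms(1) by simp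
  ultimately have "cis (\<theta> / k) ^ k = s" by (simp only: Complex.DeMoivre)
  with s assms(2) have "twist k b (cis (\<theta> / k)) = t" by (auto simp: twist_def)
  with that[of "cis (\<theta> / k)"] show ?thesis by simp
qed

text \<open>The Jacobian matrix of \<open>act_map\<close> at a point with homogeneous coordinates \<open>z\<close> such that \<open>A z = n e\<^sub>j\<close>.\<close>

definition jacobian :: "nat \<Rightarrow> 'n \<Rightarrow> bool \<Rightarrow> complex ^ 'n ^ 'n \<Rightarrow> complex \<Rightarrow> complex \<Rightarrow> 'n::finite \<Rightarrow> 'n \<Rightarrow> complex" where
  "jacobian k j b A n y a p =
     (if p = j then (if a = j then twist k b n else y * (weight k b * twist k b n / n * A $ j $ a))
      else if a = j then 0 else A $ p $ a / n)"

lemma act_map_same_chart: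
  "act_map k A (j, b) (j, b) u =
     (\<chi> l. if l = j then twist k b ((A *v hom_coords (j, b) u) $ j) * u $ j
           else (A *v hom_coords (j, b) u) $ l * inverse ((A *v hom_coords (j, b) u) $ j))"
  by (simp add: act_map_def chart_coords_def twist_def vec_eq_iff Let_def field_simps)

lemma wirtinger_hom_coords_linear:
  fixes A :: "complex ^ 'n ^ 'n::finite"
  shows "wirtinger (\<lambda>u. (A *v hom_coords (j, b) u) $ p) (\<lambda>i. if i = j then 0 else A $ p $ i) (\<lambda>_. 0) u"
proof -
  have c: "wirtinger (\<lambda>u. hom_coords (j, b) u $ l) (\<lambda>i. of_bool (i = l \<and> l \<noteq> j)) (\<lambda>_. 0) u" for l
    by (cases "l = j") (auto simp: hom_coords_def wirtinger_const intro: wirtinger_cong[OF wirtinger_coord])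
  have "wirtinger (\<lambda>u. \<Sum>l\<in>UNIV. A $ p $ l * hom_coords (j, b) u $ l)
      (\<lambda>i. \<Sum>l\<in>UNIV. 0 * hom_coords (j, b) u $ l + A $ p $ l * of_bool (i = l \<and> l \<noteq> j))
      (\<lambda>i. \<Sum>l\<in>UNIV. 0 * hom_coords (j, b) u $ l + A $ p $ l * 0) u"
    by (intro wirtinger_sum wirtinger_mult wirtinger_const c)
  moreover have "(\<Sum>l\<in>UNIV. 0 * hom_coords (j, b) u $ l + A $ p $ l * of_bool (i = l \<and> l \<noteq> j)) =
      (if i = j then 0 else A $ p $ i)" for i
  proof -
    have "(\<Sum>l\<in>UNIV. 0 * hom_coords (j, b) u $ l + A $ p $ l * of_bool (i = l \<and> l \<noteq> j)) =
      (\<Sum>l\<in>UNIV. if l = i then (if i = j then 0 else A $ p $ i) else 0)"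
      by (rule sum.cong) auto
    then show ?thesis by simp
  qed
  ultimately show ?thesis by (simp add: matrix_vector_mult_def)
qed

text \<open>As \<open>A z\<close> lies on axis \<open>j\<close>, its other entries vanish and the
  quotient rule keeps only the derivative of the numerator.\<close>

lemma d_hol_act_map:
  assumes Az: "A *v hom_coords (j, b) u = axis j n" and n: "n \<noteq> 0"
  shows "d_hol a (\<lambda>v. act_map k A (j, b) (j, b) v $ p) u = jacobian k j b A n (u $ j) a p"
proof -
  have val: "(A *v hom_coords (j, b) u) $ l = (if l = j then n else 0)" for l
    by (simp add: Az axis_def)
  have inv: "wirtinger1 inverse (- (inverse n * inverse n)) 0 n"
    using DERIV_inverse[OF n] by (intro wirtinger1_field) (simp add: power2_eq_square)
  have tw: "wirtinger1 (twist k b) (weight k b * twist k b n / n) 0 n"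
    by (intro wirtinger1_field twist_derivative n)
  note lin = wirtinger_hom_coords_linear[of A j b _ u]
  show ?thesis
  proof (cases "p = j")
    case True
    have "wirtinger1 (twist k b) (weight k b * twist k b n / n) 0 ((A *v hom_coords (j, b) u) $ j)"
      using tw by (simp add: val)
    from wirtinger_d_hol[OF wirtinger_mult[OF wirtinger_compose[OF this lin] wirtinger_coord[of j]], of a]
    show ?thesis using True by (auto simp: act_map_same_chart jacobian_def val)
  next
    case False
    have "wirtinger1 inverse (- (inverse n * inverse n)) 0 ((A *v hom_coords (j, b) u) $ j)"
      using inv by (simp add: val)
    from wirtinger_d_hol[OF wirtinger_mult[OF lin[of p] wirtinger_compose[OF this lin]], of a]
    show ?thesis using False by (auto simp: act_map_same_chart jacobian_def val divide_inverse)
  qed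
qed

lemma U_invariant_jacobian:
  assumes "U_invariant k g" "unitary_matrix A"
    and Az: "A *v hom_coords (j, b) u = axis j n" and n: "n \<noteq> 0"
  shows "g (j, b) u $ i $ l = (\<Sum>p\<in>UNIV. \<Sum>q\<in>UNIV. jacobian k j b A n (u $ j) i p *
     g (j, b) (axis j (twist k b n * u $ j)) $ p $ q * cnj (jacobian k j b A n (u $ j) l q))"
proof -
  have "u \<in> act_dom A (j, b) (j, b)"
    using n by (simp add: act_dom_def in_chart_def Az)
  then have *: "g (j, b) u = pullback_form (act_map k A (j, b) (j, b)) (g (j, b)) u"
    using assms(1,2) unfolding U_invariant_def by blast
  have "act_map k A (j, b) (j, b) u = axis j (twist k b n * u $ j)"
    by (auto simp: act_map_same_chart Az vec_eq_iff axis_def)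
  with * show ?thesis
    by (simp add: pullback_form_def d_hol_act_map[OF Az n])
qed

subsection \<open>Invariant Kaehler metrics in a chart\<close>

text \<open>\<open>b\<close> selects the end of the fibre. \<open>a0\<close> is a fixed horizontal
  direction; all of them are equivalent by \<open>G_axis_diag\<close>.\<close>

locale invariant_chart =
  fixes k :: nat and g :: "('n::finite) form_field" and j a0 :: 'n and b :: bool
  assumes k_pos: "k \<ge> 1" and a0: "a0 \<noteq> j"
    and kahler: "kahler_metric k g" and invariant: "U_invariant k g"
begin

abbreviation G :: "complex ^ 'n \<Rightarrow> complex ^ 'n ^ 'n" where "G \<equiv> g (j, b)"

abbreviation kap :: real where "kap \<equiv> weight k b"

definition alpha :: "complex \<Rightarrow> complex" where "alpha x = G (axis j x) $ a0 $ a0"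

definition beta :: "complex \<Rightarrow> complex" where "beta x = G (axis j x) $ j $ j"

text \<open>For the representative \<open>z\<close> with \<open>z_j = 1\<close>, \<open>Nsq\<close>
  is \<open>|z|^2\<close> and \<open>E\<close> is \<open>|z|^kap\<close>. They are complex valued so
  that the Wirtinger rules apply, and the form of \<open>E\<close> lets one rule cover both signs of
  \<open>kap\<close>.\<close>

definition Nsq :: "complex ^ 'n \<Rightarrow> complex" where
  "Nsq u = 1 + (\<Sum>l\<in>- {j}. u $ l * cnj (u $ l))"

definition E :: "complex ^ 'n \<Rightarrow> complex" where "E u = exp (kap / 2 * ln (Nsq u))"

lemma kap_nonzero: "kap \<noteq> 0" using k_pos by (simp add: weight_def)

lemma G_hermitian: "cnj (G u $ i $ l) = G u $ l $ i"
  using kahler unfolding kahler_metric_def hermitian_matrix_def by metis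

lemma G_twice_differentiable: "twice_differentiable (\<lambda>u. G u $ i $ l)"
proof (rule smooth_twice_differentiable[of G "\<lambda>X. X $ i $ l"])
  show "smooth G" using kahler unfolding kahler_metric_def by blast
  show "bounded_linear (\<lambda>X :: complex ^ 'n ^ 'n. X $ i $ l)"
    by (rule bounded_linear_compose[OF bounded_linear_vec_nth bounded_linear_vec_nth])
qed

lemma G_diag_pos: "0 < G u $ i $ i"
proof -
  have "positive_form (G u)" using kahler unfolding kahler_metric_def by blast
  moreover have "axis i (1::complex) \<noteq> 0" by (simp add: axis_eq_0_iff)
  ultimately have "0 < Re (\<Sum>p\<in>UNIV. \<Sum>q\<in>UNIV. G u $ p $ q * axis i 1 $ p * cnj (axis i 1 $ q))"
    unfolding positive_form_def by blast
  also have "(\<Sum>p\<in>UNIV. \<Sum>q\<in>UNIV. G u $ p $ q * axis i 1 $ p * cnj (axis i 1 $ q)) =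
     (\<Sum>p\<in>UNIV. \<Sum>q\<in>UNIV. if q = i then (if p = i then G u $ i $ i else 0) else 0)"
    by (intro sum.cong refl) (auto simp: axis_def)
  finally have "0 < Re (G u $ i $ i)" by simp
  moreover have "G u $ i $ i \<in> \<real>" using G_hermitian[of u i i] by (simp add: Reals_cnj_iff)
  ultimately show ?thesis by (simp add: less_complex_def complex_is_Real_iff)
qed

lemma hom_coords_axis: "hom_coords (j, b) (axis j x) = axis j 1"
  by (auto simp: hom_coords_def vec_eq_iff axis_def)

text \<open>One of the two indices, \<open>c\<close>, is not \<open>j\<close>. The diagonal matrix
  with \<open>-1\<close> at \<open>c\<close> fixes the fibre pointwise and reverses the sign of the
  entry.\<close>

lemma G_axis_offdiag:
  assumes "i \<noteq> l" shows "G (axis j x) $ i $ l = 0"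
proof -
  obtain c where c: "c \<in> {i, l}" "c \<noteq> j" using assms by auto
  define A where "A = monomial_matrix id (\<lambda>q::'n. if q = c then - 1 else 1)"
  have uA: "unitary_matrix A"
    unfolding A_def by (rule unitary_monomial_matrix) auto
  have "A *v hom_coords (j, b) (axis j x) = axis j 1"
    using c(2) unfolding hom_coords_axis A_def by (simp add: monomial_matrix_axis)
  from U_invariant_jacobian[OF invariant uA this, of i l]
  have "G (axis j x) $ i $ l = (\<Sum>p\<in>UNIV. \<Sum>q\<in>UNIV. jacobian k j b A 1 x i p *
     G (axis j x) $ p $ q * cnj (jacobian k j b A 1 x l q))" by simp
  also have "\<dots> = (\<Sum>p\<in>UNIV. \<Sum>q\<in>UNIV. if q = l then (if p = i then - G (axis j x) $ i $ l else 0) else 0)"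
    by (intro sum.cong refl) (use c assms in \<open>auto simp: jacobian_def A_def monomial_matrix_def\<close>)
  finally show ?thesis by simp
qed

lemma U_invariant_diag:
  assumes "unitary_matrix A" "A *v hom_coords (j, b) u = axis j n" "n \<noteq> 0"
  shows "G u $ i $ l = (\<Sum>p\<in>UNIV. jacobian k j b A n (u $ j) i p *
     G (axis j (twist k b n * u $ j)) $ p $ p * cnj (jacobian k j b A n (u $ j) l p))"
proof -
  have "G u $ i $ l = (\<Sum>p\<in>UNIV. \<Sum>q\<in>UNIV. if q = p then jacobian k j b A n (u $ j) i p *
     G (axis j (twist k b n * u $ j)) $ p $ p * cnj (jacobian k j b A n (u $ j) l p) else 0)"
    unfolding U_invariant_jacobian[OF invariant assms]
    by (intro sum.cong refl) (auto simp: G_axis_offdiag)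
  then show ?thesis by simp
qed

lemma G_axis_diag:
  assumes "i \<noteq> j" shows "G (axis j x) $ i $ i = alpha x"
proof -
  define A where "A = monomial_matrix (\<lambda>q. if q = i then a0 else if q = a0 then i else q) (\<lambda>_. 1)"
  have uA: "unitary_matrix A"
    unfolding A_def by (rule unitary_monomial_matrix) (auto simp: inj_def)
  have "A *v hom_coords (j, b) (axis j x) = axis j 1"
    using assms a0 unfolding hom_coords_axis A_def by (simp add: monomial_matrix_axis)
  from U_invariant_diag[OF uA this, of i i]
  have "G (axis j x) $ i $ i = (\<Sum>p\<in>UNIV. jacobian k j b A 1 x i p *
     G (axis j x) $ p $ p * cnj (jacobian k j b A 1 x i p))" by simp
  also have "\<dots> = (\<Sum>p\<in>UNIV. if p = a0 then G (axis j x) $ a0 $ a0 else 0)"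
    using assms a0
    by (intro sum.cong refl) (auto simp: jacobian_def A_def monomial_matrix_def split: if_splits)
  finally show ?thesis by (simp add: alpha_def)
qed

text \<open>A phase \<open>n\<close> in position \<open>j\<close> multiplies the fibre coordinate by
  \<open>t\<close> and the horizontal ones by \<open>1 / n\<close>; both factors have modulus one
  and cancel in diagonal entries.\<close>

lemma G_axis_phase:
  assumes t: "norm t = 1"
  shows "G (axis j (t * x)) $ i $ i = G (axis j x) $ i $ i"
proof -
  obtain n where n: "norm n = 1" "twist k b n = t" using twist_surj_circle[OF k_pos t] .
  have nn: "n \<noteq> 0" "n * cnj n = 1" "t * cnj t = 1"
    using n t by (auto simp: complex_norm_square[symmetric])
  define A where "A = monomial_matrix id (\<lambda>q. if q = j then n else 1)"
  have uA: "unitary_matrix A"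
    unfolding A_def by (rule unitary_monomial_matrix) (auto simp: nn)
  have "A *v hom_coords (j, b) (axis j x) = axis j n"
    unfolding hom_coords_axis A_def by (simp add: monomial_matrix_axis)
  from U_invariant_diag[OF uA this nn(1), of i i]
  have "G (axis j x) $ i $ i = (\<Sum>p\<in>UNIV. jacobian k j b A n x i p *
     G (axis j (t * x)) $ p $ p * cnj (jacobian k j b A n x i p))" by (simp add: n)
  also have "\<dots> = (\<Sum>p\<in>UNIV. if p = i then G (axis j (t * x)) $ i $ i else 0)"
  proof (intro sum.cong refl)
    fix p
    have "t * X * cnj t = X" for X using nn(3) by (metis mult.assoc mult.commute mult.left_neutral)
    moreover have "1 / n * (X * cnj (1 / n)) = X" for X
      using nn by (simp add: field_simps)
    ultimately show "jacobian k j b A n x i p * G (axis j (t * x)) $ p $ p * cnj (jacobian k j b A n x i p) =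
      (if p = i then G (axis j (t * x)) $ i $ i else 0)"
      by (auto simp: jacobian_def A_def monomial_matrix_def n(2))
  qed
  finally show ?thesis by simp
qed

lemma radial_alpha: "radial alpha" and radial_beta: "radial beta"
  by (auto simp: radial_def alpha_def beta_def G_axis_phase)

lemma alpha_pos: "0 < alpha x" and beta_pos: "0 < beta x"
  by (auto simp: alpha_def beta_def G_diag_pos)

lemma alpha_real: "alpha x = of_real (Re (alpha x))" and beta_real: "beta x = of_real (Re (beta x))"
  and Re_alpha_pos: "0 < Re (alpha x)" and Re_beta_pos: "0 < Re (beta x)"
  using alpha_pos[of x] beta_pos[of x] by (auto simp: less_complex_def complex_eq_iff)

lemma alpha_nonzero: "alpha x \<noteq> 0" and beta_nonzero: "beta x \<noteq> 0"
  using alpha_pos[of x] beta_pos[of x] by auto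

definition nsq :: "complex ^ 'n \<Rightarrow> real" where "nsq u = 1 + (\<Sum>l\<in>- {j}. (cmod (u $ l))\<^sup>2)"

lemma nsq_ge_1: "nsq u \<ge> 1"
  by (simp add: nsq_def sum_nonneg)

lemma Nsq_of_real: "Nsq u = of_real (nsq u)"
  unfolding Nsq_def nsq_def complex_norm_square[symmetric] by simp

lemma Nsq_nonzero: "Nsq u \<noteq> 0"
  using nsq_ge_1[of u] by (simp add: Nsq_of_real)

lemma E_of_real: "E u = of_real (exp (kap / 2 * ln (nsq u)))"
proof -
  have "ln (Nsq u) = of_real (ln (nsq u))" using nsq_ge_1[of u] by (simp add: Nsq_of_real Ln_of_real)
  then show ?thesis by (simp add: E_def exp_of_real[symmetric])
qed

lemma E_nonzero: "E u \<noteq> 0" by (simp add: E_def)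

lemma E_twist: "E u = twist k b (of_real (sqrt (nsq u)))"
proof -
  have n: "nsq u > 0" using nsq_ge_1[of u] by simp
  then have "sqrt (nsq u) = exp (ln (nsq u) / 2)" by (simp add: ln_sqrt[symmetric])
  then have "sqrt (nsq u) ^ k = exp (k * (ln (nsq u) / 2))" by (simp only: exp_of_nat_mult)
  then show ?thesis
    unfolding E_of_real twist_def of_real_power[symmetric] of_real_inverse[symmetric]
    by (auto simp: weight_def exp_minus)
qed

text \<open>For \<open>v = z + N e_j\<close> one has \<open><v, v> = 2 <z, v>\<close>, so
  \<open>2 <z, v> v / <v, v> - z\<close> equals \<open>v - z = N e_j\<close>.\<close>

lemma obtain_unitary:
  obtains A where "unitary_matrix A" "A *v hom_coords (j, b) u = axis j (of_real (sqrt (nsq u)))"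
    "\<And>l. A $ j $ l = cnj (hom_coords (j, b) u $ l) / of_real (sqrt (nsq u))"
proof -
  define z where "z = hom_coords (j, b) u"
  define N where "N = sqrt (nsq u)"
  have N: "N \<ge> 1" "N\<^sup>2 = nsq u" using nsq_ge_1[of u] by (auto simp: N_def)
  have zj: "z $ j = 1" by (simp add: z_def hom_coords_def)
  have zz: "(\<Sum>l\<in>UNIV. z $ l * cnj (z $ l)) = of_real (N\<^sup>2)"
  proof -
    have "(\<Sum>l\<in>UNIV. z $ l * cnj (z $ l)) = z $ j * cnj (z $ j) + (\<Sum>l\<in>- {j}. z $ l * cnj (z $ l))"
      by (subst sum.remove[of UNIV j]) (auto simp: Compl_eq_Diff_UNIV)
    also have "(\<Sum>l\<in>- {j}. z $ l * cnj (z $ l)) = (\<Sum>l\<in>- {j}. u $ l * cnj (u $ l))"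
      by (rule sum.cong) (auto simp: z_def hom_coords_def)
    finally show ?thesis using Nsq_of_real[of u] zj by (simp add: Nsq_def N(2))
  qed
  define v where "v = z + axis j (of_real N)"
  have vz: "(\<Sum>l\<in>UNIV. cnj (v $ l) * z $ l) = of_real (N\<^sup>2 + N)"
  proof -
    have "(\<Sum>l\<in>UNIV. cnj (v $ l) * z $ l) = (\<Sum>l\<in>UNIV. z $ l * cnj (z $ l) + (if l = j then of_real N * z $ j else 0))"
      by (rule sum.cong) (auto simp: v_def axis_def algebra_simps)
    then show ?thesis by (simp add: sum.distrib zz zj)
  qed
  have vv: "(\<Sum>l\<in>UNIV. v $ l * cnj (v $ l)) = of_real (2 * (N\<^sup>2 + N))"
  proof -
    have "(\<Sum>l\<in>UNIV. v $ l * cnj (v $ l)) = (\<Sum>l\<in>UNIV. cnj (v $ l) * z $ l + (if l = j then of_real N * cnj (v $ j) else 0))"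
      by (rule sum.cong) (auto simp: v_def axis_def algebra_simps)
    also have "\<dots> = of_real (N\<^sup>2 + N) + of_real N * cnj (v $ j)"
      unfolding sum.distrib vz by simp
    finally show ?thesis by (simp add: v_def zj axis_def power2_eq_square algebra_simps)
  qed
  have pos: "2 * (N\<^sup>2 + N) > 0" using N(1) by (simp add: add_pos_pos)
  have uA: "unitary_matrix (householder v)"
    by (rule unitary_householder) (use pos vv in \<open>simp add: complex_eq_iff\<close>)
  have Az: "householder v *v z = axis j (of_real N)"
    unfolding vec_eq_iff
  proof
    fix p
    have "(householder v *v z) $ p =
        (\<Sum>q\<in>UNIV. 2 * v $ p / of_real (2 * (N\<^sup>2 + N)) * (cnj (v $ q) * z $ q) - (if q = p then z $ p else 0))"
      by (simp only: matrix_vector_mult_def vec_lambda_beta, rule sum.cong)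
        (auto simp: householder_def vv algebra_simps)
    also have "\<dots> = 2 * v $ p / of_real (2 * (N\<^sup>2 + N)) * of_real (N\<^sup>2 + N) - z $ p"
      unfolding sum_subtractf sum_distrib_left[symmetric] vz by simp
    also have "\<dots> = v $ p - z $ p"
    proof -
      have "2 * v $ p / (2 * c) * c = v $ p" if "c \<noteq> 0" for c :: complex using that by simp
      from this[of "of_real (N\<^sup>2 + N)"] pos show ?thesis by (simp add: complex_eq_iff)
    qed
    finally show "(householder v *v z) $ p = axis j (complex_of_real N) $ p" by (simp add: v_def)
  qed
  have "householder v $ j $ l = cnj (z $ l) / of_real N" for l
    using unitary_matrix_row[OF uA Az, of l] N(1) by simp
  with that[of "householder v"] uA Az show ?thesis by (simp add: z_def N_def)
qed

text \<open>Row \<open>j\<close> of the Jacobian has only its vertical entry, so these components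
  involve \<open>beta\<close> alone.\<close>

lemma G_fibre_row:
  assumes "l \<noteq> j"
  shows "G u $ j $ l = u $ l * (kap * beta (E u * u $ j) * E u ^ 2 / Nsq u * cnj (u $ j))"
proof -
  define N where "N = complex_of_real (sqrt (nsq u))"
  have N: "N \<noteq> 0" "cnj N = N" "N * N = Nsq u"
    using nsq_ge_1[of u] by (auto simp: N_def Nsq_of_real of_real_mult[symmetric] simp del: of_real_mult)
  obtain A where A: "unitary_matrix A" "A *v hom_coords (j, b) u = axis j N"
    and row: "\<And>q. A $ j $ q = cnj (hom_coords (j, b) u $ q) / N"
    using obtain_unitary[of u, folded N_def] by blast
  have A3: "A $ j $ l = cnj (u $ l) / N" using assms by (simp add: row hom_coords_def)
  have tw: "twist k b N = E u" "cnj (E u) = E u" by (simp_all add: N_def E_twist[symmetric] E_of_real)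
  have "G u $ j $ l = (\<Sum>p\<in>UNIV. if p = j then E u * beta (E u * u $ j) * cnj (u $ j * (kap * E u / N * A $ j $ l)) else 0)"
    unfolding U_invariant_diag[OF A(1,2) N(1)] tw
    using assms by (intro sum.cong refl) (auto simp: jacobian_def beta_def tw)
  then show ?thesis
    using N by (simp add: A3 tw power2_eq_square field_simps Nsq_of_real)
qed

text \<open>At \<open>y = 0\<close> the vertical entry of a horizontal Jacobian row vanishes. What
  remains is a column of \<open>A\<close> without its entry \<open>j\<close>, of squared norm
  \<open>1 - |A_ji|^2\<close>; this is a Fubini-Study component.\<close>

lemma G_zero_section:
  assumes "i \<noteq> j" "u $ j = 0"
  shows "G u $ i $ i = alpha 0 / Nsq u * (1 - cnj (u $ i) * u $ i / Nsq u)"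
proof -
  define N where "N = complex_of_real (sqrt (nsq u))"
  have N: "N \<noteq> 0" "cnj N = N" "N * N = Nsq u"
    using nsq_ge_1[of u] by (auto simp: N_def Nsq_of_real of_real_mult[symmetric] simp del: of_real_mult)
  obtain A where A: "unitary_matrix A" "A *v hom_coords (j, b) u = axis j N"
    and row: "\<And>q. A $ j $ q = cnj (hom_coords (j, b) u $ q) / N"
    using obtain_unitary[of u, folded N_def] by blast
  have A3: "A $ j $ i = cnj (u $ i) / N" using assms by (simp add: row hom_coords_def)
  have "G u $ i $ i = (\<Sum>p\<in>UNIV. alpha 0 / Nsq u * (A $ p $ i * cnj (A $ p $ i))
      - (if p = j then alpha 0 / Nsq u * (A $ j $ i * cnj (A $ j $ i)) else 0))"
    unfolding U_invariant_diag[OF A(1,2) N(1)]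
    using assms N by (intro sum.cong refl) (auto simp: jacobian_def G_axis_diag N(3)[symmetric])
  also have "\<dots> = alpha 0 / Nsq u * (1 - A $ j $ i * cnj (A $ j $ i))"
    unfolding sum_subtractf sum_distrib_left[symmetric] unitary_matrix_sum[OF A(1)]
    by (simp add: algebra_simps)
  finally show ?thesis using N by (simp add: A3)
qed

text \<open>The Jacobian \<open>K\<close> is not expanded but compared with a matrix
  \<open>T\<close> of determinant \<open>det A\<close>: away from index \<open>j\<close> the two
  agree up to the factor \<open>1 / N\<close>. The factor \<open>det A\<close> then has modulus
  one.\<close>

lemma det_G:
  "det (G u) = E u ^ 2 / Nsq u ^ CARD('n) * alpha (E u * u $ j) ^ (CARD('n) - 1) * beta (E u * u $ j)"
proof -
  define N where "N = complex_of_real (sqrt (nsq u))"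
  have N: "N \<noteq> 0" "cnj N = N" "N * N = Nsq u"
    using nsq_ge_1[of u] by (auto simp: N_def Nsq_of_real of_real_mult[symmetric] simp del: of_real_mult)
  obtain A where A: "unitary_matrix A" "A *v hom_coords (j, b) u = axis j N"
    using obtain_unitary[of u, folded N_def] by blast
  have tw: "twist k b N = E u" "cnj (E u) = E u" by (simp_all add: N_def E_twist[symmetric] E_of_real)
  define z where "z = hom_coords (j, b) u"
  have zj: "z $ j = 1" by (simp add: z_def hom_coords_def)
  define K :: "complex ^ 'n ^ 'n" where "K = (\<chi> i p. jacobian k j b A N (u $ j) i p)"
  define D :: "complex ^ 'n ^ 'n" where "D = G (axis j (E u * u $ j))"
  \<comment> \<open>\<open>M\<close> is the identity with row \<open>j\<close> replaced by
    \<open>z\<close>. Its determinant is \<open>z $ j = 1\<close>, and row \<open>j\<close> of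
    \<open>T\<close> becomes \<open>A z\<close>, a multiple of \<open>e_j\<close>.\<close>
  define M :: "complex ^ 'n ^ 'n" where
    "M = (\<chi> i. if i = j then (\<Sum>l\<in>UNIV. z $ l *s row l (mat 1)) else row i (mat 1))"
  have "det M = 1" unfolding M_def cramer_lemma_transpose by (simp add: zj)
  moreover define T where "T = M ** transpose A"
  ultimately have detT: "det T = det A" by (simp add: det_mul det_transpose)
  have rowM: "M $ j $ q = z $ q" for q
    by (simp add: M_def sum_component row_def mat_def if_distrib cong: if_cong)
  have rowM': "M $ i $ q = of_bool (i = q)" if "i \<noteq> j" for i q
    using that by (simp add: M_def row_def mat_def)
  have Tj: "T $ j $ p = (if p = j then N else 0)" for p
  proof -
    have "T $ j $ p = (A *v z) $ p"
      by (simp add: T_def matrix_matrix_mult_def matrix_vector_mult_def rowM transpose_def mult.commute)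
    then show ?thesis using A(2) by (simp add: z_def axis_def)
  qed
  have Ti: "T $ i $ p = A $ p $ i" if "i \<noteq> j" for i p
  proof -
    have "T $ i $ p = (\<Sum>q\<in>UNIV. if q = i then A $ p $ i else 0)"
      unfolding T_def matrix_matrix_mult_def
      by (simp only: vec_lambda_beta, rule sum.cong) (auto simp: rowM'[OF that] transpose_def)
    then show ?thesis by simp
  qed
  have "T $ j $ j * det K = K $ j $ j * (1 / N) ^ (CARD('n) - 1) * det T"
    by (rule det_scale_minor) (auto simp: Tj K_def jacobian_def Ti)
  then have "N * det K = E u * (1 / N) ^ (CARD('n) - 1) * det A"
    by (simp add: Tj K_def jacobian_def tw detT)
  then have "det K = E u * ((1 / N) ^ (CARD('n) - 1) * (1 / N)) * det A"
    using N(1) by (simp add: field_simps)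
  also have "(1 / N) ^ (CARD('n) - 1) * (1 / N) = (1 / N) ^ CARD('n)"
    by (subst power_Suc2[symmetric]) simp
  finally have detK: "det K = E u / N ^ CARD('n) * det A" by (simp add: power_divide)
  have "G u = K ** D ** transpose (\<chi> i l. cnj (K $ i $ l))"
  proof (simp only: vec_eq_iff, intro allI)
    fix i l
    have "(K ** D ** transpose (\<chi> i l. cnj (K $ i $ l))) $ i $ l =
       (\<Sum>q\<in>UNIV. \<Sum>p\<in>UNIV. K $ i $ p * D $ p $ q * cnj (K $ l $ q))"
      by (simp add: matrix_matrix_mult_def transpose_def sum_distrib_right)
    also have "\<dots> = (\<Sum>p\<in>UNIV. \<Sum>q\<in>UNIV. K $ i $ p * D $ p $ q * cnj (K $ l $ q))"
      by (rule sum.swap)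
    also have "\<dots> = G u $ i $ l"
      unfolding U_invariant_jacobian[OF invariant A(1,2) N(1)] by (simp add: K_def D_def tw)
    finally show "G u $ i $ l = (K ** D ** transpose (\<chi> i l. cnj (K $ i $ l))) $ i $ l" by simp
  qed
  then have "det (G u) = det K * det D * cnj (det K)"
    by (simp add: det_mul det_transpose det_cnj)
  also have "det D = (\<Prod>i\<in>UNIV. D $ i $ i)"
    by (rule det_diagonal) (simp add: D_def G_axis_offdiag)
  also have "\<dots> = D $ j $ j * (\<Prod>i\<in>- {j}. D $ i $ i)"
    by (subst prod.remove[of UNIV j]) (auto simp: Compl_eq_Diff_UNIV)
  also have "(\<Prod>i\<in>- {j}. D $ i $ i) = (\<Prod>i\<in>- {j}. alpha (E u * u $ j))"
    by (rule prod.cong) (auto simp: D_def G_axis_diag)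
  also have "\<dots> = alpha (E u * u $ j) ^ (CARD('n) - 1)"
    by (simp add: card_Diff_singleton Compl_eq_Diff_UNIV)
  finally have *: "det (G u) = det K * (D $ j $ j * alpha (E u * u $ j) ^ (CARD('n) - 1)) * cnj (det K)" .
  have "N ^ CARD('n) * N ^ CARD('n) = Nsq u ^ CARD('n)"
    by (simp only: N(3)[symmetric] power_mult_distrib)
  then have "det (G u) = (det A * cnj (det A)) * (E u * E u / Nsq u ^ CARD('n)) *
      alpha (E u * u $ j) ^ (CARD('n) - 1) * beta (E u * u $ j)"
    unfolding * detK by (simp add: D_def beta_def tw N(2) ac_simps)
  then show ?thesis by (simp add: det_unitary[OF A(1)] power2_eq_square)
qed

end

section \<open>Wirtinger operators in one variable\<close>

definition dz :: "(complex \<Rightarrow> complex) \<Rightarrow> complex \<Rightarrow> complex" where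
  "dz F x = (frechet_derivative F (at x) 1 - \<i> * frechet_derivative F (at x) \<i>) / 2"

definition dzbar :: "(complex \<Rightarrow> complex) \<Rightarrow> complex \<Rightarrow> complex" where
  "dzbar F x = (frechet_derivative F (at x) 1 + \<i> * frechet_derivative F (at x) \<i>) / 2"

lemma wirtinger1_dz:
  assumes "wirtinger1 F p q x" shows "dz F x = p" "dzbar F x = q"
proof -
  have "frechet_derivative F (at x) = (\<lambda>h. p * h + q * cnj h)"
    by (rule frechet_derivative_at[OF assms[unfolded wirtinger1_def], symmetric])
  then show "dz F x = p" "dzbar F x = q" by (simp_all add: dz_def dzbar_def algebra_simps)
qed

lemma wirtinger1_dz_dzbar: "wirtinger1 F p q x \<Longrightarrow> wirtinger1 F (dz F x) (dzbar F x) x"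
  using wirtinger1_dz by blast

lemma wirtinger1_inverse:
  assumes "wirtinger1 F p q x" "F x \<noteq> 0"
  shows "wirtinger1 (\<lambda>x. inverse (F x)) (- (inverse (F x) * inverse (F x)) * p) (- (inverse (F x) * inverse (F x)) * q) x"
proof -
  have "wirtinger1 inverse (- (inverse (F x) * inverse (F x))) 0 (F x)"
    using DERIV_inverse[OF assms(2)] by (intro wirtinger1_field) (simp add: power2_eq_square)
  from wirtinger1_compose[OF this assms(1)] show ?thesis by simp
qed

lemma wirtinger1_ln: "0 < x \<Longrightarrow> wirtinger1 ln (inverse x) 0 x"
  by (rule wirtinger1_field) (auto intro!: has_field_derivative_Ln simp: complex_nonpos_Reals_iff less_complex_def)

lemma wirtinger_inverse:
  assumes "wirtinger F p q u" "F u \<noteq> 0"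
  shows "wirtinger (\<lambda>x. inverse (F x)) (\<lambda>i. - (inverse (F u) * inverse (F u)) * p i)
     (\<lambda>i. - (inverse (F u) * inverse (F u)) * q i) u"
proof -
  have "wirtinger1 inverse (- (inverse (F u) * inverse (F u))) 0 (F u)"
    using DERIV_inverse[OF assms(2)] by (intro wirtinger1_field) (simp add: power2_eq_square)
  from wirtinger_compose[OF this assms(1)] show ?thesis by simp
qed

context invariant_chart
begin

subsection \<open>The Ricci form\<close>

text \<open>The holomorphic derivative of \<open>ln (Nsq u)\<close>.\<close>

definition Q :: "complex ^ 'n \<Rightarrow> 'n \<Rightarrow> complex" where
  "Q u i = (if i = j then 0 else cnj (u $ i)) * inverse (Nsq u)"

lemma cnj_Nsq [simp]: "cnj (Nsq u) = Nsq u" by (simp add: Nsq_of_real)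

lemma cnj_E [simp]: "cnj (E u) = E u" by (simp add: E_of_real)

lemma Nsq_pos: "0 < Nsq u"
  using nsq_ge_1[of u] by (simp add: Nsq_of_real less_complex_def)

lemma wirtinger_Nsq: "wirtinger Nsq (\<lambda>i. Q u i * Nsq u) (\<lambda>i. cnj (Q u i) * Nsq u) u"
proof -
  have "wirtinger (\<lambda>u. 1 + (\<Sum>l\<in>- {j}. u $ l * cnj (u $ l)))
     (\<lambda>i. 0 + (\<Sum>l\<in>- {j}. of_bool (i = l) * cnj (u $ l) + u $ l * cnj 0))
     (\<lambda>i. 0 + (\<Sum>l\<in>- {j}. 0 * cnj (u $ l) + u $ l * cnj (of_bool (i = l)))) u"
    by (intro wirtinger_add wirtinger_const wirtinger_sum wirtinger_mult wirtinger_cnj wirtinger_coord)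
  moreover have "(\<Sum>l\<in>- {j}. of_bool (i = l) * cnj (u $ l) + u $ l * cnj 0) = Q u i * Nsq u" for i
  proof -
    have "(\<Sum>l\<in>- {j}. of_bool (i = l) * cnj (u $ l) + u $ l * cnj 0) =
        (\<Sum>l\<in>- {j}. if l = i then cnj (u $ l) else 0)"
      by (rule sum.cong) auto
    then show ?thesis using Nsq_nonzero[of u] by (simp add: Q_def sum.delta)
  qed
  moreover have "(\<Sum>l\<in>- {j}. 0 * cnj (u $ l) + u $ l * cnj (of_bool (i = l))) = cnj (Q u i) * Nsq u" for i
  proof -
    have "(\<Sum>l\<in>- {j}. 0 * cnj (u $ l) + u $ l * cnj (of_bool (i = l))) =
        (\<Sum>l\<in>- {j}. if l = i then u $ l else 0)"
      by (rule sum.cong) auto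
    then show ?thesis using Nsq_nonzero[of u] by (simp add: Q_def sum.delta)
  qed
  ultimately show ?thesis unfolding Nsq_def[abs_def] by simp
qed

lemma wirtinger_ln_Nsq: "wirtinger (\<lambda>u. ln (Nsq u)) (Q u) (\<lambda>i. cnj (Q u i)) u"
  by (rule wirtinger_cong[OF wirtinger_compose[OF wirtinger1_ln[OF Nsq_pos] wirtinger_Nsq]])
    (use Nsq_nonzero in auto)

lemma wirtinger_E: "wirtinger E (\<lambda>i. kap / 2 * Q u i * E u) (\<lambda>i. kap / 2 * cnj (Q u i) * E u) u"
proof -
  have "wirtinger1 (\<lambda>x :: complex. exp (kap / 2 * x)) (kap / 2 * exp (kap / 2 * x)) 0 x" for x :: complex
    by (rule wirtinger1_field) (auto intro!: derivative_eq_intros)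
  from wirtinger_compose[OF this wirtinger_ln_Nsq]
  show ?thesis unfolding E_def[abs_def] by (rule wirtinger_cong) simp_all
qed

text \<open>The fibre coordinate of the point on the fibre \<open>w = 0\<close> in the same unitary orbit.\<close>

definition xi :: "complex ^ 'n \<Rightarrow> complex" where "xi u = E u * u $ j"

lemma wirtinger_xi:
  "wirtinger xi (\<lambda>i. kap / 2 * Q u i * xi u + E u * of_bool (i = j)) (\<lambda>i. kap / 2 * cnj (Q u i) * xi u) u"
  unfolding xi_def[abs_def]
  by (rule wirtinger_cong[OF wirtinger_mult[OF wirtinger_E wirtinger_coord]]) simp_all

lemma wirtinger1_beta: "wirtinger1 beta (dz beta x) (dzbar beta x) x"
proof -
  have "(\<lambda>u. G u $ j $ j) differentiable (at (axis j x))"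
    using G_twice_differentiable unfolding twice_differentiable_def by blast
  from wirtinger1_axis[OF this] show ?thesis
    unfolding beta_def[symmetric] by (rule wirtinger1_dz_dzbar)
qed

text \<open>Recognising these as derivatives of a smooth metric entry makes
  \<open>dzbar beta\<close> differentiable once more.\<close>

lemma dz_beta: "dz beta = (\<lambda>x. d_hol j (\<lambda>u. G u $ j $ j) (axis j x))"
  and dzbar_beta: "dzbar beta = (\<lambda>x. d_bar j (\<lambda>u. G u $ j $ j) (axis j x))"
proof -
  have "(\<lambda>u. G u $ j $ j) differentiable (at (axis j x))" for x
    using G_twice_differentiable unfolding twice_differentiable_def by blast
  from wirtinger1_axis[OF this]
  have *: "wirtinger1 beta (d_hol j (\<lambda>u. G u $ j $ j) (axis j x)) (d_bar j (\<lambda>u. G u $ j $ j) (axis j x)) x" for x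
    unfolding beta_def[symmetric] .
  show "dz beta = (\<lambda>x. d_hol j (\<lambda>u. G u $ j $ j) (axis j x))"
    and "dzbar beta = (\<lambda>x. d_bar j (\<lambda>u. G u $ j $ j) (axis j x))"
    using wirtinger1_dz[OF *] by auto
qed

lemma dzbar_beta_cnj: "dzbar beta x = cnj (dz beta x)"
  by (rule wirtinger1_real[OF wirtinger1_beta]) (metis Reals_of_real beta_real)

lemma beta_euler: "x * dz beta x = cnj x * dzbar beta x"
  by (rule radial_wirtinger1[OF radial_beta wirtinger1_beta])

lemma wirtinger1_dzbar_beta: "wirtinger1 (dzbar beta) (dz (dzbar beta) x) (dzbar (dzbar beta) x) x"
proof -
  have "d_bar j (\<lambda>u. G u $ j $ j) differentiable (at (axis j x))"
    using G_twice_differentiable unfolding twice_differentiable_def by blast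
  from wirtinger1_axis[OF this] show ?thesis
    unfolding dzbar_beta[symmetric] by (rule wirtinger1_dz_dzbar)
qed

text \<open>\<open>G u $ j $ a0\<close> is \<open>u $ a0 * H u\<close> and \<open>u $ a0 = 0\<close>
  on the fibre, so only the value of \<open>H\<close> survives: its derivatives must exist but need
  not be computed.\<close>

lemma G_fibre_row_derivative:
  "d_hol a0 (\<lambda>u. G u $ j $ a0) (axis j x) = kap * beta x * cnj x"
proof -
  define H where "H = (\<lambda>u. kap * beta (xi u) * (E u * E u) * inverse (Nsq u) * cnj (u $ j))"
  have "\<exists>p q. wirtinger H p q u" for u
    unfolding H_def
    by (intro exI) (rule wirtinger_mult wirtinger_const wirtinger_compose[OF wirtinger1_beta]
      wirtinger_xi wirtinger_E wirtinger_inverse[OF wirtinger_Nsq Nsq_nonzero] wirtinger_cnj wirtinger_coord)+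
  then obtain p q where H: "wirtinger H p q (axis j x)" by blast
  have "(\<lambda>u. G u $ j $ a0) = (\<lambda>u. u $ a0 * H u)"
    unfolding G_fibre_row[OF a0] by (simp add: H_def xi_def power2_eq_square divide_inverse)
  then have "d_hol a0 (\<lambda>u. G u $ j $ a0) (axis j x) = 1 * H (axis j x) + axis j x $ a0 * p a0"
    using wirtinger_d_hol[OF wirtinger_mult[OF wirtinger_coord H]] by simp
  moreover have "nsq (axis j x) = 1" by (simp add: nsq_def axis_def)
  moreover have "axis j x $ a0 = 0" using a0 by (simp add: axis_def)
  ultimately show ?thesis
    by (simp add: H_def xi_def E_of_real Nsq_of_real axis_def)
qed

text \<open>Closedness of the Kaehler form trades the vertical derivative of a horizontal entry for
  the horizontal derivative of a mixed one. Thus \<open>beta\<close> determines \<open>alpha\<close>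
  up to a constant.\<close>

lemma wirtinger1_alpha: "wirtinger1 alpha (kap * beta x * cnj x) (kap * beta x * x) x"
proof -
  have "d_hol j (\<lambda>v. G v $ a0 $ a0) (axis j x) = d_hol a0 (\<lambda>v. G v $ j $ a0) (axis j x)"
    using kahler unfolding kahler_metric_def by blast
  then have p: "d_hol j (\<lambda>v. G v $ a0 $ a0) (axis j x) = kap * beta x * cnj x"
    by (simp add: G_fibre_row_derivative)
  have "(\<lambda>u. G u $ a0 $ a0) differentiable (at (axis j x))"
    using G_twice_differentiable unfolding twice_differentiable_def by blast
  from wirtinger1_axis[OF this, unfolded p]
  have *: "wirtinger1 alpha (kap * beta x * cnj x) (d_bar j (\<lambda>u. G u $ a0 $ a0) (axis j x)) x"
    by (simp add: alpha_def[abs_def])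
  have "cnj (beta x) = beta x" by (metis beta_real complex_cnj_complex_of_real)
  with wirtinger1_real[OF *] have "d_bar j (\<lambda>u. G u $ a0 $ a0) (axis j x) = kap * beta x * x"
    by (metis (no_types, lifting) Reals_of_real alpha_real complex_cnj_cnj complex_cnj_complex_of_real complex_cnj_mult)
  with * show ?thesis by simp
qed

text \<open>\<open>lam\<close> is \<open>ln (det g)\<close> on the fibre \<open>w = 0\<close>, \<open>lam2\<close> its conjugate derivative and \<open>- S\<close> the vertical Ricci
  curvature; \<open>M\<close> is half of the derivative of \<open>lam\<close> in the direction of \<open>ln |y|\<close>.\<close>

definition lam :: "complex \<Rightarrow> complex" where
  "lam x = (of_nat CARD('n) - 1) * ln (alpha x) + ln (beta x)"

definition lam2 :: "complex \<Rightarrow> complex" where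
  "lam2 x = (of_nat CARD('n) - 1) * kap * (beta x * x) * inverse (alpha x) + dzbar beta x * inverse (beta x)"

definition M :: "complex \<Rightarrow> complex" where "M x = cnj x * lam2 x"

definition S :: "complex \<Rightarrow> complex" where "S = dz lam2"

lemma cnj_beta [simp]: "cnj (beta x) = beta x" and cnj_alpha [simp]: "cnj (alpha x) = alpha x"
  by (metis beta_real complex_cnj_complex_of_real) (metis alpha_real complex_cnj_complex_of_real)

lemma wirtinger1_lam: "wirtinger1 lam (cnj (lam2 x)) (lam2 x) x"
  unfolding lam_def[abs_def]
  by (rule wirtinger1_cong[OF wirtinger1_add[OF wirtinger1_mult[OF wirtinger1_const
     wirtinger1_compose[OF wirtinger1_ln[OF alpha_pos] wirtinger1_alpha]]
     wirtinger1_compose[OF wirtinger1_ln[OF beta_pos] wirtinger1_beta]]])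
    (simp_all add: lam2_def dzbar_beta_cnj)

lemma radial_lam: "radial lam"
  using radial_alpha radial_beta by (simp add: radial_def lam_def)

lemma wirtinger1_lam2: "wirtinger1 lam2 (S x) (dzbar lam2 x) x"
proof -
  have "\<exists>p q. wirtinger1 lam2 p q x"
    unfolding lam2_def[abs_def]
    by (intro exI) (rule wirtinger1_add wirtinger1_mult wirtinger1_const wirtinger1_beta wirtinger1_id
      wirtinger1_dzbar_beta wirtinger1_inverse[OF wirtinger1_alpha alpha_nonzero]
      wirtinger1_inverse[OF wirtinger1_beta beta_nonzero])+
  then show ?thesis unfolding S_def using wirtinger1_dz_dzbar by blast
qed

lemma lam2_equivariant: "norm t = 1 \<Longrightarrow> lam2 (t * x) = t * lam2 x"
  using radial_wirtinger1_equivariant(2)[OF radial_lam wirtinger1_lam] .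

lemma radial_S: "radial S"
  unfolding radial_def
proof (intro allI impI)
  fix t x :: complex assume t: "norm t = 1"
  have "wirtinger1 (\<lambda>x. t * lam2 x) (S (t * x) * t) (dzbar lam2 (t * x) * cnj t) x"
    using wirtinger1_rotate[OF wirtinger1_lam2[of "t * x"]] by (simp add: lam2_equivariant[OF t])
  from wirtinger1_unique(1)[OF this wirtinger1_mult[OF wirtinger1_const wirtinger1_lam2[of x]]]
  have "t * S (t * x) = t * S x" by (simp add: mult.commute)
  moreover have "t \<noteq> 0" using t by auto
  ultimately show "S (t * x) = S x" by simp
qed

lemma cnj_M [simp]: "cnj (M x) = M x"
  using radial_wirtinger1[OF radial_lam wirtinger1_lam[of x]] by (simp add: M_def)

lemma radial_M: "radial M"
  unfolding radial_def
proof (intro allI impI)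
  fix t x :: complex assume t: "norm t = 1"
  have "cnj t * t = 1" using t by (metis complex_norm_square mult.commute of_real_1 power_one)
  moreover have "M (t * x) = (cnj t * t) * M x" by (simp add: M_def lam2_equivariant[OF t] ac_simps)
  ultimately show "M (t * x) = M x" by simp
qed

text \<open>\<open>M\<close> is real and radial. Reality makes its two derivatives conjugate, and
  the Euler relation then shows that \<open>S\<close> is real away from \<open>0\<close>; at
  \<open>0\<close> the factor \<open>x\<close> settles the claim.\<close>

lemma wirtinger1_M: "wirtinger1 M (cnj x * S x) (x * S x) x"
  and lam2_dzbar: "lam2 x + cnj x * dzbar lam2 x = x * S x"
proof -
  have w: "wirtinger1 M (cnj x * S x) (lam2 x + cnj x * dzbar lam2 x) x"
    unfolding M_def[abs_def]
    by (rule wirtinger1_cong[OF wirtinger1_mult[OF wirtinger1_cnj[OF wirtinger1_id] wirtinger1_lam2]]) simp_all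
  have q: "lam2 x + cnj x * dzbar lam2 x = x * cnj (S x)"
    using wirtinger1_real[OF w] by (simp add: Reals_cnj_iff)
  have "x * (cnj x * S x) = cnj x * (x * cnj (S x))"
    using radial_wirtinger1[OF radial_M w[unfolded q]] .
  then have "x * S x = x * cnj (S x)" by (cases "x = 0") auto
  from trans[OF q this[symmetric]] show *: "lam2 x + cnj x * dzbar lam2 x = x * S x" .
  from w[unfolded *] show "wirtinger1 M (cnj x * S x) (x * S x) x" .
qed

lemma ln_det_G: "ln (det (G u)) = (kap - of_nat CARD('n)) * ln (Nsq u) + lam (xi u)"
proof -
  define n where "n = CARD('n)"
  have n: "of_nat (n - 1) = (of_nat n - 1 :: complex)"
    unfolding n_def by (simp add: of_nat_diff)
  define e s A B where defs: "e = exp (kap / 2 * ln (nsq u))" "s = nsq u" "A = Re (alpha (xi u))" "B = Re (beta (xi u))"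
  have pos: "e > 0" "s > 0" "A > 0" "B > 0"
    using nsq_ge_1[of u] by (auto simp: defs Re_alpha_pos Re_beta_pos)
  have "det (G u) = of_real (e ^ 2 / s ^ n * A ^ (n - 1) * B)"
    using alpha_real[of "xi u"] beta_real[of "xi u"]
    by (simp add: det_G[of u, folded xi_def] E_of_real Nsq_of_real n_def defs)
  moreover have "e ^ 2 / s ^ n * A ^ (n - 1) * B > 0" using pos by simp
  ultimately have "ln (det (G u)) = of_real (ln (e ^ 2 / s ^ n * A ^ (n - 1) * B))"
    by (simp only: Ln_of_real)
  also have "ln (e ^ 2 / s ^ n * A ^ (n - 1) * B) = (kap - n) * ln s + (n - 1) * ln A + ln B"
    using pos by (simp add: ln_mult ln_div ln_realpow defs(1) algebra_simps)
      (simp add: defs)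
  finally have "ln (det (G u)) = of_real ((kap - n) * ln s + (n - 1) * ln A + ln B)" .
  moreover have "ln (Nsq u) = of_real (ln s)" "ln (alpha (xi u)) = of_real (ln A)" "ln (beta (xi u)) = of_real (ln B)"
    using pos Ln_of_real[of A] Ln_of_real[of B] Ln_of_real[of s]
      alpha_real[of "xi u"] beta_real[of "xi u"]
    by (simp_all add: Nsq_of_real defs)
  ultimately show ?thesis by (simp add: lam_def n_def[symmetric] n[simplified])
qed

lemma d_bar_ln_det:
  "d_bar l (\<lambda>w. ln (det (G w))) u = cnj (Q u l) * (kap - of_nat CARD('n) + kap * M (xi u)) + of_bool (l = j) * (E u * lam2 (xi u))"
proof -
  have "wirtinger (\<lambda>w. ln (det (G w)))
    (\<lambda>i. 0 * ln (Nsq u) + (kap - of_nat CARD('n)) * Q u i + (cnj (lam2 (xi u)) * (kap / 2 * Q u i * xi u + E u * of_bool (i = j))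
        + lam2 (xi u) * cnj (kap / 2 * cnj (Q u i) * xi u)))
    (\<lambda>i. 0 * ln (Nsq u) + (kap - of_nat CARD('n)) * cnj (Q u i) + (cnj (lam2 (xi u)) * (kap / 2 * cnj (Q u i) * xi u)
        + lam2 (xi u) * cnj (kap / 2 * Q u i * xi u + E u * of_bool (i = j)))) u"
    unfolding ln_det_G
    by (intro wirtinger_add wirtinger_mult wirtinger_const wirtinger_ln_Nsq
      wirtinger_compose[OF wirtinger1_lam wirtinger_xi])
  from wirtinger_d_bar[OF this, of l]
  have "d_bar l (\<lambda>w. ln (det (G w))) u = (kap - of_nat CARD('n)) * cnj (Q u l) + (cnj (lam2 (xi u)) * xi u) * (kap / 2 * cnj (Q u l))
      + (cnj (xi u) * lam2 (xi u)) * (kap / 2 * cnj (Q u l)) + of_bool (l = j) * (E u * lam2 (xi u))"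
    by (simp add: algebra_simps)
  moreover have "cnj (lam2 (xi u)) * xi u = M (xi u)"
    using cnj_M[of "xi u"] by (simp add: M_def mult.commute)
  ultimately show ?thesis unfolding M_def[symmetric] by (simp add: algebra_simps)
qed

text \<open>Components of the Fubini-Study form \<open>\<partial>\<partial>-bar ln (Nsq u)\<close>.\<close>

definition FS :: "complex ^ 'n \<Rightarrow> 'n \<Rightarrow> 'n \<Rightarrow> complex" where
  "FS u i l = (if l = j then 0 else of_bool (i = l) * inverse (Nsq u) - u $ l * Q u i * inverse (Nsq u))"

lemma wirtinger_cnj_Q: "\<exists>q. wirtinger (\<lambda>u. cnj (Q u l)) (\<lambda>i. FS u i l) q u"
proof (cases "l = j")
  case True
  then show ?thesis using wirtinger_const[of 0 u] by (auto simp: Q_def FS_def)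
next
  case False
  then have "(\<lambda>u. cnj (Q u l)) = (\<lambda>u. u $ l * inverse (Nsq u))" by (simp add: Q_def)
  then show ?thesis
    by (simp only:) (rule exI, rule wirtinger_cong[OF wirtinger_mult[OF wirtinger_coord
      wirtinger_inverse[OF wirtinger_Nsq Nsq_nonzero]] _ refl],
      use False Nsq_nonzero in \<open>simp add: FS_def\<close>)
qed

text \<open>A Fubini-Study part plus a multiple of the square of the covector
  \<open>E * (dy + kap * y * Q)\<close>, the connection form of the line bundle up to scaling. The
  vertical terms combine into this square by \<open>lam2_dzbar\<close>.\<close>

lemma ricci_formula:
  "ricci g (j, b) u $ i $ l = FS u i l * (of_nat CARD('n) - kap - kap * M (xi u))
     - S (xi u) * (kap * xi u * Q u i + of_bool (i = j) * E u) * cnj (kap * xi u * Q u l + of_bool (l = j) * E u)"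
proof -
  obtain q where q: "wirtinger (\<lambda>u. cnj (Q u l)) (\<lambda>i. FS u i l) q u" using wirtinger_cnj_Q by blast
  define P where "P = (\<lambda>i. kap / 2 * Q u i * xi u + E u * of_bool (i = j))"
  have "d_hol i (\<lambda>v. d_bar l (\<lambda>w. ln (det (G w))) v) u =
      (FS u i l * (kap - of_nat CARD('n) + kap * M (xi u)) + cnj (Q u l) * (0 + (0 * M (xi u) + kap *
        (cnj (xi u) * S (xi u) * P i + xi u * S (xi u) * cnj (kap / 2 * cnj (Q u i) * xi u)))))
     + (0 * (E u * lam2 (xi u)) + of_bool (l = j) * (kap / 2 * Q u i * E u * lam2 (xi u) +
         E u * (S (xi u) * P i + dzbar lam2 (xi u) * cnj (kap / 2 * cnj (Q u i) * xi u))))"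
    unfolding d_bar_ln_det P_def
    by (rule wirtinger_d_hol[OF wirtinger_add[OF wirtinger_mult[OF q wirtinger_add[OF wirtinger_const
      wirtinger_mult[OF wirtinger_const wirtinger_compose[OF wirtinger1_M wirtinger_xi]]]]
      wirtinger_mult[OF wirtinger_const wirtinger_mult[OF wirtinger_E
        wirtinger_compose[OF wirtinger1_lam2 wirtinger_xi]]]]])
  also have "\<dots> = FS u i l * (kap - of_nat CARD('n) + kap * M (xi u))
      + S (xi u) * (kap * xi u * Q u i + of_bool (i = j) * E u) * (cnj (Q u l) * kap * cnj (xi u))
      + of_bool (l = j) * E u * (kap / 2 * Q u i * (lam2 (xi u) + cnj (xi u) * dzbar lam2 (xi u)) + S (xi u) * P i)"
    by (simp add: P_def field_simps)
  also have "\<dots> = FS u i l * (kap - of_nat CARD('n) + kap * M (xi u))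
      + S (xi u) * (kap * xi u * Q u i + of_bool (i = j) * E u) * cnj (kap * xi u * Q u l + of_bool (l = j) * E u)"
    unfolding lam2_dzbar by (simp add: P_def field_simps)
  finally show ?thesis by (simp add: ricci_def algebra_simps)
qed

end

subsection \<open>Points and boundedness of functions\<close>

lemma point_transition:
  assumes "u \<in> overlap c d" shows "point k c u = point k d (transition k c d u)"
  unfolding point_def
  by (rule equiv_class_eq[OF equiv_glue]) (use assms in \<open>simp add: glue_def\<close>)

lemma point_fibre_flip:
  assumes "x \<noteq> 0"
  shows "point k (j, b) (axis j x) = point k (j, \<not> b) (axis j (inverse x))"
proof -
  have h: "hom_coords (j, b) (axis j x) = axis j 1"
    by (auto simp: hom_coords_def vec_eq_iff axis_def)
  have "axis j x \<in> overlap (j, b) (j, \<not> b)"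
    using assms unfolding overlap_def mem_Collect_eq h in_chart_def by (simp add: axis_def)
  moreover have "transition k (j, b) (j, \<not> b) (axis j x) = axis j (inverse x)"
    unfolding transition_def h by (auto simp: chart_coords_def Let_def vec_eq_iff axis_def)
  ultimately show ?thesis using point_transition by metis
qed

lemma point_section_flip:
  assumes "x \<noteq> 0" "a \<noteq> j"
  shows "point k (j, b) (axis a x) = point k (a, b) (axis j (inverse x))"
proof -
  have h: "hom_coords (j, b) (axis a x) = axis j 1 + axis a x"
    using assms by (auto simp: hom_coords_def vec_eq_iff axis_def)
  have "axis a x \<in> overlap (j, b) (a, b)"
    using assms unfolding overlap_def mem_Collect_eq h in_chart_def by (simp add: axis_def)
  moreover have "transition k (j, b) (a, b) (axis a x) = axis j (inverse x)"
    using assms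
    unfolding transition_def h by (auto simp: chart_coords_def Let_def vec_eq_iff axis_def divide_inverse)
  ultimately show ?thesis using point_transition by metis
qed

lemma norm_axis: "norm (axis i x) = norm x"
proof -
  have "(norm (axis i x $ l))\<^sup>2 = (if l = i then (norm x)\<^sup>2 else 0)" for l
    by (simp add: axis_def)
  then show ?thesis by (simp add: norm_vec_def L2_set_def)
qed

lemma wirtinger1_Re_derivative:
  assumes "wirtinger1 F p q (of_real x)"
  shows "((\<lambda>x. Re (F (of_real x))) has_real_derivative Re (p + q)) (at x)"
proof -
  have "((\<lambda>x. F (of_real x)) has_derivative (\<lambda>h. p * of_real h + q * cnj (of_real h))) (at x)"
    by (rule has_derivative_compose[OF has_derivative_of_real[OF has_derivative_ident] assms[unfolded wirtinger1_def]])
  from has_derivative_Re[OF this] show ?thesis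
    unfolding has_field_derivative_def by (rule has_derivative_eq_rhs) (auto simp: algebra_simps)
qed

lemma wirtinger1_eq_0_constant:
  assumes "\<And>x. wirtinger1 F 0 0 x" shows "F x = F y"
proof -
  have "(F has_derivative (\<lambda>h. 0)) (at x within UNIV)" for x
    using assms[of x] by (simp add: wirtinger1_def)
  from has_derivative_zero_constant[OF convex_UNIV this] obtain c where "\<And>x. F x = c" by blast
  then show ?thesis by simp
qed

lemma wirtinger1_holomorphic:
  assumes "\<And>x. wirtinger1 F (p x) 0 x"
  shows "(F has_field_derivative p x) (at x)" "F holomorphic_on UNIV"
proof -
  show *: "(F has_field_derivative p x) (at x)" for x
    using assms[of x] by (simp add: wirtinger1_def has_field_derivative_def)
  then show "F holomorphic_on UNIV"
    by (auto simp: holomorphic_on_def field_differentiable_def intro: DERIV_subset)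
qed

text \<open>The difference \<open>h - s ln (1 + |x|\<^sup>2)\<close> is harmonic and bounded above if \<open>s > 0\<close>, hence constant, but \<open>h\<close> is
  bounded and the logarithm is not.\<close>

lemma log_potential_nonpos:
  fixes h :: "complex \<Rightarrow> real"
  assumes h: "\<And>x. wirtinger1 (\<lambda>x. of_real (h x)) (p x) (cnj (p x)) x"
    and p: "\<And>x. wirtinger1 p (p' x) (of_real s * inverse (1 + x * cnj x) ^ 2) x"
    and bound: "\<And>x. \<bar>h x\<bar> \<le> C"
  shows "s \<le> 0"
proof (rule ccontr)
  assume "\<not> s \<le> 0"
  then have s: "s > 0" by simp
  define N where "N = (\<lambda>x. 1 + x * cnj x)"
  have N_real: "N x = of_real (1 + (cmod x)\<^sup>2)" for x
    unfolding N_def complex_norm_square[symmetric] by simp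
  have N_pos: "0 < N x" for x
    unfolding N_real by (simp add: less_complex_def add_pos_nonneg)
  then have N0: "N x \<noteq> 0" for x by (metis less_irrefl)
  have wN: "wirtinger1 N (cnj x) x x" for x
    unfolding N_def
    by (rule wirtinger1_cong[OF wirtinger1_add[OF wirtinger1_const
      wirtinger1_mult[OF wirtinger1_id wirtinger1_cnj[OF wirtinger1_id]]]]) simp_all
  define D where "D = (\<lambda>x. h x - s * ln (1 + (cmod x)\<^sup>2))"
  define P where "P = (\<lambda>x. p x + (- of_real s) * (cnj x * inverse (N x)))"
  have lnN: "ln (N x) = of_real (ln (1 + (cmod x)\<^sup>2))" for x
    unfolding N_real by (rule Ln_of_real) (simp add: add_pos_nonneg)
  have "wirtinger1 (\<lambda>x. of_real (h x) + (- of_real s) * ln (N x)) (P x) (cnj (P x)) x" for x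
    unfolding P_def
    by (rule wirtinger1_cong[OF wirtinger1_add[OF h wirtinger1_mult[OF wirtinger1_const
      wirtinger1_compose[OF wirtinger1_ln[OF N_pos] wN]]]]) (simp_all add: N_def mult.commute)
  then have D: "wirtinger1 (\<lambda>x. of_real (D x)) (P x) (cnj (P x)) x" for x
    by (simp add: D_def lnN)
  have "wirtinger1 P (p' x + - of_real s * (cnj x * (- (inverse (N x) * inverse (N x)) * cnj x))) 0 x" for x
  proof -
    \<comment> \<open>The mixed derivative of \<open>ln (1 + |x|^2)\<close> is
      \<open>1 / N - |x|^2 / N^2 = 1 / N^2\<close>, which cancels the one assumed for
      \<open>h\<close>.\<close>
    have "inverse (N x) * inverse (N x) * N x = inverse (N x)" using N0[of x] by simp
    then have "inverse (N x) = inverse (N x) * inverse (N x) + cnj x * (inverse (N x) * inverse (N x) * x)"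
      by (simp add: N_def algebra_simps)
    then have z: "inverse (N x) + cnj x * (- (inverse (N x) * inverse (N x)) * x) = inverse (N x) * inverse (N x)"
      by (simp add: algebra_simps)
    show ?thesis
      unfolding P_def
      apply (rule wirtinger1_cong[OF wirtinger1_add[OF p wirtinger1_mult[OF wirtinger1_const
        wirtinger1_mult[OF wirtinger1_cnj[OF wirtinger1_id] wirtinger1_inverse[OF wN N0]]]]])
       apply simp
      using z by (simp add: N_def power2_eq_square)
  qed
  then have holP: "P holomorphic_on UNIV" by (rule wirtinger1_holomorphic(2))
  have "D x \<le> C" for x
  proof -
    have "ln (1 + (cmod x)\<^sup>2) \<ge> 0" by simp
    then have "s * ln (1 + (cmod x)\<^sup>2) \<ge> 0" using s by simp
    then show ?thesis using bound[of x] by (simp add: D_def)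
  qed
  from harmonic_Liouville[OF D holP this] have const: "D x = D 0" for x .
  \<comment> \<open>Chosen so that \<open>s * ln (1 + |x|^2) = 2 * C + 1\<close>, more than
    \<open>h\<close> can vary.\<close>
  define y where "y = exp ((2 * C + 1) / s)"
  have "C \<ge> 0" using bound[of 0] by linarith
  then have "y \<ge> 1" using s by (simp add: y_def)
  define x where "x = complex_of_real (sqrt (y - 1))"
  have "(cmod x)\<^sup>2 = y - 1" using \<open>y \<ge> 1\<close> by (simp add: x_def)
  then have "s * ln (1 + (cmod x)\<^sup>2) = 2 * C + 1" using s by (simp add: y_def)
  with const[of x] bound[of x] bound[of 0] show False by (simp add: D_def)
qed

lemma log_potential_zero:
  fixes h :: "complex \<Rightarrow> real"
  assumes h: "\<And>x. wirtinger1 (\<lambda>x. of_real (h x)) (p x) (cnj (p x)) x"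
    and p: "\<And>x. wirtinger1 p (p' x) (of_real s * inverse (1 + x * cnj x) ^ 2) x"
    and bound: "\<And>x. \<bar>h x\<bar> \<le> C"
  shows "s = 0"
proof (rule antisym)
  show "s \<le> 0" by (rule log_potential_nonpos[OF h p bound])
  have "- s \<le> 0"
  proof (rule log_potential_nonpos[of "\<lambda>x. - h x" "\<lambda>x. (- 1) * p x"])
    show "wirtinger1 (\<lambda>x. of_real (- h x)) ((- 1) * p x) (cnj ((- 1) * p x)) x" for x
      using wirtinger1_mult[OF wirtinger1_const h, of "- 1" x] by simp
    show "wirtinger1 (\<lambda>x. (- 1) * p x) (0 * p x + (- 1) * p' x) (of_real (- s) * inverse (1 + x * cnj x) ^ 2) x" for x
      by (rule wirtinger1_cong[OF wirtinger1_mult[OF wirtinger1_const p]]) simp_all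
  qed (use bound in auto)
  then show "0 \<le> s" by simp
qed

lemma matrix_inv_diagonal:
  fixes D :: "complex ^ 'n ^ 'n::finite"
  assumes "\<And>i l. i \<noteq> l \<Longrightarrow> D $ i $ l = 0" "\<And>i. D $ i $ i \<noteq> 0"
  shows "matrix_inv D $ p $ q = (if p = q then inverse (D $ p $ p) else 0)"
proof -
  define I :: "complex ^ 'n ^ 'n" where "I = (\<chi> p q. if p = q then inverse (D $ p $ p) else 0)"
  have "(\<Sum>q\<in>UNIV. D $ i $ q * I $ q $ l) = (\<Sum>q\<in>UNIV. if q = i then of_bool (i = l) else 0)"
    and "(\<Sum>q\<in>UNIV. I $ i $ q * D $ q $ l) = (\<Sum>q\<in>UNIV. if q = i then of_bool (i = l) else 0)" for i l
    by (rule sum.cong; use assms in \<open>auto simp: I_def\<close>)+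
  then have "D ** I = mat 1" "I ** D = mat 1"
    by (simp_all add: vec_eq_iff matrix_matrix_mult_def mat_def)
  then have "D ** matrix_inv D = mat 1"
    unfolding matrix_inv_def by (metis (mono_tags, lifting) someI_ex)
  then have "matrix_inv D = I"
    by (metis \<open>I ** D = mat 1\<close> matrix_mul_assoc matrix_mul_lid matrix_mul_rid)
  then show ?thesis by (simp add: I_def)
qed

subsection \<open>The soliton equation in a chart\<close>

locale soliton_chart = invariant_chart k g j a0 b
  for k :: nat and g :: "('n::finite) form_field" and j a0 :: 'n and b :: bool +
  fixes f :: "'n chart_point set \<Rightarrow> real"
  assumes f_smooth: "smooth_on_Mk k f"
    and soliton: "ricci g c u $ i $ l - g c u $ i $ l = hess_mixed (\<lambda>v. complex_of_real (f (point k c v))) u i l"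
    and gradient_holomorphic: "hess_hol g c (\<lambda>v. complex_of_real (f (point k c v))) u i l = 0"
begin

definition F :: "complex ^ 'n \<Rightarrow> complex" where "F u = complex_of_real (f (point k (j, b) u))"

lemma f_bounded_line: "\<exists>C. \<forall>x. cmod x \<le> 1 \<longrightarrow> \<bar>f (point k c (axis i x))\<bar> \<le> C"
proof -
  have "cont_diff 0 (\<lambda>u. f (point k c u))"
    using f_smooth unfolding smooth_on_Mk_def smooth_def by blast
  then have "continuous_on UNIV (\<lambda>u. f (point k c u))" by simp
  then have "continuous_on (cball 0 1 :: (complex ^ 'n) set) (\<lambda>u. f (point k c u))"
    by (rule continuous_on_subset) simp
  then have "compact ((\<lambda>u. f (point k c u)) ` (cball 0 1 :: (complex ^ 'n) set))"
    by (rule compact_continuous_image) simp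
  then obtain C where "\<And>u. u \<in> cball 0 1 \<Longrightarrow> \<bar>f (point k c u)\<bar> \<le> C"
    using compact_imp_bounded[of "(\<lambda>u. f (point k c u)) ` cball 0 1"] unfolding bounded_iff by fastforce
  moreover have "axis i x \<in> cball 0 (1::real)" if "cmod x \<le> 1" for x
    using that by (simp add: norm_axis)
  ultimately show ?thesis by blast
qed

text \<open>The line is covered by the unit discs of \<open>x\<close> and \<open>inverse x\<close>,
  on each of which \<open>f\<close> is continuous. Charts and axes are arbitrary, so this serves
  fibres as well as lines in the sections.\<close>

lemma f_bounded:
  assumes "\<And>x. x \<noteq> 0 \<Longrightarrow> point k c (axis i x) = point k d (axis l (inverse x))"
  obtains C where "\<And>x. \<bar>f (point k c (axis i x))\<bar> \<le> C"
proof -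
  obtain C D where C: "\<And>x. cmod x \<le> 1 \<Longrightarrow> \<bar>f (point k c (axis i x))\<bar> \<le> C"
    and D: "\<And>x. cmod x \<le> 1 \<Longrightarrow> \<bar>f (point k d (axis l x))\<bar> \<le> D"
    using f_bounded_line by blast
  have "\<bar>f (point k c (axis i x))\<bar> \<le> max C D" for x
  proof (cases "cmod x \<le> 1")
    case True
    then show ?thesis using C[of x] by simp
  next
    case False
    then have "x \<noteq> 0" "cmod (inverse x) \<le> 1" by (auto simp: norm_inverse inverse_le_1_iff)
    then show ?thesis using D[of "inverse x"] assms[of x] by simp
  qed
  then show ?thesis by (rule that)
qed

lemma F_twice_differentiable: "twice_differentiable F"
  unfolding F_def[abs_def]
  using f_smooth smooth_twice_differentiable[of "\<lambda>u. f (point k (j, b) u)" complex_of_real]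
  by (simp add: smooth_on_Mk_def bounded_linear_of_real)

lemma wirtinger1_F_axis:
  "wirtinger1 (\<lambda>x. F (axis i x)) (d_hol i F (axis i x)) (cnj (d_hol i F (axis i x))) x"
proof -
  have "F differentiable (at (axis i x))"
    using F_twice_differentiable unfolding twice_differentiable_def by blast
  from wirtinger1_axis[OF this] have w: "wirtinger1 (\<lambda>x. F (axis i x)) (d_hol i F (axis i x)) (d_bar i F (axis i x)) x" .
  moreover have "d_bar i F (axis i x) = cnj (d_hol i F (axis i x))"
    by (rule wirtinger1_real[OF w]) (simp add: F_def)
  ultimately show ?thesis by simp
qed

lemma wirtinger1_dF_axis:
  "wirtinger1 (\<lambda>x. d_hol i F (axis i x)) (d_hol i (d_hol i F) (axis i x))
     (ricci g (j, b) (axis i x) $ i $ i - G (axis i x) $ i $ i) x"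
proof -
  have "d_hol i F differentiable (at (axis i x))"
    using F_twice_differentiable unfolding twice_differentiable_def by blast
  from wirtinger1_axis[OF this] show ?thesis
    using soliton[of "(j, b)" "axis i x" i i] by (simp add: hess_mixed_def F_def[abs_def])
qed

lemma axis_simps:
  "Nsq (axis j x) = 1" "E (axis j x) = 1" "xi (axis j x) = x" "Q (axis j x) i = 0"
proof -
  have "nsq (axis j x) = 1" by (simp add: nsq_def axis_def)
  then show "Nsq (axis j x) = 1" and E: "E (axis j x) = 1"
    by (simp_all add: Nsq_of_real E_of_real)
  show "xi (axis j x) = x" using E by (simp add: xi_def axis_def)
  show "Q (axis j x) i = 0" by (simp add: Q_def axis_def)
qed

definition dF :: "complex \<Rightarrow> complex" where "dF x = d_hol j F (axis j x)"

lemma wirtinger1_F: "wirtinger1 (\<lambda>x. F (axis j x)) (dF x) (cnj (dF x)) x"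
  unfolding dF_def by (rule wirtinger1_F_axis)

text \<open>The off-diagonal entries of \<open>g\<close> vanish along the whole fibre, hence so do
  their vertical derivatives.\<close>

lemma christoffel_axis:
  "christoffel g (j, b) (axis j x) p j j = (if p = j then dz beta x / beta x else 0)"
proof -
  have off: "d_hol j (\<lambda>v. G v $ j $ q) (axis j x) = 0" if "q \<noteq> j" for q
  proof -
    have "(\<lambda>u. G u $ j $ q) differentiable (at (axis j x))"
      using G_twice_differentiable unfolding twice_differentiable_def by blast
    from wirtinger1_axis[OF this] have "wirtinger1 (\<lambda>_. 0) (d_hol j (\<lambda>v. G v $ j $ q) (axis j x))
        (d_bar j (\<lambda>v. G v $ j $ q) (axis j x)) x"
      using that by (simp add: G_axis_offdiag)
    from wirtinger1_unique(1)[OF this wirtinger1_const] show ?thesis .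
  qed
  have inv: "matrix_inv (transpose (G (axis j x))) $ p $ q =
      (if p = q then inverse (G (axis j x) $ p $ p) else 0)" for p q
    by (subst matrix_inv_diagonal) (auto simp: transpose_def G_axis_offdiag, metis G_diag_pos less_irrefl)
  have "christoffel g (j, b) (axis j x) p j j =
      (\<Sum>q\<in>UNIV. if q = p then (if p = j then dz beta x / beta x else 0) else 0)"
    unfolding christoffel_def
    by (intro sum.cong refl) (auto simp: inv off dz_beta beta_def divide_inverse)
  then show ?thesis by simp
qed

text \<open>The holomorphic derivative comes from the vanishing of the \<open>(2,0)\<close> Hessian,
  the conjugate one from the soliton equation with vertical Ricci component
  \<open>- S x\<close>.\<close>

lemma wirtinger1_dF: "wirtinger1 dF (dz beta x / beta x * dF x) (- S x - beta x) x"
proof -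
  have "hess_hol g (j, b) F (axis j x) j j = 0"
    using gradient_holomorphic unfolding F_def[abs_def] by blast
  moreover have "(\<Sum>p\<in>UNIV. christoffel g (j, b) (axis j x) p j j * d_hol p F (axis j x)) =
      (\<Sum>p\<in>UNIV. if p = j then dz beta x / beta x * dF x else 0)"
    by (intro sum.cong refl) (auto simp: christoffel_axis dF_def)
  ultimately have "d_hol j (d_hol j F) (axis j x) = dz beta x / beta x * dF x"
    unfolding hess_hol_def by simp
  moreover have "ricci g (j, b) (axis j x) $ j $ j = - S x"
    by (simp add: ricci_formula axis_simps FS_def)
  ultimately show ?thesis
    using wirtinger1_dF_axis[of j x] by (simp add: dF_def[abs_def] beta_def)
qed

text \<open>The mixed second derivative of \<open>f\<close> on the fibre is
  \<open>- S - beta\<close>, already known to be radial, so it drops out of the difference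
  \<open>D\<close>. As \<open>D 0 = 0\<close>, constancy of \<open>D\<close> is the claim.\<close>

lemma radial_F: "radial (\<lambda>x. F (axis j x))"
  unfolding radial_def
proof (intro allI impI)
  fix t x :: complex assume t: "norm t = 1"
  have tt: "cnj t * t = 1" using t by (metis complex_norm_square mult.commute of_real_1 power_one)
  obtain C where C: "\<And>x. \<bar>f (point k (j, b) (axis j x))\<bar> \<le> C"
    using f_bounded[OF point_fibre_flip[of _ k j b]] by blast
  define D where "D = (\<lambda>x. f (point k (j, b) (axis j (t * x))) + (- 1) * f (point k (j, b) (axis j x)))"
  define p where "p = (\<lambda>x. dF (t * x) * t + (- 1) * dF x)"
  have D: "wirtinger1 (\<lambda>x. of_real (D x)) (p x) (cnj (p x)) x" for x
  proof -
    have "wirtinger1 (\<lambda>x. F (axis j (t * x)) + (- 1) * F (axis j x)) (p x) (cnj (p x)) x"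
      unfolding p_def
      by (rule wirtinger1_cong[OF wirtinger1_add[OF wirtinger1_rotate[OF wirtinger1_F]
        wirtinger1_mult[OF wirtinger1_const wirtinger1_F]]]) simp_all
    then show ?thesis by (simp add: D_def F_def)
  qed
  have "\<exists>p'. wirtinger1 p p' 0 x" for x
  proof -
    have "S (t * x) = S x" "beta (t * x) = beta x"
      using radialD[OF radial_S t] radialD[OF radial_beta t] by auto
    then have "(- S (t * x) - beta (t * x)) * cnj t * t + (- 1) * (- S x - beta x) = 0"
      using tt by (simp add: mult.assoc)
    then show ?thesis
      unfolding p_def
      by (intro exI) (rule wirtinger1_cong[OF wirtinger1_add[OF wirtinger1_mult[OF
        wirtinger1_rotate[OF wirtinger1_dF] wirtinger1_const]
        wirtinger1_mult[OF wirtinger1_const wirtinger1_dF]] refl], simp)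
  qed
  then obtain p' where "\<And>x. wirtinger1 p (p' x) 0 x" by metis
  then have "p holomorphic_on UNIV" by (rule wirtinger1_holomorphic(2))
  moreover have "D x \<le> C + C" for x
    using C[of "t * x"] C[of x] by (simp add: D_def)
  ultimately have "D x = D 0" by (rule harmonic_Liouville[OF D])
  then show "F (axis j (t * x)) = F (axis j x)" by (simp add: D_def F_def)
qed

text \<open>Up to the factor \<open>beta\<close>, the conjugate of \<open>dF\<close> is the gradient vector field of \<open>f\<close> on the fibre, which is
  holomorphic and commutes with rotations.\<close>

lemma gradient_linear: "\<exists>c::real. \<forall>x. dF x = c * cnj x * beta x"
proof -
  define v where "v = (\<lambda>x. cnj (dF x) * inverse (beta x))"
  have "\<exists>v'. wirtinger1 v v' 0 x" for x
    unfolding v_def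
    by (intro exI) (rule wirtinger1_cong[OF wirtinger1_mult[OF wirtinger1_cnj[OF wirtinger1_dF]
      wirtinger1_inverse[OF wirtinger1_beta beta_nonzero]] refl],
      simp add: dzbar_beta_cnj beta_nonzero field_simps)
  then obtain v' where "\<And>x. wirtinger1 v (v' x) 0 x" by metis
  then have v': "(v has_field_derivative v' x) (at x)" for x by (rule wirtinger1_holomorphic(1))
  have "v (t * x) = t * v x" if t: "norm t = 1" for t x
    using radial_wirtinger1_equivariant(2)[OF radial_F wirtinger1_F t, of x] radialD[OF radial_beta t]
    by (simp add: v_def)
  from holomorphic_equivariant_linear[OF v' this] obtain c where c: "\<And>x. v x = c * x" by blast
  have "cnj (dF x) = c * x * beta x" for x
    using c[of x] beta_nonzero[of x] by (simp add: v_def field_simps)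
  then have dF: "dF x = cnj c * cnj x * beta x" for x
    by (metis cnj_beta complex_cnj_cnj complex_cnj_mult)
  \<comment> \<open>The Euler relation at \<open>x = 1\<close> says that \<open>dF 1\<close> is
    real, which makes \<open>c\<close> real.\<close>
  have "1 * dF 1 = cnj 1 * cnj (dF 1)"
    by (rule radial_wirtinger1[OF radial_F wirtinger1_F])
  then have "cnj c = c" using beta_nonzero[of 1] by (simp add: dF)
  then have "cnj c = of_real (Re c)" by (metis Reals_cnj_iff of_real_Re)
  with dF show ?thesis by metis
qed

text \<open>The first equation compares two expressions for the conjugate derivative of
  \<open>dF\<close>. The second is its integral: both derivatives of the left side are multiples of
  the first equation, and the constant is read off at \<open>x = 0\<close>, where \<open>M\<close>
  vanishes.\<close>

lemma fibre_equations:
  obtains c :: real where "\<And>x. - S x = beta x + c * (beta x + cnj x * dzbar beta x)"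
    and "\<And>x. M x + alpha x / kap + c * (x * cnj x * beta x) = alpha 0 / kap"
proof -
  obtain c :: real where c: "\<And>x. dF x = c * cnj x * beta x" using gradient_linear by blast
  have "wirtinger1 (\<lambda>x. c * cnj x * beta x) (c * (cnj x * dz beta x)) (c * (beta x + cnj x * dzbar beta x)) x" for x
    by (rule wirtinger1_cong[OF wirtinger1_mult[OF wirtinger1_mult[OF wirtinger1_const
      wirtinger1_cnj[OF wirtinger1_id]] wirtinger1_beta]]) (simp_all add: algebra_simps)
  then have "wirtinger1 dF (c * (cnj x * dz beta x)) (c * (beta x + cnj x * dzbar beta x)) x" for x
    by (simp add: c[symmetric])
  from wirtinger1_unique(2)[OF wirtinger1_dF this]
  have eq: "- S x - beta x = c * (beta x + cnj x * dzbar beta x)" for x .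
  then have 1: "- S x = beta x + c * (beta x + cnj x * dzbar beta x)" for x by (simp add: algebra_simps)
  have "wirtinger1 (\<lambda>x. M x + inverse kap * alpha x + c * (x * cnj x * beta x)) 0 0 x" for x
  proof -
    have bar: "S x + beta x + c * (beta x + cnj x * dzbar beta x) = 0"
      using arg_cong[OF 1[of x], of "\<lambda>y. y + S x"] by (simp add: add.assoc add.commute add.left_commute)
    then have hol: "S x + beta x + c * (beta x + x * dz beta x) = 0" by (simp only: beta_euler)
    have cancel: "inverse (complex_of_real kap) * (kap * y) = y" for y
      using kap_nonzero by simp
    have "cnj x * S x + (0 * alpha x + inverse (complex_of_real kap) * (kap * beta x * cnj x)) +
        (0 * (x * cnj x * beta x) + c * ((1 * cnj x + x * cnj 0) * beta x + x * cnj x * dz beta x)) =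
        cnj x * (S x + beta x + c * (beta x + x * dz beta x))"
      using kap_nonzero by (simp add: cancel mult.assoc) (simp add: algebra_simps)
    moreover have "x * S x + (0 * alpha x + inverse (complex_of_real kap) * (kap * beta x * x)) +
        (0 * (x * cnj x * beta x) + c * ((0 * cnj x + x * cnj 1) * beta x + x * cnj x * dzbar beta x)) =
        x * (S x + beta x + c * (beta x + cnj x * dzbar beta x))"
      using kap_nonzero by (simp add: cancel mult.assoc) (simp add: algebra_simps)
    ultimately show ?thesis
      unfolding bar hol mult_zero_right
      by (intro wirtinger1_cong[OF wirtinger1_add[OF wirtinger1_add[OF wirtinger1_M
          wirtinger1_mult[OF wirtinger1_const wirtinger1_alpha]]
          wirtinger1_mult[OF wirtinger1_const wirtinger1_mult[OF wirtinger1_mult[OF wirtinger1_id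
          wirtinger1_cnj[OF wirtinger1_id]] wirtinger1_beta]]]]) auto
  qed
  from wirtinger1_eq_0_constant[OF this, of _ 0]
  have "M x + alpha x / kap + c * (x * cnj x * beta x) = alpha 0 / kap" for x
    by (simp add: M_def divide_inverse mult.commute)
  with 1 show ?thesis by (rule that)
qed

text \<open>On a projective line in the section \<open>y\<^sub>j = 0\<close> the soliton equation reads
  \<open>\<partial>\<partial>-bar f = (n - kap - alpha 0) \<partial>\<partial>-bar ln (1 + |x|\<^sup>2)\<close> with \<open>f\<close> bounded.\<close>

lemma alpha_zero: "alpha 0 = of_nat CARD('n) - kap"
proof -
  define s where "s = CARD('n) - kap - Re (alpha 0)"
  obtain C where C: "\<And>x. \<bar>f (point k (j, b) (axis a0 x))\<bar> \<le> C"
    using f_bounded[OF point_section_flip[OF _ a0, of _ k b]] by blast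
  have "s = 0"
  proof (rule log_potential_zero[OF _ _ C])
    show "wirtinger1 (\<lambda>x. of_real (f (point k (j, b) (axis a0 x)))) (d_hol a0 F (axis a0 x))
        (cnj (d_hol a0 F (axis a0 x))) x" for x
      using wirtinger1_F_axis[of a0 x] by (simp add: F_def)
    fix x :: complex
    have j0: "axis a0 x $ j = 0" using a0 by (simp add: axis_def)
    have N: "Nsq (axis a0 x) = 1 + x * cnj x"
    proof -
      have "(\<Sum>l\<in>- {j}. axis a0 x $ l * cnj (axis a0 x $ l)) = (\<Sum>l\<in>- {j}. if l = a0 then x * cnj x else 0)"
        by (rule sum.cong) (auto simp: axis_def)
      then show ?thesis using a0 by (simp add: Nsq_def)
    qed
    have N0: "1 + x * cnj x \<noteq> 0" using Nsq_nonzero[of "axis a0 x"] by (simp add: N)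
    have "inverse n - (n - 1) * inverse n ^ 2 = inverse n ^ 2" if "n \<noteq> 0" for n :: complex
      using that by (simp add: field_simps power2_eq_square)
    from this[OF N0]
    have FS: "inverse (1 + x * cnj x) - cnj x * x * inverse (1 + x * cnj x) ^ 2 = inverse (1 + x * cnj x) ^ 2"
      by (simp add: mult.commute)
    have "ricci g (j, b) (axis a0 x) $ a0 $ a0 = inverse (1 + x * cnj x) ^ 2 * (of_nat CARD('n) - kap)"
      using a0 FS by (simp add: ricci_formula xi_def j0 M_def FS_def Q_def N power2_eq_square mult.assoc mult.commute mult.left_commute)
    moreover have "G (axis a0 x) $ a0 $ a0 = inverse (1 + x * cnj x) ^ 2 * alpha 0"
    proof -
      have "G (axis a0 x) $ a0 $ a0 =
          alpha 0 * (inverse (1 + x * cnj x) - cnj x * x * inverse (1 + x * cnj x) ^ 2)"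
        unfolding G_zero_section[OF a0 j0] N by (simp add: divide_inverse power2_eq_square algebra_simps)
      then show ?thesis unfolding FS by simp
    qed
    ultimately have "ricci g (j, b) (axis a0 x) $ a0 $ a0 - G (axis a0 x) $ a0 $ a0 =
        of_real s * inverse (1 + x * cnj x) ^ 2"
      using alpha_real[of 0] by (simp add: s_def algebra_simps)
    with wirtinger1_dF_axis[of a0 x]
    show "wirtinger1 (\<lambda>x. d_hol a0 F (axis a0 x)) (d_hol a0 (d_hol a0 F) (axis a0 x))
        (of_real s * inverse (1 + x * cnj x) ^ 2) x" by simp
  qed
  then have "Re (alpha 0) = CARD('n) - kap" by (simp add: s_def)
  then show ?thesis using alpha_real[of 0] by simp
qed

end

subsection \<open>The ordinary differential equation\<close>

text \<open>The bound is the Pade approximant of order (1,1), which agrees with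
  \<open>ln (1 + y)\<close> to second order at \<open>0\<close>.\<close>

lemma ln_add1_lower_strict:
  fixes y :: real
  assumes "y > 0" shows "2 * y / (2 + y) < ln (1 + y)"
proof -
  define d where "d = (\<lambda>y::real. ln (1 + y) - 2 * y / (2 + y))"
  have "\<exists>z. (d has_real_derivative z) (at x) \<and> z > 0" if "0 < x" "x < y" for x
  proof (intro exI conjI)
    have "(d has_real_derivative 1 / (1 + x) - (2 * (2 + x) - 2 * x) / ((2 + x) * (2 + x))) (at x)"
      unfolding d_def using that by (auto intro!: derivative_eq_intros)
    moreover have "1 / (1 + x) - (2 * (2 + x) - 2 * x) / ((2 + x) * (2 + x)) = x\<^sup>2 / ((1 + x) * (2 + x)\<^sup>2)"
      using that by (simp add: divide_simps) (simp add: power2_eq_square algebra_simps)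
    ultimately show "(d has_real_derivative x\<^sup>2 / ((1 + x) * (2 + x)\<^sup>2)) (at x)" by simp
    show "x\<^sup>2 / ((1 + x) * (2 + x)\<^sup>2) > 0" using that by simp
  qed
  moreover have "continuous_on {0..y} d"
    unfolding d_def by (intro continuous_intros) auto
  ultimately have "d 0 < d y" by (rule DERIV_pos_imp_increasing_open[OF assms])
  then show ?thesis by (simp add: d_def)
qed

lemma mono_limits_at_bot_top:
  fixes W :: "real \<Rightarrow> real"
  assumes "mono W" "(W \<longlongrightarrow> L) at_bot" "(W \<longlongrightarrow> L') at_top"
  shows "L \<le> W t" "W t \<le> L'"
proof -
  have "eventually (\<lambda>s. W s \<le> W t) at_bot"
    using eventually_le_at_bot[of t] by eventually_elim (use assms(1) in \<open>auto dest: monoD\<close>)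
  then show "L \<le> W t" by (rule tendsto_upperbound[OF assms(2)]) simp
  have "eventually (\<lambda>s. W t \<le> W s) at_top"
    using eventually_ge_at_top[of t] by eventually_elim (use assms(1) in \<open>auto dest: monoD\<close>)
  then show "W t \<le> L'" by (rule tendsto_lowerbound[OF assms(3)]) simp
qed

lemma DERIV_nonneg_mono:
  fixes W :: "real \<Rightarrow> real"
  assumes "\<And>t. (W has_real_derivative W' t) (at t)" "\<And>t. 0 \<le> W' t"
  shows "mono W"
  using assms by (intro monoI DERIV_nonneg_imp_nondecreasing[where f = W]) blast+

text \<open>On \<open>C\<^sup>n - {0}\<close> the metric has a potential depending on \<open>t = ln |z|\<^sup>2\<close> only; \<open>A\<close> is its derivative
  and \<open>P\<close> its second derivative. With \<open>P\<close> regarded as a function of \<open>A\<close>, the function \<open>q\<close> is \<open>dP / dA\<close>.\<close>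

locale soliton_profile =
  fixes n k c :: real and A P q :: "real \<Rightarrow> real"
  assumes k_ge: "1 \<le> k" and k_le: "k \<le> n - 1"
    and q: "\<And>t. q t = n - A t - (n - 1) * P t / A t - c * P t"
    and dA: "\<And>t. (A has_real_derivative P t) (at t)"
    and dP: "\<And>t. (P has_real_derivative P t * q t) (at t)"
    and P_pos: "\<And>t. 0 < P t"
    and A_bot: "(A \<longlongrightarrow> n - k) at_bot" and P_bot: "(P \<longlongrightarrow> 0) at_bot"
    and A_top: "(A \<longlongrightarrow> n + k) at_top" and P_top: "(P \<longlongrightarrow> 0) at_top"
begin

lemma A_less: "s < t \<Longrightarrow> A s < A t"
  using dA P_pos by (intro DERIV_pos_imp_increasing[of s t A]) blast+

lemma A_bounds: "n - k < A t" "A t < n + k"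
proof -
  have m: "mono A" using A_less by (intro monoI) (metis order_le_less)
  have "n - k \<le> A (t - 1)" by (rule mono_limits_at_bot_top(1)[OF m A_bot A_top])
  also have "A (t - 1) < A t" by (rule A_less) simp
  finally show "n - k < A t" .
  have "A t < A (t + 1)" by (rule A_less) simp
  also have "A (t + 1) \<le> n + k" by (rule mono_limits_at_bot_top(2)[OF m A_bot A_top])
  finally show "A t < n + k" .
qed

lemma A_pos: "0 < A t"
  using A_bounds(1)[of t] k_le by simp

text \<open>The integrating factor \<open>x^(n - 1) * exp (c * x)\<close> of the linear equation for
  \<open>P\<close> as a function of \<open>A\<close>, written with \<open>ln\<close> because
  \<open>n\<close> is a real number here.\<close>

definition w :: "real \<Rightarrow> real" where "w x = exp ((n - 1) * ln x + c * x)"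

definition H :: "real \<Rightarrow> real" where "H t = w (A t) * P t"

lemma dH: "(H has_real_derivative w (A t) * P t * (n - A t)) (at t)"
proof -
  have "(H has_real_derivative
      w (A t) * ((n - 1) * (P t / A t) + c * P t) * P t + w (A t) * (P t * q t)) (at t)"
    unfolding H_def w_def using A_pos[of t]
    by (auto intro!: derivative_eq_intros dA dP simp: field_simps)
  then show ?thesis
    by (rule DERIV_cong) (simp add: q algebra_simps)
qed

lemma w_tendsto: "(A \<longlongrightarrow> x) F \<Longrightarrow> 0 < x \<Longrightarrow> ((\<lambda>t. w (A t)) \<longlongrightarrow> w x) F"
  unfolding w_def by (intro tendsto_intros) auto

lemma H_bot: "(H \<longlongrightarrow> 0) at_bot" and H_top: "(H \<longlongrightarrow> 0) at_top"
  unfolding H_def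
  using tendsto_mult[OF w_tendsto[OF A_bot] P_bot] tendsto_mult[OF w_tendsto[OF A_top] P_top] k_ge k_le
  by auto

text \<open>Since \<open>H\<close> vanishes at both ends, \<open>(n - x) w(x)\<close> has integral \<open>0\<close> over \<open>[n - k, n + k]\<close>; the
  weight can thus not favour one side of \<open>n\<close>.\<close>

lemma weight_not_one_sided:
  assumes sign: "\<And>x. n - k < x \<Longrightarrow> x < n + k \<Longrightarrow> x \<noteq> n \<Longrightarrow> (n - x) * (w x - w n) < 0"
  shows False
proof -
  \<comment> \<open>In the variable \<open>x = A t\<close> this is a primitive of
    \<open>- (n - x) * (w x - w n)\<close>. The quadratic term is the same at \<open>n - k\<close>
    and \<open>n + k\<close>, so \<open>W\<close> has equal limits at both ends.\<close>
  define W where "W = (\<lambda>t. - H t - w n * (n - A t)\<^sup>2 / 2)"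
  define W' where "W' = (\<lambda>t. - ((n - A t) * (w (A t) - w n) * P t))"
  have dW: "(W has_real_derivative W' t) (at t)" for t
    unfolding W_def W'_def
    by (auto intro!: derivative_eq_intros dH dA simp: field_simps power2_eq_square)
  have "0 \<le> W' t" for t
  proof (cases "A t = n")
    case False
    with sign[OF A_bounds[of t]] P_pos[of t] show ?thesis
      unfolding W'_def by (simp add: mult_neg_pos less_imp_le)
  qed (simp add: W'_def)
  then have m: "mono W" using dW by (rule DERIV_nonneg_mono[rotated])
  have "(W \<longlongrightarrow> - 0 - w n * (n - (n - k))\<^sup>2 / 2) at_bot" "(W \<longlongrightarrow> - 0 - w n * (n - (n + k))\<^sup>2 / 2) at_top"
    unfolding W_def by (intro tendsto_intros H_bot H_top A_bot A_top; simp)+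
  then have lim: "(W \<longlongrightarrow> - w n * k\<^sup>2 / 2) at_bot" "(W \<longlongrightarrow> - w n * k\<^sup>2 / 2) at_top" by simp_all
  have "W t = - w n * k\<^sup>2 / 2" for t
    using mono_limits_at_bot_top[OF m lim, of t] by simp
  then have "W = (\<lambda>_. - w n * k\<^sup>2 / 2)" by auto
  then have W0: "W' t = 0" for t
    using dW[of t] DERIV_const DERIV_unique by metis
  obtain t where t: "A t \<noteq> n" using A_less[of 0 1] by (metis less_irrefl zero_less_one)
  from sign[OF A_bounds[of t] t] P_pos[of t] have "W' t > 0"
    unfolding W'_def by (simp add: mult_neg_pos)
  with W0[of t] show False by simp
qed

text \<open>Taking exponentials, the assumptions read
  \<open>w (n - s) < w n < w (n + s)\<close>.\<close>

lemma weight_sign: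
  assumes gt: "\<And>s. 0 < s \<Longrightarrow> s < k \<Longrightarrow> 0 < (n - 1) * ln (1 + s / n) + c * s"
    and lt: "\<And>s. 0 < s \<Longrightarrow> s < k \<Longrightarrow> (n - 1) * ln (1 - s / n) - c * s < 0"
  shows False
proof (rule weight_not_one_sided)
  fix x assume x: "n - k < x" "x < n + k" "x \<noteq> n"
  have n: "n > 0" "x > 0" using x k_ge k_le by auto
  have ln: "(n - 1) * ln x + c * x = (n - 1) * ln n + c * n + ((n - 1) * ln (x / n) + c * (x - n))"
    using n by (simp add: ln_div algebra_simps)
  show "(n - x) * (w x - w n) < 0"
  proof (cases "x > n")
    case True
    then have "1 + (x - n) / n = x / n" using n by (simp add: field_simps)
    with gt[of "x - n"] True x have "0 < (n - 1) * ln (x / n) + c * (x - n)" by simp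
    then have "w n < w x" unfolding w_def ln by simp
    with True show ?thesis by (simp add: mult_neg_pos)
  next
    case False
    then have "1 - (n - x) / n = x / n" using n by (simp add: field_simps)
    with lt[of "n - x"] False x have "(n - 1) * ln (x / n) + c * (x - n) < 0" by (simp add: algebra_simps)
    then have "w x < w n" unfolding w_def ln by simp
    with False x show ?thesis by (simp add: mult_pos_neg)
  qed
qed

lemma c_neg: "c < 0"
proof (rule ccontr)
  assume "\<not> c < 0"
  then have c: "c \<ge> 0" by simp
  have n: "n > 1" using k_ge k_le by simp
  show False
  proof (rule weight_sign)
    fix s assume s: "0 < s" "s < k"
    have "0 < ln (1 + s / n)" using n s by (intro ln_gt_zero) simp
    then have "0 < (n - 1) * ln (1 + s / n)" using n by (intro mult_pos_pos) auto
    then show "0 < (n - 1) * ln (1 + s / n) + c * s" using c s by (simp add: add_pos_nonneg)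
    have "s < n" using s k_le by simp
    then have "ln (1 - s / n) < 0" using s n by (subst ln_less_zero_iff) (auto simp: field_simps)
    then have "(n - 1) * ln (1 - s / n) < 0" using n by (simp add: mult_pos_neg)
    moreover have "0 \<le> c * s" using c s by simp
    ultimately show "(n - 1) * ln (1 - s / n) - c * s < 0" by linarith
  qed
qed

lemma c_upper:
  assumes "k \<ge> 2" shows "1 + k * c \<le> 0"
proof (rule ccontr)
  assume "\<not> 1 + k * c \<le> 0"
  then have kc: "1 + k * c > 0" by simp
  have n: "n \<ge> 3" using assms k_le by simp
  have c: "c > - 1 / k" using kc assms by (simp add: field_simps)
  show False
  proof (rule weight_sign)
    fix s assume s: "0 < s" "s < k"
    \<comment> \<open>\<open>2 * k * (n - 1) - (2 * n + k)\<close> equals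
      \<open>(k - 2) * (2 * n - 3) + (2 * n - 6)\<close>, and both terms are nonnegative for
      \<open>k \<ge> 2\<close>, \<open>n \<ge> 3\<close>.\<close>
    have "0 \<le> (k - 2) * (2 * n - 3)" using assms n by (intro mult_nonneg_nonneg) auto
    then have "2 * n + k \<le> 2 * k * (n - 1)" using n by (simp add: algebra_simps)
    then have "1 / k \<le> 2 * (n - 1) / (2 * n + k)" using assms n by (simp add: field_simps)
    also have "\<dots> \<le> 2 * (n - 1) / (2 * n + s)" using s n by (intro divide_left_mono) auto
    finally have "- c \<le> 2 * (n - 1) / (2 * n + s)" using c by (simp add: field_simps)
    then have "- c * s \<le> 2 * (n - 1) / (2 * n + s) * s" using s by (intro mult_right_mono) auto
    also have "\<dots> = (n - 1) * (2 * (s / n) / (2 + s / n))" using n s by (simp add: field_simps)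
    also have "\<dots> < (n - 1) * ln (1 + s / n)"
      using ln_add1_lower_strict[of "s / n"] n s by (intro mult_strict_left_mono) auto
    finally show "0 < (n - 1) * ln (1 + s / n) + c * s" by simp
    have "s < n" using s k_le by simp
    then have "ln (1 - s / n) \<le> - (s / n)" using ln_le_minus_one[of "1 - s / n"] n by (simp add: field_simps)
    then have *: "(n - 1) * ln (1 - s / n) \<le> (n - 1) * (- (s / n))" using n by (intro mult_left_mono) auto
    have "- c < 1 / k" using c by simp
    moreover have "1 / k \<le> 1 / 2" using assms by (simp add: field_simps)
    moreover have "1 / 2 \<le> (n - 1) / n" using n by (simp add: field_simps)
    ultimately have "- c < (n - 1) / n" by linarith
    then have "- c * s < (n - 1) / n * s" using s by (intro mult_strict_right_mono) auto
    then show "(n - 1) * ln (1 - s / n) - c * s < 0" using * by simp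
  qed
qed

text \<open>\<open>x\<^sup>n exp (- x)\<close> is a primitive of \<open>(n - x) x\<^sup>n\<^sup>-\<^sup>1 exp (- x)\<close>, the integrand for \<open>c = - 1\<close>, and takes a
  larger value at \<open>n + 1\<close> than at \<open>n - 1\<close>.\<close>

lemma c_lower:
  assumes k: "k = 1" shows "c > - 1"
proof (rule ccontr)
  assume "\<not> c > - 1"
  then have c: "c + 1 \<le> 0" by simp
  have n: "n \<ge> 2" using k k_le by simp
  define v where "v = (\<lambda>x. exp (n * ln x - x))"
  \<comment> \<open>Makes the comparison weight \<open>e * x^(n - 1) * exp (- x)\<close> agree with
    \<open>w\<close> at \<open>x = n\<close>, so that the difference never has the sign opposite to
    \<open>n - x\<close>.\<close>
  define e where "e = exp ((c + 1) * n)"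
  define W where "W = (\<lambda>t. H t - e * v (A t))"
  define W' where "W' = (\<lambda>t. (n - A t) * P t * (w (A t) - e * exp ((n - 1) * ln (A t) - A t)))"
  have dW: "(W has_real_derivative W' t) (at t)" for t
  proof -
    have "v (A t) = exp (ln (A t) + ((n - 1) * ln (A t) - A t))"
      by (simp add: v_def algebra_simps)
    also have "\<dots> = A t * exp ((n - 1) * ln (A t) - A t)"
      using A_pos[of t] by (subst exp_add) simp
    finally have "v (A t) = A t * exp ((n - 1) * ln (A t) - A t)" .
    then have v': "exp (n * ln (A t) - A t) * (n / A t - 1) = (n - A t) * exp ((n - 1) * ln (A t) - A t)"
      using A_pos[of t] by (simp add: v_def field_simps)
    have "(W has_real_derivative w (A t) * P t * (n - A t) - e * (exp (n * ln (A t) - A t) * (n / A t - 1) * P t)) (at t)"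
      unfolding W_def v_def using A_pos[of t]
      by (auto intro!: derivative_eq_intros dH dA simp: field_simps)
    then show ?thesis unfolding v' by (rule DERIV_cong) (simp add: W'_def algebra_simps)
  qed
  have "0 \<le> W' t" for t
  proof -
    have w: "w (A t) - e * exp ((n - 1) * ln (A t) - A t) =
        (exp ((c + 1) * A t) - exp ((c + 1) * n)) * exp ((n - 1) * ln (A t) - A t)"
      by (simp add: w_def e_def left_diff_distrib exp_add[symmetric] algebra_simps)
    have "0 \<le> (n - A t) * (exp ((c + 1) * A t) - exp ((c + 1) * n))"
    proof (cases "A t \<le> n")
      case True
      then have "(c + 1) * n \<le> (c + 1) * A t" using c by (intro mult_left_mono_neg) auto
      with True show ?thesis by (intro mult_nonneg_nonneg) auto
    next
      case False
      then have "(c + 1) * A t \<le> (c + 1) * n" using c by (intro mult_left_mono_neg) auto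
      with False show ?thesis by (intro mult_nonpos_nonpos) auto
    qed
    moreover have "0 \<le> P t * exp ((n - 1) * ln (A t) - A t)"
      using P_pos[of t] by simp
    ultimately have "0 \<le> ((n - A t) * (exp ((c + 1) * A t) - exp ((c + 1) * n))) *
        (P t * exp ((n - 1) * ln (A t) - A t))"
      by (rule mult_nonneg_nonneg)
    then show ?thesis unfolding W'_def w by (simp only: ac_simps)
  qed
  then have m: "mono W" using dW by (rule DERIV_nonneg_mono[rotated])
  have "(W \<longlongrightarrow> 0 - e * v (n - k)) at_bot" "(W \<longlongrightarrow> 0 - e * v (n + k)) at_top"
    unfolding W_def v_def using n k
    by (intro tendsto_intros H_bot H_top A_bot A_top; simp)+
  from mono_limits_at_bot_top[OF m this] have "e * v (n + k) \<le> e * v (n - k)"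
    by (smt (verit))
  then have "n * ln (n + 1) - (n + 1) \<le> n * ln (n - 1) - (n - 1)"
    by (simp add: v_def e_def k)
  then have "n * ln ((n + 1) / (n - 1)) \<le> 2" using n by (simp add: ln_div algebra_simps)
  moreover have "n * ln ((n + 1) / (n - 1)) > 2"
  proof -
    \<comment> \<open>For \<open>y = 2 / (n - 1)\<close> the rational lower bound of
      \<open>ln (1 + y)\<close> is exactly \<open>2 / n\<close>.\<close>
    have "1 + 2 / (n - 1) = (n + 1) / (n - 1)" using n by (simp add: field_simps)
    then have "2 * (2 / (n - 1)) / (2 + 2 / (n - 1)) < ln ((n + 1) / (n - 1))"
      using ln_add1_lower_strict[of "2 / (n - 1)"] n by simp
    moreover have "2 * (2 / (n - 1)) / (2 + 2 / (n - 1)) = 2 / n" using n by (simp add: field_simps)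
    ultimately have "2 / n < ln ((n + 1) / (n - 1))" by simp
    then show ?thesis
      using n pos_divide_less_eq[of n 2 "ln ((n + 1) / (n - 1))"] by (simp add: mult.commute)
  qed
  ultimately show False by simp
qed

lemma q_bot: "(q \<longlongrightarrow> k) at_bot"
proof -
  have "((\<lambda>t. n - A t - (n - 1) * P t / A t - c * P t) \<longlongrightarrow> n - (n - k) - (n - 1) * 0 / (n - k) - c * 0) at_bot"
    using k_ge k_le by (intro tendsto_intros A_bot P_bot) auto
  then show ?thesis by (simp add: q[abs_def])
qed

lemma dq: "(q has_real_derivative P t * (- 1 - c * q t - (n - 1) * (q t * A t - P t) / (A t)\<^sup>2)) (at t)"
proof -
  have "(q has_real_derivative 0 - P t - ((n - 1) * (P t * q t) * A t - (n - 1) * P t * P t) / (A t * A t)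
      - c * (P t * q t)) (at t)"
    unfolding q[abs_def] using A_pos[of t]
    by (intro DERIV_diff DERIV_const dA dP DERIV_divide DERIV_cmult dP[unfolded q]) simp
  then show ?thesis
    by (rule DERIV_cong) (simp add: power2_eq_square algebra_simps diff_divide_distrib add_divide_distrib)
qed

text \<open>At a first point with \<open>q = m = - 1 / c\<close> the function \<open>P - m A\<close> has been decreasing from a negative limit;
  but then \<open>q\<close> has negative derivative there.\<close>

lemma q_less:
  assumes kc: "0 < 1 + k * c" shows "0 < 1 + c * q t"
proof (rule ccontr)
  assume neg: "\<not> 0 < 1 + c * q t"
  define m where "m = - 1 / c"
  have c: "c < 0" by (rule c_neg)
  have m: "k < m" "m > 0" using kc c k_ge by (auto simp: m_def field_simps)
  have qm: "q s < m \<longleftrightarrow> 0 < 1 + c * q s" for s using c by (auto simp: m_def field_simps)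
  have "eventually (\<lambda>s. q s < m) at_bot" using q_bot m(1) by (rule order_tendstoD)
  then obtain T where T: "\<And>s. s \<le> T \<Longrightarrow> q s < m" unfolding eventually_at_bot_linorder by blast
  \<comment> \<open>\<open>m \<le> q s\<close> is a closed condition that fails up to
    \<open>T\<close>, so there is a first time at which \<open>q\<close> reaches
    \<open>m\<close>.\<close>
  define B where "B = {s. m \<le> q s} \<inter> {T..t}"
  have cont: "continuous_on UNIV q" using dq by (intro DERIV_continuous_on) blast
  have "closed {s. m \<le> q s}" by (intro closed_Collect_le continuous_intros cont)
  then have "compact B" unfolding B_def by (intro closed_Int_compact) auto
  moreover have "t \<in> B"
    using neg qm[of t] T[of t] unfolding B_def by (cases "t \<le> T") auto
  ultimately obtain s where s: "s \<in> B" "\<And>r. r \<in> B \<Longrightarrow> s \<le> r"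
    using compact_attains_inf[of B] by blast
  have before: "q r < m" if "r < s" for r
  proof (rule ccontr)
    assume "\<not> q r < m"
    then have "r \<in> B" using that s(1) T[of r] unfolding B_def by (cases "r \<le> T") auto
    with s(2)[of r] that show False by simp
  qed
  have "q s \<ge> m" using s(1) by (simp add: B_def)
  moreover have "q s \<le> m"
  proof (rule tendsto_upperbound[of q _ "at_left s"])
    show "(q \<longlongrightarrow> q s) (at_left s)"
      using DERIV_isCont[OF dq, of s] by (simp add: isCont_def filterlim_at_split)
    show "eventually (\<lambda>r. q r \<le> m) (at_left s)"
      unfolding eventually_at_filter using before by (auto intro!: always_eventually simp: less_imp_le)
  qed simp
  ultimately have qs: "q s = m" by simp
  have "P s < m * A s"
  proof -
    define D where "D = (\<lambda>r. m * A r - P r)"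
    have dD: "(D has_real_derivative P r * (m - q r)) (at r)" for r
      unfolding D_def by (auto intro!: derivative_eq_intros dA dP simp: algebra_simps)
    have "D r \<le> D s" if "r \<le> s" for r
    proof (rule DERIV_nonneg_imp_nondecreasing[OF that])
      fix x assume "x \<le> s"
      then have "0 \<le> P x * (m - q x)" using P_pos[of x] before[of x] qs by (cases "x = s") auto
      with dD[of x] show "\<exists>y. (D has_real_derivative y) (at x) \<and> 0 \<le> y" by blast
    qed
    then have "eventually (\<lambda>r. D r \<le> D s) at_bot"
      unfolding eventually_at_bot_linorder by blast
    moreover have "(D \<longlongrightarrow> m * (n - k) - 0) at_bot"
      unfolding D_def by (intro tendsto_intros A_bot P_bot)
    ultimately have "m * (n - k) - 0 \<le> D s" by (intro tendsto_upperbound[of D _ at_bot]) auto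
    moreover have "m * (n - k) > 0" using m k_le by simp
    ultimately show ?thesis by (simp add: D_def)
  qed
  \<comment> \<open>With \<open>q s = - 1 / c\<close> the terms \<open>- 1 - c * q s\<close> cancel,
    and only the part with \<open>q s * A s - P s > 0\<close> is left in the derivative of
    \<open>q\<close>. A decreasing \<open>q\<close> would have exceeded \<open>m\<close> just before
    \<open>s\<close>.\<close>
  then have "0 < (n - 1) * (q s * A s - P s) / (A s)\<^sup>2"
    using qs k_ge k_le A_pos[of s] by simp
  moreover have "- 1 - c * q s = 0" using c by (simp add: qs m_def)
  ultimately have "P s * (- 1 - c * q s - (n - 1) * (q s * A s - P s) / (A s)\<^sup>2) < 0"
    using P_pos[of s] by (intro mult_pos_neg) auto
  from DERIV_neg_dec_left[OF dq this] obtain d where "d > 0" "\<And>h. 0 < h \<Longrightarrow> h < d \<Longrightarrow> q s < q (s - h)"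
    by blast
  from this(2)[of "d / 2"] this(1) before[of "s - d / 2"] qs show False by simp
qed

text \<open>\<open>A + c * P\<close> has derivative \<open>P * (1 + c * q)\<close>, so it does not
  fall below its limit \<open>n - k > 0\<close> at the lower end.\<close>

lemma A_plus_cP_pos:
  assumes kc: "0 < 1 + k * c" shows "0 < A t + c * P t"
proof -
  define D where "D = (\<lambda>r. A r + c * P r)"
  have "(D has_real_derivative P r * (1 + c * q r)) (at r)" for r
    unfolding D_def by (auto intro!: derivative_eq_intros dA dP simp: algebra_simps)
  moreover have "0 \<le> P r * (1 + c * q r)" for r
    using P_pos[of r] q_less[OF kc, of r] by simp
  ultimately have "mono D" by (rule DERIV_nonneg_mono)
  moreover have "(D \<longlongrightarrow> (n - k) + c * 0) at_bot" "(D \<longlongrightarrow> (n + k) + c * 0) at_top"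
    unfolding D_def by (intro tendsto_intros A_bot P_bot A_top P_top)+
  ultimately have "(n - k) + c * 0 \<le> D t" by (rule mono_limits_at_bot_top(1))
  then show ?thesis using k_le by (simp add: D_def)
qed

end

section \<open>Positivity of the Ricci form and real radial profiles\<close>

lemma radial_norm: "radial h \<Longrightarrow> h x = h (of_real (cmod x))"
proof (cases "x = 0")
  case False
  then have "sgn x * of_real (cmod x) = x" by (simp add: sgn_eq)
  then show "radial h \<Longrightarrow> ?thesis" using radialD[of h "sgn x" "of_real (cmod x)"] False by (simp add: norm_sgn)
qed simp

lemma sum_cnj_Cauchy_Schwarz:
  fixes u v :: "'i \<Rightarrow> complex"
  shows "(cmod (\<Sum>l\<in>I. u l * v l))\<^sup>2 \<le> (\<Sum>l\<in>I. (cmod (u l))\<^sup>2) * (\<Sum>l\<in>I. (cmod (v l))\<^sup>2)"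
proof -
  have "cmod (\<Sum>l\<in>I. u l * v l) \<le> (\<Sum>l\<in>I. cmod (u l) * cmod (v l))"
    by (rule order_trans[OF norm_sum]) (simp add: norm_mult)
  then have "(cmod (\<Sum>l\<in>I. u l * v l))\<^sup>2 \<le> (\<Sum>l\<in>I. cmod (u l) * cmod (v l))\<^sup>2"
    by (intro power_mono) auto
  also have "\<dots> \<le> (\<Sum>l\<in>I. (cmod (u l))\<^sup>2) * (\<Sum>l\<in>I. (cmod (v l))\<^sup>2)"
    by (rule Cauchy_Schwarz_ineq_sum)
  finally show ?thesis .
qed

context invariant_chart
begin

lemma FS_form:
  "(\<Sum>i\<in>UNIV. \<Sum>l\<in>UNIV. FS u i l * v $ i * cnj (v $ l)) =
     of_real ((\<Sum>l\<in>- {j}. (cmod (v $ l))\<^sup>2) / nsq u - (cmod (\<Sum>l\<in>- {j}. cnj (u $ l) * v $ l))\<^sup>2 / (nsq u)\<^sup>2)"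
proof -
  define Z where "Z = (\<Sum>l\<in>- {j}. cnj (u $ l) * v $ l)"
  have QZ: "(\<Sum>i\<in>UNIV. Q u i * v $ i) = inverse (Nsq u) * Z"
  proof -
    have "(\<Sum>i\<in>UNIV. Q u i * v $ i) = (\<Sum>i\<in>- {j}. Q u i * v $ i)"
      by (rule sum.mono_neutral_right) (auto simp: Q_def)
    also have "\<dots> = (\<Sum>i\<in>- {j}. inverse (Nsq u) * (cnj (u $ i) * v $ i))"
      by (rule sum.cong) (auto simp: Q_def)
    finally show ?thesis by (simp add: sum_distrib_left Z_def)
  qed
  have cZ: "(\<Sum>l\<in>- {j}. u $ l * cnj (v $ l)) = cnj Z" by (simp add: Z_def)
  have "(\<Sum>i\<in>UNIV. \<Sum>l\<in>UNIV. FS u i l * v $ i * cnj (v $ l)) =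
      (\<Sum>l\<in>UNIV. \<Sum>i\<in>UNIV. FS u i l * v $ i * cnj (v $ l))" by (rule sum.swap)
  also have "\<dots> = (\<Sum>l\<in>- {j}. \<Sum>i\<in>UNIV. FS u i l * v $ i * cnj (v $ l))"
    by (rule sum.mono_neutral_right) (auto simp: FS_def)
  also have "\<dots> = (\<Sum>l\<in>- {j}. inverse (Nsq u) * (v $ l * cnj (v $ l))
      - inverse (Nsq u) * (inverse (Nsq u) * Z) * (u $ l * cnj (v $ l)))"
  proof (rule sum.cong[OF refl])
    fix l assume l: "l \<in> - {j}"
    have "(\<Sum>i\<in>UNIV. FS u i l * v $ i * cnj (v $ l)) =
        (\<Sum>i\<in>UNIV. (if i = l then inverse (Nsq u) * (v $ l * cnj (v $ l)) else 0)
           - inverse (Nsq u) * (u $ l * cnj (v $ l)) * (Q u i * v $ i))"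
      using l by (intro sum.cong) (auto simp: FS_def algebra_simps)
    also have "\<dots> = inverse (Nsq u) * (v $ l * cnj (v $ l))
        - inverse (Nsq u) * (u $ l * cnj (v $ l)) * (\<Sum>i\<in>UNIV. Q u i * v $ i)"
      unfolding sum_subtractf sum_distrib_left[symmetric] by simp
    finally show "(\<Sum>i\<in>UNIV. FS u i l * v $ i * cnj (v $ l)) = inverse (Nsq u) * (v $ l * cnj (v $ l))
        - inverse (Nsq u) * (inverse (Nsq u) * Z) * (u $ l * cnj (v $ l))"
      unfolding QZ by (simp add: ac_simps)
  qed
  also have "\<dots> = inverse (Nsq u) * (\<Sum>l\<in>- {j}. v $ l * cnj (v $ l)) - inverse (Nsq u) * (inverse (Nsq u) * Z) * cnj Z"
    unfolding sum_subtractf sum_distrib_left[symmetric] cZ ..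
  also have "(\<Sum>l\<in>- {j}. v $ l * cnj (v $ l)) = of_real (\<Sum>l\<in>- {j}. (cmod (v $ l))\<^sup>2)"
    unfolding of_real_sum complex_norm_square ..
  also have "inverse (Nsq u) * (inverse (Nsq u) * Z) * cnj Z = inverse (Nsq u) ^ 2 * of_real ((cmod Z)\<^sup>2)"
    unfolding complex_norm_square by (simp add: power2_eq_square ac_simps)
  finally show ?thesis
    unfolding Z_def[symmetric] Nsq_of_real by (simp add: divide_inverse power_inverse mult.commute)
qed

text \<open>Cauchy-Schwarz gives \<open>(cmod Z)^2 \<le> (nsq u - 1) * V\<close>. The missing
  \<open>1\<close>, due to \<open>z_j = 1\<close>, bounds the Fubini-Study part below by
  \<open>V / (nsq u)^2\<close>; for vertical vectors the square is positive instead.\<close>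

lemma positive_form_combination:
  assumes "0 < m" "0 < s"
    and G: "\<And>i l. X $ i $ l = FS u i l * complex_of_real m + complex_of_real s *
       (kap * xi u * Q u i + of_bool (i = j) * E u) * cnj (kap * xi u * Q u l + of_bool (l = j) * E u)"
  shows "positive_form X"
  unfolding positive_form_def
proof (intro allI impI)
  fix v :: "complex ^ 'n" assume v: "v \<noteq> 0"
  define Y where "Y = (\<lambda>i. kap * xi u * Q u i + of_bool (i = j) * E u)"
  define V where "V = (\<Sum>l\<in>- {j}. (cmod (v $ l))\<^sup>2)"
  define Z where "Z = (\<Sum>l\<in>- {j}. cnj (u $ l) * v $ l)"
  have prod: "(\<Sum>i\<in>UNIV. \<Sum>l\<in>UNIV. Y i * cnj (Y l) * v $ i * cnj (v $ l)) =
      of_real ((cmod (\<Sum>i\<in>UNIV. Y i * v $ i))\<^sup>2)"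
    unfolding complex_norm_square cnj_sum sum_product by (intro sum.cong refl) simp
  have "(\<Sum>i\<in>UNIV. \<Sum>l\<in>UNIV. X $ i $ l * v $ i * cnj (v $ l)) =
     (\<Sum>i\<in>UNIV. \<Sum>l\<in>UNIV. of_real m * (FS u i l * v $ i * cnj (v $ l)) + of_real s * (Y i * cnj (Y l) * v $ i * cnj (v $ l)))"
    by (intro sum.cong refl) (simp add: G Y_def algebra_simps)
  also have "\<dots> = of_real m * (\<Sum>i\<in>UNIV. \<Sum>l\<in>UNIV. FS u i l * v $ i * cnj (v $ l))
      + of_real s * (\<Sum>i\<in>UNIV. \<Sum>l\<in>UNIV. Y i * cnj (Y l) * v $ i * cnj (v $ l))"
    unfolding sum.distrib sum_distrib_left[symmetric] ..
  finally have form: "Re (\<Sum>i\<in>UNIV. \<Sum>l\<in>UNIV. X $ i $ l * v $ i * cnj (v $ l)) =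
      m * (V / nsq u - (cmod Z)\<^sup>2 / (nsq u)\<^sup>2) + s * (cmod (\<Sum>i\<in>UNIV. Y i * v $ i))\<^sup>2"
    unfolding FS_form prod V_def[symmetric] Z_def[symmetric] by simp
  have n: "nsq u \<ge> 1" by (rule nsq_ge_1)
  have "(cmod Z)\<^sup>2 \<le> (nsq u - 1) * V"
    using sum_cnj_Cauchy_Schwarz[where I = "- {j}" and u = "\<lambda>l. cnj (u $ l)" and v = "\<lambda>l. v $ l"] unfolding Z_def V_def nsq_def by simp
  then have "V / (nsq u)\<^sup>2 \<le> (nsq u * V - (cmod Z)\<^sup>2) / (nsq u)\<^sup>2"
    by (intro divide_right_mono) (auto simp: algebra_simps)
  also have "\<dots> = V / nsq u - (cmod Z)\<^sup>2 / (nsq u)\<^sup>2"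
    using n by (simp add: diff_divide_distrib power2_eq_square)
  finally have FS: "V / (nsq u)\<^sup>2 \<le> V / nsq u - (cmod Z)\<^sup>2 / (nsq u)\<^sup>2" .
  show "0 < Re (\<Sum>i\<in>UNIV. \<Sum>l\<in>UNIV. X $ i $ l * v $ i * cnj (v $ l))"
  proof (cases "\<exists>l\<in>- {j}. v $ l \<noteq> 0")
    case True
    then have "0 < V" unfolding V_def by (auto intro: sum_pos2)
    then have "0 < V / (nsq u)\<^sup>2" using n by simp
    with FS assms(1) have "0 < m * (V / nsq u - (cmod Z)\<^sup>2 / (nsq u)\<^sup>2)" by simp
    moreover have "0 \<le> s * (cmod (\<Sum>i\<in>UNIV. Y i * v $ i))\<^sup>2" using assms(2) by simp
    ultimately show ?thesis unfolding form by linarith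
  next
    case False
    then have v0: "v $ l = 0" if "l \<noteq> j" for l using that by auto
    with v have vj: "v $ j \<noteq> 0" by (metis vec_eq_iff zero_index)
    have "(\<Sum>i\<in>UNIV. Y i * v $ i) = (\<Sum>i\<in>UNIV. if i = j then E u * v $ j else 0)"
      by (rule sum.cong) (auto simp: v0 Y_def Q_def)
    then have "(\<Sum>i\<in>UNIV. Y i * v $ i) \<noteq> 0" using vj E_nonzero by simp
    then have "0 < s * (cmod (\<Sum>i\<in>UNIV. Y i * v $ i))\<^sup>2" using assms(2) by simp
    moreover have "0 \<le> V / (nsq u)\<^sup>2" unfolding V_def by (intro divide_nonneg_nonneg sum_nonneg) auto
    then have "0 \<le> m * (V / nsq u - (cmod Z)\<^sup>2 / (nsq u)\<^sup>2)" using FS assms(1) by simp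
    ultimately show ?thesis unfolding form by linarith
  qed
qed

definition ra :: "real \<Rightarrow> real" where "ra x = Re (alpha (of_real x))"

definition rb :: "real \<Rightarrow> real" where "rb x = Re (beta (of_real x))"

definition rb' :: "real \<Rightarrow> real" where "rb' x = Re (dz beta (of_real x) + dzbar beta (of_real x))"

lemma rb_pos: "0 < rb x"
  by (simp add: rb_def Re_beta_pos)

lemma alpha_ra: "alpha (of_real x) = of_real (ra x)" and beta_rb: "beta (of_real x) = of_real (rb x)"
  using alpha_real beta_real by (auto simp: ra_def rb_def)

lemma ra_derivative: "(ra has_real_derivative 2 * kap * x * rb x) (at x)"
  using wirtinger1_Re_derivative[OF wirtinger1_alpha[of "of_real x"]]
  unfolding ra_def[abs_def] by (rule DERIV_cong) (simp add: rb_def)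

lemma rb_derivative: "(rb has_real_derivative rb' x) (at x)"
  using wirtinger1_Re_derivative[OF wirtinger1_beta[of "of_real x"]]
  by (simp add: rb_def[abs_def] rb'_def)

text \<open>By the Euler relation both Wirtinger derivatives contribute equally to
  \<open>x * rb' x\<close>.\<close>

lemma dzbar_beta_real: "of_real x * dzbar beta (of_real x) = of_real (x * rb' x / 2)"
proof -
  have e: "of_real x * dz beta (of_real x) = of_real x * dzbar beta (of_real x)"
    using beta_euler[of "of_real x"] by (simp only: complex_cnj_complex_of_real)
  have "of_real x * dzbar beta (of_real x) = of_real x * (dz beta (of_real x) + dzbar beta (of_real x)) / 2"
    by (simp only: distrib_left e) simp
  also have "dz beta (of_real x) + dzbar beta (of_real x) = of_real (rb' x)"
    by (simp add: rb'_def dzbar_beta_cnj complex_eq_iff)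
  finally show ?thesis by simp
qed

end

context soliton_chart
begin

text \<open>On the real axis \<open>M\<close> is evaluated twice: by its definition, and by the
  integrated soliton equation with \<open>alpha 0\<close> inserted.\<close>

lemma real_equations:
  obtains c :: real
  where "\<And>x. (real CARD('n) - 1) * kap * x\<^sup>2 * rb x / ra x + x * rb' x / (2 * rb x) + ra x / kap + c * x\<^sup>2 * rb x =
      (CARD('n) - kap) / kap"
    and "\<And>u i l. ricci g (j, b) u $ i $ l =
      FS u i l * complex_of_real (ra (cmod (xi u)) + kap * c * (cmod (xi u))\<^sup>2 * rb (cmod (xi u))) +
      complex_of_real (rb (cmod (xi u)) + c * (rb (cmod (xi u)) + cmod (xi u) * rb' (cmod (xi u)) / 2)) *
       (kap * xi u * Q u i + of_bool (i = j) * E u) * cnj (kap * xi u * Q u l + of_bool (l = j) * E u)"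
proof -
  define n where "n = CARD('n)"
  obtain c :: real where S: "\<And>x. - S x = beta x + c * (beta x + cnj x * dzbar beta x)"
    and M: "\<And>x. M x + alpha x / kap + c * (x * cnj x * beta x) = alpha 0 / kap"
    by (rule fibre_equations) (rule that)
  have Mr: "M (of_real x) = of_real ((real n - 1) * kap * x\<^sup>2 * rb x / ra x + x * rb' x / (2 * rb x))" for x
  proof -
    have "M (of_real x) = (of_nat n - 1) * kap * (of_real x * of_real x * beta (of_real x)) * inverse (alpha (of_real x))
        + (of_real x * dzbar beta (of_real x)) * inverse (beta (of_real x))"
      unfolding M_def lam2_def n_def complex_cnj_complex_of_real distrib_left by (simp only: ac_simps)
    then show ?thesis
      unfolding dzbar_beta_real alpha_ra beta_rb
      by (simp only: divide_inverse power2_eq_square of_real_mult of_real_add of_real_diff of_real_1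
        of_real_of_nat_eq of_real_inverse inverse_mult_distrib of_real_numeral ac_simps)
  qed
  have M2: "M (of_real x) = of_real ((real n - kap) / kap - ra x / kap - c * x\<^sup>2 * rb x)" for x
  proof -
    have "M (of_real x) = alpha 0 / kap - alpha (of_real x) / kap - c * (of_real x * of_real x * beta (of_real x))"
      using M[of "of_real x"] unfolding complex_cnj_complex_of_real by (metis add_diff_cancel diff_diff_eq add.commute)
    then show ?thesis unfolding alpha_zero alpha_ra beta_rb by (simp add: n_def power2_eq_square)
  qed
  have 1: "(real n - 1) * kap * x\<^sup>2 * rb x / ra x + x * rb' x / (2 * rb x) + ra x / kap + c * x\<^sup>2 * rb x =
      (n - kap) / kap" for x
  proof -
    have "(real n - 1) * kap * x\<^sup>2 * rb x / ra x + x * rb' x / (2 * rb x) =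
        (real n - kap) / kap - ra x / kap - c * x\<^sup>2 * rb x"
      using trans[OF Mr[of x, symmetric] M2[of x]] by (simp only: of_real_eq_iff)
    then show ?thesis by simp
  qed
  have 2: "ricci g (j, b) u $ i $ l =
      FS u i l * complex_of_real (ra (cmod (xi u)) + kap * c * (cmod (xi u))\<^sup>2 * rb (cmod (xi u))) +
      complex_of_real (rb (cmod (xi u)) + c * (rb (cmod (xi u)) + cmod (xi u) * rb' (cmod (xi u)) / 2)) *
       (kap * xi u * Q u i + of_bool (i = j) * E u) * cnj (kap * xi u * Q u l + of_bool (l = j) * E u)" for u i l
  proof -
    define x where "x = cmod (xi u)"
    have "of_nat CARD('n) - kap - kap * M (xi u) = complex_of_real (real n - kap - kap * ((real n - kap) / kap - ra x / kap - c * x\<^sup>2 * rb x))"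
      unfolding radial_norm[OF radial_M, of "xi u"] x_def[symmetric] M2 by (simp add: n_def)
    also have "real n - kap - kap * ((real n - kap) / kap - ra x / kap - c * x\<^sup>2 * rb x) = ra x + kap * c * x\<^sup>2 * rb x"
      using kap_nonzero by (simp add: field_simps)
    finally have m: "of_nat CARD('n) - kap - kap * M (xi u) = complex_of_real (ra x + kap * c * x\<^sup>2 * rb x)" .
    have "- S (xi u) = beta (of_real x) + c * (beta (of_real x) + of_real x * dzbar beta (of_real x))"
      unfolding radial_norm[OF radial_S, of "xi u"] x_def[symmetric] S by simp
    then have s: "- S (xi u) = complex_of_real (rb x + c * (rb x + x * rb' x / 2))"
      unfolding dzbar_beta_real beta_rb by simp
    have "ricci g (j, b) u $ i $ l = FS u i l * (of_nat CARD('n) - kap - kap * M (xi u)) + (- S (xi u)) *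
       (kap * xi u * Q u i + of_bool (i = j) * E u) * cnj (kap * xi u * Q u l + of_bool (l = j) * E u)"
      unfolding ricci_formula by simp
    then show ?thesis unfolding m s x_def .
  qed
  show ?thesis by (rule that[OF 1[unfolded n_def] 2])
qed

end

section \<open>Joining the two ends of the fibre\<close>

lemma tensor_fibre_flip:
  fixes g :: "('n::finite) form_field"
  assumes "is_tensor k g" "x \<noteq> 0" "a \<noteq> j"
  shows "g (j, False) (axis j x) $ a $ a = g (j, True) (axis j (inverse x)) $ a $ a"
    and "g (j, False) (axis j x) $ j $ j =
      inverse (x ^ 2) * cnj (inverse (x ^ 2)) * g (j, True) (axis j (inverse x)) $ j $ j"
proof -
  let ?t = "transition k (j, False) (j, True)"
  have t: "?t u = (\<chi> l. if l = j then inverse (u $ j) else u $ l)" for u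
    by (simp add: transition_def chart_coords_def hom_coords_def Let_def vec_eq_iff)
  have h: "hom_coords (j, False) (axis j x) = axis j 1"
    by (auto simp: hom_coords_def vec_eq_iff axis_def)
  have "axis j x \<in> overlap (j, False) (j, True)"
    using assms(2) unfolding overlap_def mem_Collect_eq h in_chart_def by (simp add: axis_def)
  then have *: "g (j, False) (axis j x) = pullback_form ?t (g (j, True)) (axis j x)"
    using assms(1) unfolding is_tensor_def by blast
  have ti: "?t (axis j x) = axis j (inverse x)" by (auto simp: t vec_eq_iff axis_def)
  have d: "d_hol i (\<lambda>v. ?t v $ p) (axis j x) = (if i = p then (if p = j then - inverse (x ^ 2) else 1) else 0)" for i p
  proof (cases "p = j")
    case True
    have "wirtinger (\<lambda>v. inverse (v $ j)) (\<lambda>i. - (inverse (axis j x $ j) * inverse (axis j x $ j)) * of_bool (i = j))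
        (\<lambda>i. - (inverse (axis j x $ j) * inverse (axis j x $ j)) * 0) (axis j x)"
      by (rule wirtinger_inverse[OF wirtinger_coord]) (use assms(2) in \<open>simp add: axis_def\<close>)
    from wirtinger_d_hol[OF this, of i] show ?thesis
      using True by (simp add: t axis_def power2_eq_square)
  next
    case False
    with wirtinger_d_hol[OF wirtinger_coord, of i p "axis j x"] show ?thesis by (simp add: t)
  qed
  have "g (j, False) (axis j x) $ i $ i = (\<Sum>p\<in>UNIV. \<Sum>q\<in>UNIV. if q = i then (if p = i then
      (if i = j then inverse (x ^ 2) * cnj (inverse (x ^ 2)) else 1) * g (j, True) (axis j (inverse x)) $ i $ i else 0) else 0)" for i
    unfolding * pullback_form_def vec_lambda_beta ti d
    by (intro sum.cong refl) auto
  then have **: "g (j, False) (axis j x) $ i $ i =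
      (if i = j then inverse (x ^ 2) * cnj (inverse (x ^ 2)) else 1) * g (j, True) (axis j (inverse x)) $ i $ i" for i
    by simp
  from **[of a] assms(3) show "g (j, False) (axis j x) $ a $ a = g (j, True) (axis j (inverse x)) $ a $ a" by simp
  from **[of j] show "g (j, False) (axis j x) $ j $ j =
      inverse (x ^ 2) * cnj (inverse (x ^ 2)) * g (j, True) (axis j (inverse x)) $ j $ j" by simp
qed

lemma filterlim_exp_scaled_at_bot:
  fixes a :: real assumes "a > 0" shows "((\<lambda>t. exp (a * t)) \<longlongrightarrow> 0) at_bot"
  by (rule filterlim_compose[OF exp_at_bot]) (rule filterlim_tendsto_pos_mult_at_bot[OF tendsto_const assms filterlim_ident])

lemma filterlim_inverse_exp_scaled_at_top:
  fixes a :: real assumes "a > 0" shows "((\<lambda>t. inverse (exp (a * t))) \<longlongrightarrow> 0) at_top"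
proof -
  have "filterlim (\<lambda>t. exp (a * t)) at_top at_top"
    by (rule filterlim_compose[OF exp_at_top]) (rule filterlim_tendsto_pos_mult_at_top[OF tendsto_const assms filterlim_ident])
  then show ?thesis by (rule tendsto_inverse_0_at_top)
qed

text \<open>The two interpretations describe the ends \<open>y = 0\<close> and
  \<open>y = \<infinity>\<close>, with constants \<open>c\<close> and \<open>d\<close> that are a
  priori unrelated. A single profile in \<open>t\<close> joins them: its lower limits come from the
  first chart, its upper limits from the second.\<close>

lemma soliton_ricci_positive:
  fixes g :: "('n::finite) form_field"
  assumes n: "CARD('n) \<ge> 2" and k: "1 \<le> k" "k \<le> CARD('n) - 1"
    and chart: "soliton_chart k g j a0 f"
  shows "k = 1 \<Longrightarrow> positive_form (ricci g (j, b) u)"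
    and "positive_form (ricci g (j, False) 0) \<Longrightarrow> k = 1"
proof -
  interpret F: soliton_chart k g j a0 False f by (rule chart)
  interpret T: soliton_chart k g j a0 True f by (rule chart)
  define N where "N = real CARD('n)"
  define K where "K = real k"
  have K: "K \<ge> 1" "K \<le> N - 1" using n k by (auto simp: K_def N_def)
  have kap: "weight k False = K" "weight k True = - K" by (simp_all add: weight_def K_def)
  obtain c :: real where F1': "\<And>x. (real CARD('n) - 1) * weight k False * x\<^sup>2 * F.rb x / F.ra x + x * F.rb' x / (2 * F.rb x) +
      F.ra x / weight k False + c * x\<^sup>2 * F.rb x = (CARD('n) - weight k False) / weight k False"
    and F2: "\<And>u i l. ricci g (j, False) u $ i $ l =
      F.FS u i l * complex_of_real (F.ra (cmod (F.xi u)) + weight k False * c * (cmod (F.xi u))\<^sup>2 * F.rb (cmod (F.xi u))) +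
      complex_of_real (F.rb (cmod (F.xi u)) + c * (F.rb (cmod (F.xi u)) + cmod (F.xi u) * F.rb' (cmod (F.xi u)) / 2)) *
       (weight k False * F.xi u * F.Q u i + of_bool (i = j) * F.E u) *
       cnj (weight k False * F.xi u * F.Q u l + of_bool (l = j) * F.E u)"
    by (rule F.real_equations) (rule that)
  note F1 = F1'[unfolded kap, folded N_def]
  obtain d :: real where T1': "\<And>x. (real CARD('n) - 1) * weight k True * x\<^sup>2 * T.rb x / T.ra x + x * T.rb' x / (2 * T.rb x) +
      T.ra x / weight k True + d * x\<^sup>2 * T.rb x = (CARD('n) - weight k True) / weight k True"
    and T2: "\<And>u i l. ricci g (j, True) u $ i $ l =
      T.FS u i l * complex_of_real (T.ra (cmod (T.xi u)) + weight k True * d * (cmod (T.xi u))\<^sup>2 * T.rb (cmod (T.xi u))) +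
      complex_of_real (T.rb (cmod (T.xi u)) + d * (T.rb (cmod (T.xi u)) + cmod (T.xi u) * T.rb' (cmod (T.xi u)) / 2)) *
       (weight k True * T.xi u * T.Q u i + of_bool (i = j) * T.E u) *
       cnj (weight k True * T.xi u * T.Q u l + of_bool (l = j) * T.E u)"
    by (rule T.real_equations) (rule that)
  note T1 = T1'[unfolded kap, folded N_def]
  have tensor: "is_tensor k g" using F.kahler by (simp add: kahler_metric_def)
  have ra: "F.ra x = T.ra (inverse x)" if "x \<noteq> 0" for x :: real
    using tensor_fibre_flip(1)[OF tensor _ F.a0, of "of_real x"] that
    by (simp add: F.ra_def T.ra_def F.alpha_def T.alpha_def)
  have rb: "F.rb x = inverse (x ^ 4) * T.rb (inverse x)" if "x \<noteq> 0" for x :: real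
  proof -
    have "F.beta (of_real x) = of_real (inverse (x ^ 4)) * T.beta (of_real (inverse x))"
      using tensor_fibre_flip(2)[OF tensor _ F.a0, of "of_real x"] that
      by (simp add: F.beta_def T.beta_def power4_eq_xxxx power2_eq_square)
    then show ?thesis unfolding F.beta_rb T.beta_rb by (simp only: of_real_mult[symmetric] of_real_eq_iff)
  qed
  have ra0: "F.ra 0 = N - K" "T.ra 0 = N + K"
    using F.alpha_zero T.alpha_zero by (simp_all add: F.ra_def T.ra_def N_def kap)
  \<comment> \<open>The field \<open>y d/dy\<close> changes sign under
    \<open>y \<mapsto> 1 / y\<close>. The resulting relation is verified by comparing both equations
    at \<open>x = 1\<close>, where the flip relates values and derivatives.\<close>
  have d: "d = - c"
  proof -
    have "((\<lambda>x. inverse (x ^ 4) * T.rb (inverse x)) has_real_derivative - 4 * T.rb 1 - T.rb' 1) (at 1)"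
      by (rule derivative_eq_intros DERIV_chain2[OF T.rb_derivative] | simp)+
    moreover have "eventually (\<lambda>x. F.rb x = inverse (x ^ 4) * T.rb (inverse x)) (nhds 1)"
      unfolding eventually_nhds by (intro exI[of _ "- {0}"]) (simp add: rb open_Compl)
    ultimately have "(F.rb has_real_derivative - 4 * T.rb 1 - T.rb' 1) (at 1)"
      using DERIV_cong_ev[of 1 1 F.rb "\<lambda>x. inverse (x ^ 4) * T.rb (inverse x)"] by blast
    then have rb1: "F.rb' 1 = - 4 * T.rb 1 - T.rb' 1" using F.rb_derivative DERIV_unique by blast
    have eq1: "F.rb 1 = T.rb 1" "F.ra 1 = T.ra 1" using ra[of 1] rb[of 1] by simp_all
    have "(N - 1) * K * T.rb 1 / T.ra 1 + (- 4 * T.rb 1 - T.rb' 1) / (2 * T.rb 1) + T.ra 1 / K + c * T.rb 1 = (N - K) / K"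
      using F1[of 1] unfolding rb1 eq1 by simp
    moreover have "- ((N - 1) * K * T.rb 1 / T.ra 1) + T.rb' 1 / (2 * T.rb 1) - T.ra 1 / K + d * T.rb 1 = - ((N + K) / K)"
      using T1[of 1] by simp
    ultimately have "(- 4 * T.rb 1 - T.rb' 1) / (2 * T.rb 1) + T.rb' 1 / (2 * T.rb 1) + (c + d) * T.rb 1 =
        (N - K) / K - (N + K) / K"
      unfolding distrib_right by linarith
    moreover have "(N - K) / K - (N + K) / K = - 2" using K by (simp add: field_simps)
    moreover have "(- 4 * T.rb 1 - T.rb' 1) / (2 * T.rb 1) + T.rb' 1 / (2 * T.rb 1) = - 2"
      using T.rb_pos[of 1] by (simp add: field_simps)
    ultimately have "(c + d) * T.rb 1 = 0" by simp
    then show ?thesis using T.rb_pos[of 1] by simp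
  qed
  \<comment> \<open>\<open>|y| = |z|^k = exp (k / 2 * t)\<close> for
    \<open>t = ln |z|^2\<close>.\<close>
  define Y where "Y = (\<lambda>t. exp (K / 2 * t))"
  define A where "A = (\<lambda>t. F.ra (Y t))"
  define P where "P = (\<lambda>t. K\<^sup>2 * (Y t)\<^sup>2 * F.rb (Y t))"
  define q where "q = (\<lambda>t. N - A t - (N - 1) * P t / A t - c / K * P t)"
  have Y_pos: "Y t > 0" for t by (simp add: Y_def)
  have dY: "(Y has_real_derivative K / 2 * Y t) (at t)" for t
    unfolding Y_def by (auto intro!: derivative_eq_intros)
  \<comment> \<open>The soliton equation identifies \<open>q\<close> with the logarithmic derivative
    of \<open>P\<close>.\<close>
  have q_eq: "q t = K * (1 + Y t * F.rb' (Y t) / (2 * F.rb (Y t)))" for t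
  proof -
    have "K * ((N - 1) * K * (Y t)\<^sup>2 * F.rb (Y t) / F.ra (Y t) + Y t * F.rb' (Y t) / (2 * F.rb (Y t)) +
        F.ra (Y t) / K + c * (Y t)\<^sup>2 * F.rb (Y t)) = K * ((N - K) / K)"
      by (simp only: F1)
    then have "K * ((N - 1) * K * (Y t)\<^sup>2 * F.rb (Y t) / F.ra (Y t)) + K * (Y t * F.rb' (Y t) / (2 * F.rb (Y t))) +
        F.ra (Y t) + K * c * (Y t)\<^sup>2 * F.rb (Y t) = N - K"
      using K by (simp add: distrib_left)
    moreover have "K * ((N - 1) * K * (Y t)\<^sup>2 * F.rb (Y t) / F.ra (Y t)) = (N - 1) * P t / A t"
      "K * c * (Y t)\<^sup>2 * F.rb (Y t) = c / K * P t" "F.ra (Y t) = A t"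
      using K by (simp_all add: A_def P_def power2_eq_square)
    ultimately have "(N - 1) * P t / A t + K * (Y t * F.rb' (Y t) / (2 * F.rb (Y t))) + A t + c / K * P t = N - K"
      by (simp only:)
    then show ?thesis unfolding q_def distrib_left mult_1_right by linarith
  qed
  have conts: "isCont F.ra x" "isCont F.rb x" "isCont T.ra x" "isCont T.rb x" for x
    using F.ra_derivative F.rb_derivative T.ra_derivative T.rb_derivative by (blast intro: DERIV_isCont)+
  have Y_bot: "(Y \<longlongrightarrow> 0) at_bot"
    unfolding Y_def using K by (intro filterlim_exp_scaled_at_bot) simp
  have Y_top: "((\<lambda>t. inverse (Y t)) \<longlongrightarrow> 0) at_top"
    unfolding Y_def using K by (intro filterlim_inverse_exp_scaled_at_top) simp
  \<comment> \<open>The chart constant refers to \<open>y\<close>, the profile to \<open>t\<close>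
    with \<open>|y| = exp (K / 2 * t)\<close>; hence the division by \<open>K\<close>, after which
    the threshold \<open>1 + K * (c / K)\<close> is \<open>1 + c\<close>.\<close>
  interpret soliton_profile N K "c / K" A P q
  proof
    show "1 \<le> K" "K \<le> N - 1" by (fact K)+
    show "q t = N - A t - (N - 1) * P t / A t - c / K * P t" for t by (simp add: q_def)
    show "(A has_real_derivative P t) (at t)" for t
      using DERIV_chain2[OF F.ra_derivative dY, of t] unfolding A_def
      by (rule DERIV_cong) (simp add: P_def kap power2_eq_square)
    show "(P has_real_derivative P t * q t) (at t)" for t
      unfolding P_def q_eq using F.rb_pos[of "Y t"]
      by (auto intro!: derivative_eq_intros dY DERIV_chain2[OF F.rb_derivative dY] simp: field_simps power2_eq_square)
    show "0 < P t" for t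
      using K F.rb_pos[of "Y t"] Y_pos[of t] by (simp add: P_def)
    show "(A \<longlongrightarrow> N - K) at_bot"
      unfolding A_def ra0[symmetric] by (rule isCont_tendsto_compose[OF conts(1) Y_bot])
    have "(P \<longlongrightarrow> K\<^sup>2 * 0\<^sup>2 * F.rb 0) at_bot"
      unfolding P_def by (intro tendsto_intros Y_bot isCont_tendsto_compose[OF conts(2) Y_bot])
    then show "(P \<longlongrightarrow> 0) at_bot" by simp
    have "A = (\<lambda>t. T.ra (inverse (Y t)))" using Y_pos by (auto simp: A_def fun_eq_iff ra less_imp_neq[symmetric])
    then show "(A \<longlongrightarrow> N + K) at_top"
      unfolding ra0[symmetric] by (simp only: isCont_tendsto_compose[OF conts(3) Y_top])
    have "P t = K\<^sup>2 * (inverse (Y t))\<^sup>2 * T.rb (inverse (Y t))" for t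
    proof -
      have "(Y t)\<^sup>2 * inverse (Y t ^ 4) = (inverse (Y t))\<^sup>2"
        using Y_pos[of t] by (simp add: field_simps power4_eq_xxxx power2_eq_square)
      moreover have "F.rb (Y t) = inverse (Y t ^ 4) * T.rb (inverse (Y t))"
        using Y_pos[of t] by (intro rb) simp
      ultimately show ?thesis by (simp add: P_def mult.assoc[symmetric])
    qed
    then have P_flip: "P = (\<lambda>t. K\<^sup>2 * (inverse (Y t))\<^sup>2 * T.rb (inverse (Y t)))" by (rule ext)
    have "(P \<longlongrightarrow> K\<^sup>2 * 0\<^sup>2 * T.rb 0) at_top"
      unfolding P_flip by (intro tendsto_intros Y_top isCont_tendsto_compose[OF conts(4) Y_top])
    then show "(P \<longlongrightarrow> 0) at_top" by simp
  qed
  have surj: "\<exists>t. Y t = x" if "x > 0" for x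
    using that K by (intro exI[of _ "2 / K * ln x"]) (simp add: Y_def)
  show "k = 1" if pos: "positive_form (ricci g (j, False) 0)"
  proof -
    have "axis j (1::complex) \<noteq> 0" by (simp add: axis_eq_0_iff)
    then have "0 < Re (\<Sum>p\<in>UNIV. \<Sum>q\<in>UNIV. ricci g (j, False) 0 $ p $ q * axis j 1 $ p * cnj (axis j 1 $ q))"
      using pos unfolding positive_form_def by blast
    also have "(\<Sum>p\<in>UNIV. \<Sum>q\<in>UNIV. ricci g (j, False) 0 $ p $ q * axis j 1 $ p * cnj (axis j 1 $ q)) =
       (\<Sum>p\<in>UNIV. \<Sum>q\<in>UNIV. if q = j then (if p = j then ricci g (j, False) 0 $ j $ j else 0) else 0)"
      by (intro sum.cong refl) (auto simp: axis_def)
    also have "\<dots> = ricci g (j, False) 0 $ j $ j" by simp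
    \<comment> \<open>At the origin \<open>xi\<close> vanishes, which removes the term with
      \<open>rb'\<close>, and the Fubini-Study component with index \<open>j\<close> is
      zero.\<close>
    also have "\<dots> = of_real (F.rb 0 * (1 + c))"
    proof -
      have "axis j 0 = (0 :: complex ^ 'n)" by (simp add: vec_eq_iff axis_def)
      with F.axis_simps[of 0] show ?thesis
        unfolding F2 by (simp add: F.FS_def algebra_simps)
    qed
    finally have "0 < F.rb 0 * (1 + c)" by simp
    then have "0 < 1 + c" using F.rb_pos[of 0] by (simp add: zero_less_mult_iff)
    then have "0 < 1 + K * (c / K)" using K by simp
    with c_upper have "K < 2" by (meson not_le)
    then show "k = 1" using k(1) by (simp add: K_def)
  qed
  show "positive_form (ricci g (j, b) u)" if k1: "k = 1"
  proof -
    have "K = 1" using k1 by (simp add: K_def)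
    with c_lower have "- 1 < c / K" by blast
    then have kc: "0 < 1 + K * (c / K)" using \<open>K = 1\<close> by simp
    \<comment> \<open>\<open>Y\<close> does not reach the sections. There the vertical coefficients
      are \<open>F.rb 0 * (1 + c)\<close> and \<open>T.rb 0 * (1 - c)\<close>, so both signs are
      needed.\<close>
    have c0: "c < 0" "0 < 1 + c" using c_neg kc K by (auto simp: divide_less_0_iff)
    have m: "0 < F.ra (Y t) + K * c * (Y t)\<^sup>2 * F.rb (Y t)" for t
    proof -
      have "A t + c / K * P t = F.ra (Y t) + K * c * (Y t)\<^sup>2 * F.rb (Y t)"
        using K by (simp add: A_def P_def power2_eq_square)
      then show ?thesis using A_plus_cP_pos[OF kc, of t] by simp
    qed
    have s: "0 < 1 + c / K * q t" for t by (rule q_less[OF kc])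
    show ?thesis
    proof (cases b)
      case False
      have mF: "0 < F.ra x + weight k False * c * x\<^sup>2 * F.rb x" and sF: "0 < F.rb x + c * (F.rb x + x * F.rb' x / 2)"
        if x: "x \<ge> 0" for x
      proof -
        consider "x = 0" | t where "x = Y t" using surj[of x] x by (cases "x = 0") auto
        then have "0 < F.ra x + K * c * x\<^sup>2 * F.rb x \<and> 0 < F.rb x + c * (F.rb x + x * F.rb' x / 2)"
        proof cases
          case 1
          have "F.rb 0 * (1 + c) > 0" using F.rb_pos[of 0] c0 by simp
          then show ?thesis using 1 ra0 K by (simp add: algebra_simps)
        next
          case 2
          have "F.rb x * (1 + c / K * q t) = F.rb x + c * (F.rb x + x * F.rb' x / 2)"
            unfolding q_eq using F.rb_pos[of x] K 2 by (simp add: field_simps)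
          moreover have "F.rb x * (1 + c / K * q t) > 0" using s[of t] F.rb_pos[of x] by simp
          ultimately show ?thesis using m[of t] 2 by simp
        qed
        then show "0 < F.ra x + weight k False * c * x\<^sup>2 * F.rb x" "0 < F.rb x + c * (F.rb x + x * F.rb' x / 2)" by (auto simp: kap)
      qed
      have "positive_form (ricci g (j, False) u)"
        by (rule F.positive_form_combination[OF mF[of "cmod (F.xi u)"] sF[of "cmod (F.xi u)"] F2]) simp_all
      then show ?thesis using False by simp
    next
      case True
      have mT: "0 < T.ra x + weight k True * d * x\<^sup>2 * T.rb x" and sT: "0 < T.rb x + d * (T.rb x + x * T.rb' x / 2)"
        if x: "x \<ge> 0" for x
      proof -
        consider "x = 0" | t where "inverse x = Y t" "x > 0" using surj[of "inverse x"] x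
          by (metis inverse_positive_iff_positive order_le_less)
        then have "0 < T.ra x + (- K) * d * x\<^sup>2 * T.rb x \<and> 0 < T.rb x + d * (T.rb x + x * T.rb' x / 2)"
        proof cases
          case 1
          have "T.rb 0 * (1 - c) > 0" using T.rb_pos[of 0] c0 by simp
          then show ?thesis using 1 ra0 K by (simp add: d algebra_simps)
        next
          case 2
          have Yx: "inverse (Y t) = x" "Y t \<noteq> 0" using 2 by (auto simp: 2(1)[symmetric])
          have rax: "T.ra x = A t" using ra[of "Y t"] Yx by (simp add: A_def)
          have "(Y t)\<^sup>2 * inverse (Y t ^ 4) = (inverse (Y t))\<^sup>2"
            using Yx(2) by (simp add: field_simps power4_eq_xxxx power2_eq_square)
          then have rbx: "x\<^sup>2 * T.rb x = (Y t)\<^sup>2 * F.rb (Y t)"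
            using rb[of "Y t"] Yx by (simp add: mult.assoc[symmetric])
          have PT: "P t = K\<^sup>2 * (x\<^sup>2 * T.rb x)" unfolding rbx by (simp add: P_def)
          have "T.ra x + (- K) * d * x\<^sup>2 * T.rb x = A t + K * c * ((Y t)\<^sup>2 * F.rb (Y t))"
            unfolding rbx[symmetric] by (simp add: rax d)
          then have 1: "0 < T.ra x + (- K) * d * x\<^sup>2 * T.rb x" using m[of t] by (simp add: A_def mult.assoc)
          \<comment> \<open>At this end \<open>x\<close> decreases as \<open>t\<close> grows, so the
            logarithmic derivative changes sign. With \<open>d = - c\<close> the vertical
            coefficient again has the factor \<open>1 + c / K * q t\<close>.\<close>
          have "1 + x * T.rb' x / (2 * T.rb x) = - q t / K"
          proof -
            have "K * ((N - 1) * (- K) * x\<^sup>2 * T.rb x / T.ra x + x * T.rb' x / (2 * T.rb x) + T.ra x / (- K) + d * x\<^sup>2 * T.rb x) =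
                K * ((N - - K) / (- K))" by (simp only: T1)
            moreover have "K * ((N - 1) * (- K) * x\<^sup>2 * T.rb x / T.ra x) = - ((N - 1) * (K * K * (x\<^sup>2 * T.rb x)) / T.ra x)"
              by (simp add: ac_simps)
            moreover have "K * (T.ra x / (- K)) = - T.ra x" "K * ((N - - K) / (- K)) = - (N + K)"
              using K by auto
            moreover have "K * (d * x\<^sup>2 * T.rb x) = - (K * c * (x\<^sup>2 * T.rb x))" by (simp add: d)
            ultimately have "- ((N - 1) * (K * K * (x\<^sup>2 * T.rb x)) / T.ra x) + K * (x * T.rb' x / (2 * T.rb x)) - T.ra x - K * c * (x\<^sup>2 * T.rb x) =
                - (N + K)" unfolding distrib_left by linarith
            moreover have "q t = N - T.ra x - (N - 1) * (K * K * (x\<^sup>2 * T.rb x)) / T.ra x - K * c * (x\<^sup>2 * T.rb x)"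
              unfolding q_def PT rax using K by (simp add: power2_eq_square)
            ultimately have "q t = - (K * 1 + K * (x * T.rb' x / (2 * T.rb x)))" by linarith
            then have "q t = - (K * (1 + x * T.rb' x / (2 * T.rb x)))" by (simp only: distrib_left)
            then show ?thesis using K by simp
          qed
          then have "T.rb x * (1 + c / K * q t) = T.rb x * (1 - c * (1 + x * T.rb' x / (2 * T.rb x)))" by simp
          also have "\<dots> = T.rb x + d * (T.rb x + x * T.rb' x / 2)"
            using T.rb_pos[of x] by (simp add: d field_simps)
          finally have "T.rb x + d * (T.rb x + x * T.rb' x / 2) > 0"
            using s[of t] T.rb_pos[of x] by (metis mult_pos_pos)
          with 1 show ?thesis by blast
        qed
        then show "0 < T.ra x + weight k True * d * x\<^sup>2 * T.rb x" "0 < T.rb x + d * (T.rb x + x * T.rb' x / 2)" by (auto simp: kap)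
      qed
      have "positive_form (ricci g (j, True) u)"
        by (rule T.positive_form_combination[OF mT[of "cmod (T.xi u)"] sT[of "cmod (T.xi u)"] T2]) simp_all
      then show ?thesis using True by simp
    qed
  qed
qed

theorem mainTheorem4:
  fixes k :: nat
    and g :: "'n::finite chart \<Rightarrow> complex ^ 'n \<Rightarrow> complex ^ 'n ^ 'n"
  assumes "CARD('n) \<ge> 2"
    and "1 \<le> k" and "k \<le> CARD('n) - 1"
    and "shrinking_gradient_KR_soliton k g"
    and "U_invariant k g"
  shows "positive_ricci g \<longleftrightarrow> k = 1"
proof -
  obtain f where f: "smooth_on_Mk k f" "\<And>c u i j.
      ricci g c u $ i $ j - g c u $ i $ j = hess_mixed (\<lambda>v. complex_of_real (f (point k c v))) u i j"
    "\<And>c u i j. hess_hol g c (\<lambda>v. complex_of_real (f (point k c v))) u i j = 0"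
    using assms(4) unfolding shrinking_gradient_KR_soliton_def by blast
  have kahler: "kahler_metric k g" using assms(4) by (simp add: shrinking_gradient_KR_soliton_def)
  have other: "\<exists>a. a \<noteq> j" for j :: 'n
  proof (rule ccontr)
    assume "\<nexists>a. a \<noteq> j"
    then have "UNIV = {j}" by auto
    then have "CARD('n) = 1" by (metis card.empty card_insert_disjoint empty_iff finite.emptyI One_nat_def)
    with assms(1) show False by simp
  qed
  have chart: "soliton_chart k g j a f" if "a \<noteq> j" for j a
    using that assms(2,5) kahler f by unfold_locales auto
  show ?thesis
  proof
    assume pos: "positive_ricci g"
    obtain j a :: 'n where "a \<noteq> j" using other by blast
    from soliton_ricci_positive(2)[OF assms(1-3) chart[OF this]] pos
    show "k = 1" unfolding positive_ricci_def by blast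
  next
    assume k1: "k = 1"
    show "positive_ricci g"
      unfolding positive_ricci_def
    proof (intro allI)
      fix c :: "'n chart" and u
      obtain j b where c: "c = (j, b)" by (cases c)
      obtain a where "a \<noteq> j" using other by blast
      from soliton_ricci_positive(1)[OF assms(1-3) chart[OF this] k1]
      show "positive_form (ricci g c u)" unfolding c by blast
    qed
  qed
qed

end
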